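(* Let $d\ge 1$ be an integer, $0<\alpha\le2$, $0<\beta\le1$, $\gamma\ge0$, $V>0$. If $\gamma<\alpha$ and $d\ge\alpha/\beta+\gamma$, then the $(d,\alpha,\beta,\gamma)$-branching particle system does not have the a.s. local extinction property.
   Context: The $(d,\alpha,\beta,\gamma)$-branching particle system: particles move independently in $\mathbb{R}^d$ according to the standard spherically symmetric $\alpha$-stable Lévy process (characteristic function $e^{-t|z|^\alpha}$); each lifetime is exponential with parameter $V$; at death a particle is replaced, at its location, by a random number of offspring with generating function $s+\frac{1}{1+\beta}(1-s)^{1+\beta}$, $0<s<1$; motions, lifetimes and branchings are independent; the initial configuration $N_0$ is a Poisson random measure with intensity $\mu_\gamma(dx)=\frac{1}{1+|x|^\gamma}dx$. $N_t(A)$ is the number of particles in the Borel set $A$ at time $t$. The system has the a.s. local extinction property if for each bounded Borel set $A\subset\mathbb{R}^d$ there is a finite random time $\tau_A$ such that $N_t(A)=0$ for all $t\ge\tau_A$ a.s. *)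

theory Defs
  imports "HOL-Probability.Probability"
begin

section \<open>Stable L\'evy processes\<close>

definition cadlag :: "(real \<Rightarrow> 'a::topological_space) \<Rightarrow> bool" where
  "cadlag f \<longleftrightarrow>
     (\<forall>t\<ge>0. (f \<longlongrightarrow> f t) (at_right t)) \<and> (\<forall>t>0. \<exists>l. (f \<longlongrightarrow> l) (at_left t))"

text \<open>Processes are indexed by the type \<^typ>\<open>real\<close>, but only times \<open>t \<ge> 0\<close> are meaningful.\<close>

definition levy_process :: "'w measure \<Rightarrow> (real \<Rightarrow> 'w \<Rightarrow> 'a::euclidean_space) \<Rightarrow> bool" where
  "levy_process M X \<longleftrightarrow>
     (\<forall>t\<ge>0. X t \<in> borel_measurable M) \<and>
     (AE \<omega> in M. X 0 \<omega> = 0) \<and>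
     (\<forall>(n::nat) (t::nat \<Rightarrow> real). 0 \<le> t 0 \<and> (\<forall>i<n. t i \<le> t (Suc i)) \<longrightarrow>
        prob_space.indep_vars M (\<lambda>_. borel) (\<lambda>i \<omega>. X (t (Suc i)) \<omega> - X (t i) \<omega>) {..<n}) \<and>
     (\<forall>s\<ge>0. \<forall>t\<ge>0. distr M borel (\<lambda>\<omega>. X (s + t) \<omega> - X s \<omega>) = distr M borel (X t)) \<and>
     (AE \<omega> in M. cadlag (\<lambda>t. X t \<omega>))"

definition stable_levy_process ::
    "'w measure \<Rightarrow> real \<Rightarrow> (real \<Rightarrow> 'w \<Rightarrow> 'a::euclidean_space) \<Rightarrow> bool" where
  "stable_levy_process M \<alpha> X \<longleftrightarrow>
     levy_process M X \<and>
     (\<forall>t\<ge>0. \<forall>z. (LINT \<omega>|M. iexp (z \<bullet> X t \<omega>)) = complex_of_real (exp (- t * norm z powr \<alpha>)))"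


section \<open>Poisson random measures\<close>

definition poisson_random_measure ::
    "'w measure \<Rightarrow> 'a measure \<Rightarrow> ('w \<Rightarrow> 'a measure) \<Rightarrow> bool" where
  "poisson_random_measure M \<mu> N \<longleftrightarrow>
     (\<forall>\<omega>\<in>space M. sets (N \<omega>) = sets \<mu>) \<and>
     (\<forall>A\<in>sets \<mu>. (\<lambda>\<omega>. emeasure (N \<omega>) A) \<in> borel_measurable M) \<and>
     (\<forall>A\<in>sets \<mu>. emeasure \<mu> A < \<infinity> \<longrightarrow>
        (\<forall>k::nat. measure M {\<omega> \<in> space M. emeasure (N \<omega>) A = of_nat k}
                    = exp (- measure \<mu> A) * measure \<mu> A ^ k / fact k)) \<and>
     (\<forall>A\<in>sets \<mu>. emeasure \<mu> A = \<infinity> \<longrightarrow> (AE \<omega> in M. emeasure (N \<omega>) A = \<infinity>)) \<and>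
     (\<forall>(n::nat) A. (\<forall>i<n. A i \<in> sets \<mu>) \<and> disjoint_family_on A {..<n} \<longrightarrow>
        prob_space.indep_vars M (\<lambda>_. borel) (\<lambda>i \<omega>. emeasure (N \<omega>) (A i)) {..<n})"

text \<open>For \<open>\<gamma> = 0\<close> the convention \<open>0 powr 0 = 0\<close> changes the density \<open>1/2\<close> only at the
  origin, which is Lebesgue-null.\<close>

definition initial_intensity :: "real \<Rightarrow> 'a::euclidean_space measure" where
  "initial_intensity \<gamma> = density lborel (\<lambda>x. ennreal (1 / (1 + norm x powr \<gamma>)))"


section \<open>Deterministic evolution of the particle system\<close>

text \<open>Ulam--Harris labels: \<open>Root i\<close> is the \<open>i\<close>-th initial particle and \<open>Child u k\<close> the \<open>k\<close>-th
  offspring (counted from 0) of \<open>u\<close>. Lifetimes, offspring numbers and motions are attached to all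
  labels; \<open>exists_particle\<close> singles out the labels of particles that ever live, and a particle
  uses its motion only during its own lifetime. There are \<open>n\<close> initial particles, possibly
  infinitely many, at \<open>x 0, x 1, \<dots>\<close>.\<close>

datatype label = Root nat | Child label nat

primrec exists_particle :: "enat \<Rightarrow> (label \<Rightarrow> nat) \<Rightarrow> label \<Rightarrow> bool" where
  "exists_particle n offspring (Root i) \<longleftrightarrow> enat i < n"
| "exists_particle n offspring (Child u k) \<longleftrightarrow> exists_particle n offspring u \<and> k < offspring u"

primrec birth_time :: "(label \<Rightarrow> real) \<Rightarrow> label \<Rightarrow> real" where
  "birth_time lifetime (Root i) = 0"
| "birth_time lifetime (Child u k) = birth_time lifetime u + lifetime u"

primrec birth_place ::
    "(nat \<Rightarrow> 'a::euclidean_space) \<Rightarrow> (label \<Rightarrow> real \<Rightarrow> 'a) \<Rightarrow> (label \<Rightarrow> real) \<Rightarrow> label \<Rightarrow> 'a" where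
  "birth_place x motion lifetime (Root i) = x i"
| "birth_place x motion lifetime (Child u k) =
     birth_place x motion lifetime u + motion u (lifetime u)"

definition alive_at :: "enat \<Rightarrow> (label \<Rightarrow> real) \<Rightarrow> (label \<Rightarrow> nat) \<Rightarrow> real \<Rightarrow> label set" where
  "alive_at n lifetime offspring t =
     {u. exists_particle n offspring u \<and>
         birth_time lifetime u \<le> t \<and> t < birth_time lifetime u + lifetime u}"

definition position_at ::
    "(nat \<Rightarrow> 'a::euclidean_space) \<Rightarrow> (label \<Rightarrow> real \<Rightarrow> 'a) \<Rightarrow> (label \<Rightarrow> real) \<Rightarrow> real \<Rightarrow> label \<Rightarrow> 'a" where
  "position_at x motion lifetime t u =
     birth_place x motion lifetime u + motion u (t - birth_time lifetime u)"

text \<open>Counting measures: the value on a Borel set \<open>A\<close> is the number of labels in the index set whose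
  point lies in \<open>A\<close>, see \<open>emeasure_counting\<close>.\<close>

definition counting :: "'i set \<Rightarrow> ('i \<Rightarrow> 'a::euclidean_space) \<Rightarrow> 'a measure" where
  "counting I p = distr (count_space I) borel p"

lemma emeasure_counting:
  assumes "A \<in> sets borel"
  shows "emeasure (counting I p) A =
           (if finite {i \<in> I. p i \<in> A} then of_nat (card {i \<in> I. p i \<in> A}) else \<infinity>)"
proof -
  have "p -` A \<inter> space (count_space I) = {i \<in> I. p i \<in> A}"
    by auto
  then show ?thesis
    using assms by (simp add: counting_def emeasure_distr emeasure_count_space)
qed

definition particles_at ::
    "('w \<Rightarrow> enat) \<Rightarrow> (nat \<Rightarrow> 'w \<Rightarrow> 'a::euclidean_space) \<Rightarrow> (label \<Rightarrow> real \<Rightarrow> 'w \<Rightarrow> 'a) \<Rightarrow>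
     (label \<Rightarrow> 'w \<Rightarrow> real) \<Rightarrow> (label \<Rightarrow> 'w \<Rightarrow> nat) \<Rightarrow> real \<Rightarrow> 'w \<Rightarrow> 'a measure" where
  "particles_at n x motion lifetime offspring t \<omega> =
     counting (alive_at (n \<omega>) (\<lambda>u. lifetime u \<omega>) (\<lambda>u. offspring u \<omega>) t)
       (position_at (\<lambda>i. x i \<omega>) (\<lambda>u s. motion u s \<omega>) (\<lambda>u. lifetime u \<omega>) t)"


section \<open>The branching particle system\<close>

datatype source = Initial | Motion label | Lifetime label | Offspring label

primrec source_events ::
    "'w measure \<Rightarrow> ('w \<Rightarrow> enat) \<Rightarrow> (nat \<Rightarrow> 'w \<Rightarrow> 'a::euclidean_space) \<Rightarrow>
     (label \<Rightarrow> real \<Rightarrow> 'w \<Rightarrow> 'a) \<Rightarrow> (label \<Rightarrow> 'w \<Rightarrow> real) \<Rightarrow> (label \<Rightarrow> 'w \<Rightarrow> nat) \<Rightarrow>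
     source \<Rightarrow> 'w set set" where
  "source_events M n x motion lifetime offspring Initial =
     sets (vimage_algebra (space M) (\<lambda>\<omega>. (n \<omega>, \<lambda>i. x i \<omega>))
       (count_space UNIV \<Otimes>\<^sub>M (\<Pi>\<^sub>M i\<in>UNIV. borel)))"
| "source_events M n x motion lifetime offspring (Motion u) =
     sets (vimage_algebra (space M) (\<lambda>\<omega>. \<lambda>t\<in>{0..}. motion u t \<omega>) (\<Pi>\<^sub>M t\<in>{0..}. borel))"
| "source_events M n x motion lifetime offspring (Lifetime u) =
     sets (vimage_algebra (space M) (lifetime u) borel)"
| "source_events M n x motion lifetime offspring (Offspring u) =
     sets (vimage_algebra (space M) (offspring u) (count_space UNIV))"

text \<open>A realisation, on an arbitrary probability space, of the
  \<open>(DIM('a), \<alpha>, \<beta>, \<gamma>)\<close>-branching particle system with lifetime parameter \<open>V\<close>. The initial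
  configuration is given by an enumeration of its points.\<close>

locale branching_particle_system = prob_space M
  for M :: "'w measure" +
  fixes \<alpha> \<beta> \<gamma> V :: real
    and n :: "'w \<Rightarrow> enat"
    and x :: "nat \<Rightarrow> 'w \<Rightarrow> 'a::euclidean_space"
    and motion :: "label \<Rightarrow> real \<Rightarrow> 'w \<Rightarrow> 'a"
    and lifetime :: "label \<Rightarrow> 'w \<Rightarrow> real"
    and offspring :: "label \<Rightarrow> 'w \<Rightarrow> nat"
  assumes measurable_initial_number: "n \<in> measurable M (count_space UNIV)"
    and measurable_initial_points: "\<And>i. x i \<in> borel_measurable M"
    and poisson_initial: "poisson_random_measure M (initial_intensity \<gamma>)
          (\<lambda>\<omega>. counting {i. enat i < n \<omega>} (\<lambda>i. x i \<omega>))"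
    and stable_motion: "\<And>u. stable_levy_process M \<alpha> (motion u)"
    and exponential_lifetime: "\<And>u. distributed M lborel (lifetime u) (exponential_density V)"
    and measurable_offspring: "\<And>u. offspring u \<in> measurable M (count_space UNIV)"
    and offspring_generating_function:
      "\<And>u s. 0 < s \<Longrightarrow> s < 1 \<Longrightarrow>
         expectation (\<lambda>\<omega>. s ^ offspring u \<omega>) = s + 1 / (1 + \<beta>) * (1 - s) powr (1 + \<beta>)"
    and independence: "indep_sets (source_events M n x motion lifetime offspring) UNIV"

definition as_local_extinction ::
    "'w measure \<Rightarrow> (real \<Rightarrow> 'w \<Rightarrow> 'a::euclidean_space measure) \<Rightarrow> bool" where
  "as_local_extinction M N \<longleftrightarrow>
     (\<forall>A\<in>sets borel. bounded A \<longrightarrow>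
        (\<exists>\<tau>\<in>borel_measurable M. (\<forall>\<omega>\<in>space M. 0 \<le> (\<tau> \<omega> :: real)) \<and>
           (AE \<omega> in M. \<forall>t\<ge>\<tau> \<omega>. emeasure (N t \<omega>) A = 0)))"

end

theory Submission
  imports Defs
begin

text \<open>
  Let \<open>B\<close> be the closed unit ball and suppose that \<open>B\<close> stays empty after a finite random time
  \<open>\<tau>\<close>. Then the probability of \<open>\<tau> \<le> T\<close> tends to 1, and the contradiction comes from an upper bound
  for it below 1 that does not depend on \<open>T\<close>. On the event \<open>\<tau> \<le> T\<close> no particle is born in \<open>B\<close>
  during the window from \<open>T\<close> to \<open>S = 2 T\<close>, since a newborn particle is alive at its birth place.
  Mark each birth in \<open>B\<close> during the window independently with probability \<open>\<theta>\<close>. Families of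
  different initial particles are independent and the initial configuration is Poisson with
  intensity \<open>\<mu>\<close>, so there is no mark with probability \<open>exp (- \<integral> v d\<mu>)\<close>, where \<open>v x\<close> is the
  probability that the family of a particle at \<open>x\<close> carries a mark. It remains to choose \<open>\<theta>\<close>,
  depending on \<open>T\<close>, such that \<open>\<integral> v d\<mu> \<ge> m > 0\<close> with \<open>m\<close> independent of \<open>T\<close>
  (\<open>marked_mass_bounded_below\<close>).

  Let \<open>a\<close> be \<open>\<theta>\<close> times the indicator of window times ball, let \<open>P\<close> denote the expectation at
  the time and place where the ancestor dies, and let \<open>T\<^sub>s\<close> be the semigroup of the motion.
  Decomposition at that death yields \<open>v = a + (1 - a) P (v - v\<^sup>1\<^sup>+\<^sup>\<beta> / (1 + \<beta>))\<close>. Dropping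
  the nonlinear terms gives the mean number of marks, \<open>h = a + V \<integral> T\<^sub>s a ds\<close>. As \<open>v \<le> h\<close> and
  \<open>a \<le> 1\<close>, the nonlinear terms are controlled by \<open>h\<^sup>1\<^sup>+\<^sup>\<beta>\<close>, and \<open>h - v\<close> is at most
  \<open>h\<^sup>1\<^sup>+\<^sup>\<beta>\<close> plus twice its Green potential (\<open>mark_prob_comparison\<close>, for finitely many
  generations). Lebesgue measure is invariant under the motion, so the integral of this error over
  the whole space is of order
  \<open>S \<parallel>h\<parallel>\<^sup>1\<^sup>+\<^sup>\<beta>\<close> with the norm of \<open>L\<^sup>1\<^sup>+\<^sup>\<beta>\<close>, uniformly over the starting times.

  The dimension enters through the chance of sitting in \<open>B\<close> at time \<open>s\<close>, which is at most a
  multiple of \<open>s powr (- d / \<alpha>)\<close> and, as \<open>d \<ge> \<alpha> / \<beta> + \<gamma>\<close>, of \<open>s powr (- (1 / \<beta> + \<gamma> / \<alpha>))\<close>. The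
  \<open>L\<^sup>1\<^sup>+\<^sup>\<beta>\<close> norm of this chance, as a function of the starting point, is then at most of order
  \<open>s powr (- (1 + \<beta> \<gamma> / \<alpha>) / (1 + \<beta>))\<close>, with an exponent above \<open>- 1\<close> precisely because
  \<open>\<gamma> < \<alpha>\<close>. Integration over \<open>s \<le> S\<close> bounds \<open>\<parallel>h\<parallel>\<^sup>1\<^sup>+\<^sup>\<beta>\<close> by a multiple of
  \<open>\<theta> powr (1 + \<beta>) * S powr (\<beta> (1 - \<gamma> / \<alpha>))\<close> (\<open>occupation_norm\<close>). For
  \<open>\<theta> = \<kappa> S powr (- (1 - \<gamma> / \<alpha>))\<close> with a small constant \<open>\<kappa>\<close> the error is a small
  fraction of \<open>\<theta> S\<close>. On the other hand, by scaling, the integral of \<open>h\<close> over a ball of radius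
  \<open>R\<close> of order \<open>S powr (1 / \<alpha>)\<close> is at least a multiple of \<open>\<theta> S\<close>. There the density of \<open>\<mu>\<close> is at
  least of order \<open>S powr (- \<gamma> / \<alpha>)\<close>, and the product of the three powers of \<open>S\<close> is 1.

  The motion is specified through its characteristic function only. Smoothing by a Gaussian turns
  characteristic functions into integrals of Gaussian bumps. This shows that all particles move
  according to the same convolution semigroup (\<open>char_unique\<close>) and bounds the mass of a
  unit ball (\<open>kernel_unit_ball_bound\<close>).
\<close>

section \<open>Gaussian smoothing and uniqueness of characteristic functions\<close>

text \<open>The standard normal distribution on a Euclidean space, built as a product so that its
  characteristic function reduces to the real case.\<close>

definition std_gauss :: "'a::euclidean_space measure" where
  "std_gauss = distr (\<Pi>\<^sub>M b\<in>Basis. std_normal_distribution) borel (\<lambda>f. \<Sum>b\<in>Basis. f b *\<^sub>R b)"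

lemma sets_std_gauss [simp, measurable_cong]: "sets std_gauss = sets borel"
  by (simp add: std_gauss_def)

lemma prob_space_std_gauss: "prob_space (std_gauss :: 'a::euclidean_space measure)"
proof -
  interpret product_prob_space "\<lambda>_::'a. std_normal_distribution" Basis
    by (intro product_prob_spaceI prob_space_normal_density) simp
  show ?thesis
    unfolding std_gauss_def by (rule prob_space_distr) measurable
qed

lemma norm_sq_coords: "(norm (z::'a::euclidean_space))\<^sup>2 = (\<Sum>b\<in>Basis. (z \<bullet> b)\<^sup>2)"
  unfolding power2_norm_eq_inner by (subst euclidean_inner) (simp add: power2_eq_square)

lemma integral_std_gauss_prod:
  fixes f :: "'a::euclidean_space \<Rightarrow> real \<Rightarrow> 'c::{real_normed_field,banach,second_countable_topology}"
  assumes "\<And>b. b \<in> Basis \<Longrightarrow> integrable std_normal_distribution (f b)"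
  assumes [measurable]: "\<And>b. b \<in> Basis \<Longrightarrow> f b \<in> borel_measurable borel"
  shows "(LINT y|std_gauss. (\<Prod>b\<in>Basis. f b (y \<bullet> b))) = (\<Prod>b\<in>Basis. LINT r|std_normal_distribution. f b r)"
proof -
  interpret product_prob_space "\<lambda>_::'a. std_normal_distribution" Basis
    by (intro product_prob_spaceI prob_space_normal_density) simp
  show ?thesis
    unfolding std_gauss_def
    by (subst integral_distr) (simp_all add: product_integral_prod assms)
qed

lemma char_std_gauss:
  "(LINT y|std_gauss. iexp (z \<bullet> y)) = complex_of_real (exp (- (norm z)\<^sup>2 / 2))"
proof -
  interpret real_distribution std_normal_distribution
    by (rule real_dist_normal_dist)
  have eq: "iexp (z \<bullet> y) = (\<Prod>b\<in>Basis. iexp ((z \<bullet> b) * (y \<bullet> b)))" for y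
    by (simp add: euclidean_inner[of z y] sum_distrib_left flip: exp_sum)
  have "(LINT y|std_gauss. iexp (z \<bullet> y)) = (\<Prod>b\<in>Basis. LINT r|std_normal_distribution. iexp ((z \<bullet> b) * r))"
    unfolding eq
    by (subst integral_std_gauss_prod[where f="\<lambda>b r. iexp ((z \<bullet> b) * r)"])
       (auto intro!: integrable_const_bound[where B=1])
  also have "\<dots> = (\<Prod>b\<in>Basis. complex_of_real (exp (- ((z \<bullet> b)^2) / 2)))"
    using char_std_normal_distribution by (simp add: char_def fun_eq_iff)
  also have "\<dots> = complex_of_real (exp (- (norm z)\<^sup>2 / 2))"
    by (simp add: exp_sum[symmetric] sum_negf sum_divide_distrib[symmetric] norm_sq_coords flip: of_real_prod)
  finally show ?thesis .
qed

text \<open>The Gaussian bump is itself the characteristic function of a Gaussian. Interchanging the two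
  integrations expresses its integral against \<open>\<mu>\<close> by the characteristic function of \<open>\<mu>\<close>.\<close>

lemma gauss_smoothing:
  fixes x :: "'a::euclidean_space"
  assumes "prob_space \<mu>" and [measurable_cong]: "sets \<mu> = sets borel"
  shows "complex_of_real (LINT y|\<mu>. exp (- (norm (\<sigma> *\<^sub>R (x + y)))\<^sup>2 / 2)) =
         (LINT \<zeta>|std_gauss. iexp (\<sigma> * (x \<bullet> \<zeta>)) * (LINT y|\<mu>. iexp ((\<sigma> *\<^sub>R \<zeta>) \<bullet> y)))"
proof -
  interpret \<mu>: prob_space \<mu> by fact
  interpret N: prob_space "std_gauss :: 'a measure" by (rule prob_space_std_gauss)
  interpret P: pair_prob_space "std_gauss :: 'a measure" \<mu> ..
  have "complex_of_real (LINT y|\<mu>. exp (- (norm (\<sigma> *\<^sub>R (x + y)))\<^sup>2 / 2))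
      = (LINT y|\<mu>. LINT \<zeta>|std_gauss. iexp ((\<sigma> *\<^sub>R (x + y)) \<bullet> \<zeta>))"
    unfolding char_std_gauss by (simp add: integral_complex_of_real)
  also have "\<dots> = (LINT \<zeta>|std_gauss. LINT y|\<mu>. iexp ((\<sigma> *\<^sub>R (x + y)) \<bullet> \<zeta>))"
    by (rule P.Fubini_integral) (auto intro!: P.integrable_const_bound[where B=1])
  also have "\<dots> = (LINT \<zeta>|std_gauss. iexp (\<sigma> * (x \<bullet> \<zeta>)) * (LINT y|\<mu>. iexp ((\<sigma> *\<^sub>R \<zeta>) \<bullet> y)))"
  proof (intro Bochner_Integration.integral_cong refl)
    fix \<zeta> :: 'a
    have "iexp ((\<sigma> *\<^sub>R (x + y)) \<bullet> \<zeta>) = iexp (\<sigma> * (x \<bullet> \<zeta>)) * iexp ((\<sigma> *\<^sub>R \<zeta>) \<bullet> y)" for y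
      by (simp add: inner_add_left inner_commute[of y] distrib_left flip: exp_add)
    then show "(LINT y|\<mu>. iexp ((\<sigma> *\<^sub>R (x + y)) \<bullet> \<zeta>)) = iexp (\<sigma> * (x \<bullet> \<zeta>)) * (LINT y|\<mu>. iexp ((\<sigma> *\<^sub>R \<zeta>) \<bullet> y))"
      by simp
  qed
  finally show ?thesis .
qed

lemma nn_integral_lborel_scale:
  fixes f :: "'a::euclidean_space \<Rightarrow> ennreal"
  assumes [measurable]: "f \<in> borel_measurable borel" and "c \<noteq> 0"
  shows "(\<integral>\<^sup>+x. f x \<partial>lborel) = ennreal (\<bar>c\<bar> ^ DIM('a)) * (\<integral>\<^sup>+x. f (t + c *\<^sub>R x) \<partial>lborel)"
  by (subst lborel_affine[OF \<open>c \<noteq> 0\<close>, of t])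
     (simp add: nn_integral_density nn_integral_distr nn_integral_cmult)

text \<open>By \<open>gauss_smoothing\<close> the characteristic function determines the convolution of the measure
  with every centred Gaussian. As the variance tends to 0 these convolutions recover the integrals
  of bounded continuous functions, and those determine the measure of every open set.\<close>

lemma char_unique:
  fixes \<mu> \<nu> :: "'a::euclidean_space measure"
  assumes "prob_space \<mu>" and sm[measurable_cong]: "sets \<mu> = sets borel"
    and "prob_space \<nu>" and sn[measurable_cong]: "sets \<nu> = sets borel"
    and eq: "\<And>z. (LINT y|\<mu>. iexp (z \<bullet> y)) = (LINT y|\<nu>. iexp (z \<bullet> y))"
  shows "\<mu> = \<nu>"
proof -
  interpret \<mu>: prob_space \<mu> by fact
  interpret \<nu>: prob_space \<nu> by fact
  define K where "K = (\<lambda>z::'a. ennreal (exp (- (norm z)\<^sup>2 / 2)))"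
  have [measurable]: "K \<in> borel_measurable borel" unfolding K_def by measurable
  define I where "I = (\<integral>\<^sup>+z. K z \<partial>lborel)"
  have Kprod: "K z = (\<Prod>b\<in>Basis. ennreal (sqrt (2*pi)) * ennreal (normal_density 0 1 (z \<bullet> b)))" for z :: 'a
  proof -
    have "(\<Prod>b\<in>Basis. ennreal (sqrt (2*pi)) * ennreal (normal_density 0 1 (z \<bullet> b)))
      = ennreal (\<Prod>b\<in>Basis. exp (- (z \<bullet> b)\<^sup>2 / 2))"
      by (simp add: normal_density_def prod_ennreal flip: ennreal_mult)
    also have "(\<Prod>b\<in>Basis. exp (- (z \<bullet> b)\<^sup>2 / 2)) = exp (- (norm z)\<^sup>2 / 2)"
      by (simp add: exp_sum[symmetric] sum_negf sum_divide_distrib[symmetric] norm_sq_coords)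
    finally show ?thesis by (simp add: K_def)
  qed
  have I: "I = ennreal (sqrt (2*pi)) ^ DIM('a)"
  proof -
    have *: "(\<integral>\<^sup>+r. ennreal (normal_density 0 1 r) \<partial>lborel) = 1"
      using prob_space.emeasure_space_1[OF prob_space_normal_density[of 1 0]]
      by (simp add: emeasure_density)
    show ?thesis
      unfolding I_def Kprod
      by (subst nn_integral_lborel_prod) (simp_all add: nn_integral_cmult *)
  qed
  have I0: "I \<noteq> 0" "I \<noteq> \<infinity>" by (simp_all add: I ennreal_power)
  have K_le: "K z \<le> 1" for z by (simp add: K_def)
  have sm_eq: "(\<integral>\<^sup>+y. K (\<sigma> *\<^sub>R (x + y)) \<partial>\<mu>) = (\<integral>\<^sup>+y. K (\<sigma> *\<^sub>R (x + y)) \<partial>\<nu>)" for \<sigma> x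
  proof -
    have "complex_of_real (LINT y|\<mu>. exp (- (norm (\<sigma> *\<^sub>R (x + y)))\<^sup>2 / 2)) =
       complex_of_real (LINT y|\<nu>. exp (- (norm (\<sigma> *\<^sub>R (x + y)))\<^sup>2 / 2))"
      unfolding gauss_smoothing[OF assms(1,2)] gauss_smoothing[OF assms(3,4)] eq ..
    then have "(LINT y|\<mu>. exp (- (norm (\<sigma> *\<^sub>R (x + y)))\<^sup>2 / 2)) =
       (LINT y|\<nu>. exp (- (norm (\<sigma> *\<^sub>R (x + y)))\<^sup>2 / 2))"
      by (simp only: of_real_eq_iff)
    then show ?thesis
      unfolding K_def
      by (subst nn_integral_eq_integral, force intro!: \<mu>.integrable_const_bound[where B=1], force,
          subst nn_integral_eq_integral, force intro!: \<nu>.integrable_const_bound[where B=1], force, simp)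
  qed
  \<comment> \<open>After a change of variables the Gaussian weight no longer depends on \<open>n\<close>, while \<open>f\<close> is shifted
    by \<open>z / n\<close> only.\<close>
  have smoothed: "ennreal (real (Suc n) ^ DIM('a)) * (\<integral>\<^sup>+x. f x * (\<integral>\<^sup>+y. K (Suc n *\<^sub>R (- x + y)) \<partial>\<rho>) \<partial>lborel)
      = (\<integral>\<^sup>+y. \<integral>\<^sup>+z. f (y - z /\<^sub>R Suc n) * K z \<partial>lborel \<partial>\<rho>)"
    if "prob_space \<rho>" and [measurable_cong]: "sets \<rho> = sets borel" and [measurable]: "f \<in> borel_measurable borel"
    for \<rho> :: "'a measure" and f n
  proof -
    interpret \<rho>: prob_space \<rho> by fact
    interpret P: pair_sigma_finite "lborel :: 'a measure" \<rho> ..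
    have "(\<integral>\<^sup>+x. f x * (\<integral>\<^sup>+y. K (Suc n *\<^sub>R (- x + y)) \<partial>\<rho>) \<partial>lborel)
       = (\<integral>\<^sup>+x. \<integral>\<^sup>+y. f x * K (Suc n *\<^sub>R (- x + y)) \<partial>\<rho> \<partial>lborel)"
      by (simp add: nn_integral_cmult)
    also have "\<dots> = (\<integral>\<^sup>+y. \<integral>\<^sup>+x. f x * K (Suc n *\<^sub>R (- x + y)) \<partial>lborel \<partial>\<rho>)"
      by (rule P.Fubini'[symmetric]) measurable
    also have "\<dots> = (\<integral>\<^sup>+y. ennreal ((1 / Suc n) ^ DIM('a)) * (\<integral>\<^sup>+z. f (y - z /\<^sub>R Suc n) * K z \<partial>lborel) \<partial>\<rho>)"
    proof (intro nn_integral_cong)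
      fix y
      show "(\<integral>\<^sup>+x. f x * K (Suc n *\<^sub>R (- x + y)) \<partial>lborel) =
        ennreal ((1 / Suc n) ^ DIM('a)) * (\<integral>\<^sup>+z. f (y - z /\<^sub>R Suc n) * K z \<partial>lborel)"
        by (subst nn_integral_lborel_scale[where c="- 1 / Suc n" and t=y])
           (simp_all add: divide_inverse del: of_nat_Suc)
    qed
    also have "\<dots> = ennreal ((1 / Suc n) ^ DIM('a)) * (\<integral>\<^sup>+y. \<integral>\<^sup>+z. f (y - z /\<^sub>R Suc n) * K z \<partial>lborel \<partial>\<rho>)"
      by (intro nn_integral_cmult) measurable
    finally show ?thesis
      by (simp add: mult.assoc[symmetric] power_one_over flip: ennreal_mult del: of_nat_Suc)
  qed
  have lim: "(\<lambda>n. \<integral>\<^sup>+y. \<integral>\<^sup>+z. f (y - z /\<^sub>R Suc n) * K z \<partial>lborel \<partial>\<rho>) \<longlonglongrightarrow> (\<integral>\<^sup>+y. f y \<partial>\<rho>) * I"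
    if "prob_space \<rho>" and [measurable_cong]: "sets \<rho> = sets borel" and cf: "continuous_on UNIV f" 
      and f1: "\<And>x. f x \<le> 1"
    for \<rho> :: "'a measure" and f :: "'a \<Rightarrow> ennreal"
  proof -
    interpret \<rho>: prob_space \<rho> by fact
    have [measurable]: "f \<in> borel_measurable borel"
      using cf by (rule borel_measurable_continuous_onI)
    have "(\<lambda>n. \<integral>\<^sup>+y. \<integral>\<^sup>+z. f (y - z /\<^sub>R Suc n) * K z \<partial>lborel \<partial>\<rho>) \<longlonglongrightarrow> (\<integral>\<^sup>+y. \<integral>\<^sup>+z. f y * K z \<partial>lborel \<partial>\<rho>)"
    proof (rule nn_integral_dominated_convergence[where w="\<lambda>_. I"])
      show "AE y in \<rho>. (\<integral>\<^sup>+z. f (y - z /\<^sub>R Suc n) * K z \<partial>lborel) \<le> I" for n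
        unfolding I_def using mult_mono[OF f1 order_refl]
        by (intro AE_I2 nn_integral_mono) (metis mult_1 zero_le)
      show "AE y in \<rho>. (\<lambda>n. \<integral>\<^sup>+z. f (y - z /\<^sub>R Suc n) * K z \<partial>lborel) \<longlonglongrightarrow> (\<integral>\<^sup>+z. f y * K z \<partial>lborel)"
      proof (rule AE_I2, rule nn_integral_dominated_convergence[where w=K])
        fix y :: 'a
        show "(\<integral>\<^sup>+z. K z \<partial>lborel) < \<infinity>" using I0 by (simp add: I_def less_top)
        show "AE z in lborel. f (y - z /\<^sub>R Suc n) * K z \<le> K z" for n
          using mult_mono[OF f1 order_refl] by (intro AE_I2) (metis mult_1 zero_le)
        show "AE z in lborel. (\<lambda>n. f (y - z /\<^sub>R Suc n) * K z) \<longlonglongrightarrow> f y * K z"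
        proof (rule AE_I2)
          fix z :: 'a
          have "(\<lambda>n. y - inverse (real (Suc n)) *\<^sub>R z) \<longlonglongrightarrow> y - 0 *\<^sub>R z"
            by (intro tendsto_intros LIMSEQ_inverse_real_of_nat)
          then have "(\<lambda>n. f (y - z /\<^sub>R Suc n)) \<longlonglongrightarrow> f y"
            using cf by (intro isCont_tendsto_compose[where g=f]) (auto simp: continuous_on_eq_continuous_at)
          then show "(\<lambda>n. f (y - z /\<^sub>R Suc n) * K z) \<longlonglongrightarrow> f y * K z"
            using K_le[of z] by (intro tendsto_mult_ennreal tendsto_const) (auto simp: K_def)
        qed
      qed simp_all
      show "(\<integral>\<^sup>+y. I \<partial>\<rho>) < \<infinity>" using I0 by (simp add: less_top \<rho>.emeasure_space_1)
    qed measurable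
    then show ?thesis
      by (simp add: nn_integral_cmult nn_integral_multc I_def)
  qed
  have cont_eq: "(\<integral>\<^sup>+y. f y \<partial>\<mu>) = (\<integral>\<^sup>+y. f y \<partial>\<nu>)"
    if cf: "continuous_on UNIV f" and f1: "\<And>x. f x \<le> 1" for f :: "'a \<Rightarrow> ennreal"
  proof -
    have [measurable]: "f \<in> borel_measurable borel"
      using cf by (rule borel_measurable_continuous_onI)
    have "(\<integral>\<^sup>+y. f y \<partial>\<mu>) * I = (\<integral>\<^sup>+y. f y \<partial>\<nu>) * I"
      using lim[OF assms(1,2) cf f1] lim[OF assms(3,4) cf f1]
      unfolding smoothed[OF assms(1,2) \<open>f \<in> _\<close>, symmetric] smoothed[OF assms(3,4) \<open>f \<in> _\<close>, symmetric] sm_eq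
      by (rule LIMSEQ_unique)
    then show ?thesis
      using I0 by (metis ennreal_mult_divide_eq infinity_ennreal_def)
  qed
  have open_eq: "emeasure \<mu> U = emeasure \<nu> U" if "open U" for U
  proof (cases "U = UNIV")
    case True
    have "space \<mu> = UNIV" "space \<nu> = UNIV"
      using sm sn by (auto dest: sets_eq_imp_space_eq)
    with True show ?thesis
      using \<mu>.emeasure_space_1 \<nu>.emeasure_space_1 by simp
  next
    case False
    then have ne: "- U \<noteq> {}" by auto
    have [measurable]: "U \<in> sets borel" using that by simp
    \<comment> \<open>Continuous functions that increase to the indicator of \<open>U\<close>; \<open>infdist\<close> is only useful for a
      nonempty complement.\<close>
    define f where "f k x = ennreal (min 1 (real k * infdist x (- U)))" for k x
    have fc: "continuous_on UNIV (f k)" for k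
      unfolding f_def by (intro continuous_intros continuous_on_ennreal)
    have f1: "f k x \<le> 1" for k x by (simp add: f_def)
    have "(\<lambda>k. f k x) \<longlonglongrightarrow> indicator U x" for x
    proof (cases "x \<in> U")
      case True
      then have pos: "infdist x (- U) > 0"
        using that ne in_closed_iff_infdist_zero[of "- U" x] infdist_nonneg[of x "- U"]
        by (simp add: closed_def less_le)
      obtain k0 where k0: "real k0 * infdist x (- U) \<ge> 1"
        using pos by (meson reals_Archimedean3 less_imp_le)
      have "eventually (\<lambda>k. f k x = 1) sequentially"
        using eventually_ge_at_top[of k0]
      proof eventually_elim
        case (elim k)
        then have "real k * infdist x (- U) \<ge> 1"
          using k0 pos by (meson less_imp_le mult_right_mono of_nat_mono order_trans)
        then show ?case by (simp add: f_def)
      qed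
      then show ?thesis using True by (simp add: tendsto_eventually)
    next
      case False
      then show ?thesis by (simp add: f_def)
    qed note lim_f = this
    have L: "(\<lambda>k. \<integral>\<^sup>+y. f k y \<partial>\<rho>) \<longlonglongrightarrow> (\<integral>\<^sup>+y. indicator U y \<partial>\<rho>)"
      if "prob_space \<rho>" and [measurable_cong]: "sets \<rho> = sets borel" for \<rho> :: "'a measure"
    proof -
      interpret \<rho>: prob_space \<rho> by fact
      show ?thesis
        by (rule nn_integral_dominated_convergence[where w="\<lambda>_. 1"])
           (auto simp: f1 lim_f \<rho>.emeasure_space_1 intro!: borel_measurable_continuous_onI[OF fc] simp: measurable_cong_sets[OF that(2) refl])
    qed
    show ?thesis
      using LIMSEQ_unique[OF L[OF assms(1,2), unfolded cont_eq[OF fc f1]] L[OF assms(3,4)]]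
      by (simp add: sm sn)
  qed
  show ?thesis
  proof (rule measure_eqI_generator_eq[where E="{U. open U}" and \<Omega>=UNIV and A="\<lambda>_. UNIV"])
    show "sets \<mu> = sigma_sets UNIV {U. open U}" "sets \<nu> = sigma_sets UNIV {U. open U}"
      by (simp_all add: sm sn borel_def)
  qed (auto simp: Int_stable_def open_eq)
qed

text \<open>The normal density is at most 1, so that scaling \<open>r\<close> by \<open>l powr (- 1 / \<alpha>)\<close> in the Lebesgue
  integral yields the power of \<open>l\<close>.\<close>

lemma std_normal_exp_powr_bound:
  fixes \<alpha> :: real
  assumes "0 < \<alpha>"
  obtains K where "0 < K" and
    "\<And>l. 0 < l \<Longrightarrow> (LINT r|std_normal_distribution. exp (- l * \<bar>r\<bar> powr \<alpha>)) \<le> K * l powr (- 1 / \<alpha>)"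
proof -
  interpret real_distribution std_normal_distribution
    by (rule real_dist_normal_dist)
  define m where "m = nat \<lceil>2 / \<alpha>\<rceil>"
  define B where "B = (2 + fact m :: real)"
  have m: "2 / \<alpha> \<le> real m" by (simp add: m_def real_nat_ceiling_ge)
  \<comment> \<open>The stretched exponential is dominated by the Cauchy density.\<close>
  have dom: "exp (- (\<bar>r\<bar> powr \<alpha>)) \<le> B * (1 / (1 + r\<^sup>2))" for r :: real
  proof -
    define u where "u = \<bar>r\<bar> powr \<alpha>"
    have u0: "0 \<le> u" by (simp add: u_def)
    have "r\<^sup>2 \<le> 1 + u ^ m"
    proof (cases "\<bar>r\<bar> \<le> 1")
      case True
      then have "r\<^sup>2 \<le> 1" by (simp add: abs_square_le_1)
      moreover have "0 \<le> u ^ m" using u0 by simp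
      ultimately show ?thesis by linarith
    next
      case False
      then have "r\<^sup>2 = \<bar>r\<bar> powr 2" by simp
      also have "\<dots> \<le> \<bar>r\<bar> powr (\<alpha> * m)"
        using False m assms by (intro powr_mono) (auto simp: field_simps)
      also have "\<dots> = u ^ m"
        using False by (simp add: u_def powr_powr flip: powr_realpow)
      finally show ?thesis by simp
    qed
    also have "u ^ m \<le> fact m * exp u"
    proof -
      have "u ^ m /\<^sub>R fact m \<le> exp u"
        using u0 sums_le[OF _ sums_If_finite_set[of "{m}" "\<lambda>n. u ^ n /\<^sub>R fact n"] exp_converges[of u]]
        by (auto simp: )
      then show ?thesis by (simp add: field_simps)
    qed
    finally have "1 + r\<^sup>2 \<le> 2 + fact m * exp u" by simp
    also have "\<dots> \<le> B * exp u"
      using u0 by (simp add: B_def distrib_right)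
    finally have "(1 + r\<^sup>2) * exp (- u) \<le> B * exp u * exp (- u)"
      by (intro mult_right_mono) auto
    then have "(1 + r\<^sup>2) * exp (- u) \<le> B" by (simp add: mult.assoc flip: exp_add)
    moreover have "0 < 1 + r\<^sup>2" by (simp add: add_pos_nonneg)
    ultimately have "exp (- u) \<le> B * (1 / (1 + r\<^sup>2))"
      by (simp add: field_simps)
    then show ?thesis by (simp add: u_def)
  qed
  define J where "J = (\<integral>\<^sup>+r. ennreal (exp (- (\<bar>r\<bar> powr \<alpha>))) \<partial>lborel)"
  have "J < \<infinity>"
  proof -
    have int: "integrable lborel (\<lambda>r::real. B * (1 / (1 + r\<^sup>2)))"
      using integrable_inverse_1_plus_square
      by (intro integrable_mult_right) (simp add: set_integrable_def inverse_eq_divide)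
    have "J \<le> (\<integral>\<^sup>+r. ennreal (B * (1 / (1 + r\<^sup>2))) \<partial>lborel)"
      unfolding J_def by (intro nn_integral_mono ennreal_leI dom)
    also have "\<dots> = ennreal (LINT r|lborel. B * (1 / (1 + r\<^sup>2)))"
      by (rule nn_integral_eq_integral[OF int]) (simp add: B_def)
    also have "\<dots> < \<infinity>" by simp
    finally show ?thesis .
  qed
  define K where "K = enn2real J + 1"
  show ?thesis
  proof
    show "0 < K" by (simp add: K_def add_nonneg_pos)
    fix l :: real assume l: "0 < l"
    define c where "c = l powr (- 1 / \<alpha>)"
    have c: "0 < c" using l by (simp add: c_def)
    have lc: "l * \<bar>c * r\<bar> powr \<alpha> = \<bar>r\<bar> powr \<alpha>" for r
      using l assms by (simp add: c_def abs_mult powr_mult powr_divide powr_powr powr_minus field_simps)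
    have "ennreal (LINT r|std_normal_distribution. exp (- l * \<bar>r\<bar> powr \<alpha>)) =
      (\<integral>\<^sup>+r. ennreal (exp (- l * \<bar>r\<bar> powr \<alpha>)) \<partial>std_normal_distribution)"
      using l by (intro nn_integral_eq_integral[symmetric] integrable_const_bound[where B=1]) auto
    also have "\<dots> = (\<integral>\<^sup>+r. ennreal (std_normal_density r) * ennreal (exp (- l * \<bar>r\<bar> powr \<alpha>)) \<partial>lborel)"
      by (subst nn_integral_density) auto
    also have "\<dots> \<le> (\<integral>\<^sup>+r. ennreal (exp (- l * \<bar>r\<bar> powr \<alpha>)) \<partial>lborel)"
    proof (rule nn_integral_mono)
      fix r :: real
      have "exp (- r\<^sup>2 / 2) \<le> sqrt (2 * pi)"
        by (rule order_trans[where y=1]) (use pi_gt3 in auto)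
      then have "std_normal_density r \<le> 1"
        by (simp add: normal_density_def divide_le_eq)
      then have "ennreal (std_normal_density r) \<le> 1" by simp
      then show "ennreal (std_normal_density r) * ennreal (exp (- l * \<bar>r\<bar> powr \<alpha>)) \<le> ennreal (exp (- l * \<bar>r\<bar> powr \<alpha>))"
        by (metis mult_1 mult_right_mono zero_le)
    qed
    also have "\<dots> = ennreal c * J"
      using c by (subst nn_integral_real_affine[where c=c and t=0]) (auto simp: J_def lc)
    also have "\<dots> \<le> ennreal (K * c)"
      using \<open>J < \<infinity>\<close> c 
      by (cases J) (auto simp: K_def mult.commute ennreal_mult[symmetric] intro!: ennreal_leI mult_left_mono)
    finally have "(LINT r|std_normal_distribution. exp (- l * \<bar>r\<bar> powr \<alpha>)) \<le> K * c"
      using c by (subst (asm) ennreal_le_iff) (auto simp: K_def)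
    then show "(LINT r|std_normal_distribution. exp (- l * \<bar>r\<bar> powr \<alpha>)) \<le> K * l powr (- 1 / \<alpha>)"
      unfolding c_def .
  qed
qed

section \<open>Isotropic stable convolution semigroups\<close>

locale stable_semigroup =
  fixes p :: "real \<Rightarrow> 'a::euclidean_space measure" and \<alpha> :: real
  assumes kernel [measurable]: "p \<in> borel \<rightarrow>\<^sub>M subprob_algebra borel"
    and prob_kernel: "\<And>s. prob_space (p s)"
    and stability_index_pos: "0 < \<alpha>"
    and char_kernel: "\<And>s z. 0 \<le> s \<Longrightarrow>
      (LINT y|p s. iexp (z \<bullet> y)) = complex_of_real (exp (- s * norm z powr \<alpha>))"
begin

lemma sets_kernel [simp, measurable_cong]: "sets (p s) = sets borel"
  using measurable_space[OF kernel, of s] by (simp add: space_subprob_algebra)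

lemma space_kernel [simp]: "space (p s) = UNIV"
  using sets_eq_imp_space_eq[OF sets_kernel] by simp

lemma emeasure_kernel_UNIV [simp]: "emeasure (p s) UNIV = 1"
  using prob_space.emeasure_space_1[OF prob_kernel, of s] by simp

lemma kernel_eqI:
  assumes "prob_space \<mu>" "sets \<mu> = sets borel" "0 \<le> s"
    and "\<And>z. (LINT y|\<mu>. iexp (z \<bullet> y)) = complex_of_real (exp (- s * norm z powr \<alpha>))"
  shows "\<mu> = p s"
  using assms by (intro char_unique) (auto simp: prob_kernel char_kernel)

lemma kernel_semigroup:
  assumes "0 \<le> s" "0 \<le> r" and [measurable]: "f \<in> borel_measurable borel"
  shows "(\<integral>\<^sup>+y. \<integral>\<^sup>+y'. f (y + y') \<partial>p r \<partial>p s) = (\<integral>\<^sup>+y. f y \<partial>p (s + r))"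
proof -
  interpret ps: prob_space "p s" by (rule prob_kernel)
  interpret pr: prob_space "p r" by (rule prob_kernel)
  interpret P: pair_prob_space "p s" "p r" ..
  define \<mu> where "\<mu> = distr (p s \<Otimes>\<^sub>M p r) borel (\<lambda>(y, y'). y + y')"
  have "\<mu> = p (s + r)"
  proof (rule kernel_eqI)
    show "prob_space \<mu>" unfolding \<mu>_def by (rule P.prob_space_distr) measurable
    fix z
    have "(LINT y|\<mu>. iexp (z \<bullet> y)) = (LINT w|(p s \<Otimes>\<^sub>M p r). iexp (z \<bullet> (fst w + snd w)))"
      unfolding \<mu>_def by (subst integral_distr) (auto simp: split_beta')
    also have "\<dots> = (LINT y|p s. LINT y'|p r. iexp (z \<bullet> (y + y')))"
      by (subst P.integral_fst'[symmetric]) (auto intro!: P.integrable_const_bound[where B=1])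
    also have "\<dots> = (LINT y|p s. iexp (z \<bullet> y) * (LINT y'|p r. iexp (z \<bullet> y')))"
      by (simp add: inner_add_right distrib_left exp_add)
    also have "\<dots> = complex_of_real (exp (- (s + r) * norm z powr \<alpha>))"
    proof -
      have "exp (- s * norm z powr \<alpha>) * exp (- r * norm z powr \<alpha>) = exp (- (s + r) * norm z powr \<alpha>)"
        by (simp add: algebra_simps flip: exp_add)
      then show ?thesis
        using assms by (simp only: char_kernel of_real_mult[symmetric] integral_mult_left_zero)
    qed
    finally show "(LINT y|\<mu>. iexp (z \<bullet> y)) = complex_of_real (exp (- (s + r) * norm z powr \<alpha>))" .
  qed (use assms in \<open>auto simp: \<mu>_def\<close>)
  then have "(\<integral>\<^sup>+y. f y \<partial>p (s + r)) = (\<integral>\<^sup>+w. f (fst w + snd w) \<partial>(p s \<Otimes>\<^sub>M p r))"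
    by (simp add: \<mu>_def nn_integral_distr split_beta' flip: \<open>\<mu> = p (s + r)\<close>)
  also have "\<dots> = (\<integral>\<^sup>+y. \<integral>\<^sup>+y'. f (y + y') \<partial>p r \<partial>p s)"
    by (subst pr.nn_integral_fst[symmetric]) auto
  finally show ?thesis ..
qed

lemma kernel_scaling:
  assumes "0 < s"
  shows "p s = distr (p 1) borel (\<lambda>y. s powr (1 / \<alpha>) *\<^sub>R y)"
proof (rule kernel_eqI[symmetric])
  interpret prob_space "p 1" by (rule prob_kernel)
  show "prob_space (distr (p 1) borel (\<lambda>y. s powr (1 / \<alpha>) *\<^sub>R y))"
    by (rule prob_space_distr) measurable
  fix z
  show "(LINT y|distr (p 1) borel (\<lambda>y. s powr (1 / \<alpha>) *\<^sub>R y). iexp (z \<bullet> y)) = complex_of_real (exp (- s * norm z powr \<alpha>))"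
    using char_kernel[of 1 "s powr (1 / \<alpha>) *\<^sub>R z"] assms stability_index_pos
    by (subst integral_distr) (auto simp: powr_mult powr_powr)
qed (use assms in auto)

text \<open>A large enough ball carries half of the mass at time 1; scaling transports it to time \<open>s\<close>.\<close>

lemma kernel_tight:
  obtains C where "0 < C" and
    "\<And>s. 0 < s \<Longrightarrow> ennreal (1 / 2) \<le> emeasure (p s) {y. norm y \<le> C * s powr (1 / \<alpha>)}"
proof -
  interpret prob_space "p 1" by (rule prob_kernel)
  have "(\<lambda>n. measure (p 1) (cball 0 (real n))) \<longlonglongrightarrow> measure (p 1) (\<Union>n. cball 0 (real n))"
    by (rule finite_Lim_measure_incseq) (auto simp: incseq_def)
  moreover have "(\<Union>n. cball 0 (real n)) = (UNIV :: 'a set)"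
    using real_arch_simple by (auto simp: mem_cball)
  ultimately have "(\<lambda>n. measure (p 1) (cball 0 (real n))) \<longlonglongrightarrow> 1"
    using prob_space by simp
  then have "eventually (\<lambda>n. 1 / 2 < measure (p 1) (cball 0 (real n))) sequentially"
    by (rule order_tendstoD) simp
  then obtain n where n: "1 / 2 < measure (p 1) (cball 0 (real n))"
    by (auto simp: eventually_sequentially)
  show ?thesis
  proof
    show "0 < real n + 1" by simp
    fix s :: real assume s: "0 < s"
    have "ennreal (1 / 2) \<le> emeasure (p 1) (cball 0 (real n))"
      unfolding emeasure_eq_measure using n by (intro ennreal_leI) simp
    also have "\<dots> \<le> emeasure (p 1) {y. norm y \<le> real n + 1}"
      by (intro emeasure_mono) auto
    also have "\<dots> = emeasure (p s) {y. norm y \<le> (real n + 1) * s powr (1 / \<alpha>)}"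
      unfolding kernel_scaling[OF s] using s
      by (subst emeasure_distr) (auto intro!: arg_cong[where f="emeasure (p 1)"] simp: mult.commute)
    finally show "ennreal (1 / 2) \<le> emeasure (p s) {y. norm y \<le> (real n + 1) * s powr (1 / \<alpha>)}" .
  qed
qed

text \<open>On the unit ball the indicator is at most \<open>exp (1 / 2)\<close> times the Gaussian bump. Its
  expectation is, by \<open>gauss_smoothing\<close>, at most the expectation of \<open>exp (- s \<bar>\<zeta>\<bar>\<^sup>\<alpha>)\<close> for a
  standard normal \<open>\<zeta>\<close>. Estimating \<open>\<bar>\<zeta>\<bar>\<^sup>\<alpha>\<close> from below by the average of the \<open>\<bar>\<zeta>\<^sub>b\<bar>\<^sup>\<alpha>\<close>
  over the coordinates leaves a product of one-dimensional integrals.\<close>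

lemma kernel_unit_ball_bound:
  obtains C where "1 \<le> C" and
    "\<And>s x. 0 < s \<Longrightarrow> (\<integral>\<^sup>+y. indicator (cball 0 1) (x + y) \<partial>p s) \<le> ennreal (C * s powr (- real DIM('a) / \<alpha>))"
proof -
  define d where "d = real DIM('a)"
  have d: "0 < d" by (simp add: d_def)
  obtain K where K: "0 < K" and
    Kb: "\<And>l. 0 < l \<Longrightarrow> (LINT r|std_normal_distribution. exp (- l * \<bar>r\<bar> powr \<alpha>)) \<le> K * l powr (- 1 / \<alpha>)"
    using std_normal_exp_powr_bound[OF stability_index_pos] by blast
  define C where "C = max 1 (exp (1/2) * (K * (1 / d) powr (- 1 / \<alpha>)) ^ DIM('a))"
  show ?thesis
  proof
    show "1 \<le> C" by (simp add: C_def)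
    fix s :: real and x :: 'a assume s: "0 < s"
    interpret ps: prob_space "p s" by (rule prob_kernel)
    interpret N: prob_space "std_gauss :: 'a measure" by (rule prob_space_std_gauss)
    interpret R: real_distribution std_normal_distribution by (rule real_dist_normal_dist)
    have coord: "exp (- s * norm \<zeta> powr \<alpha>) \<le> (\<Prod>b\<in>Basis. exp (- (s / d) * \<bar>\<zeta> \<bullet> b\<bar> powr \<alpha>))" for \<zeta> :: 'a
    proof -
      have "(\<Sum>b\<in>Basis. \<bar>\<zeta> \<bullet> b\<bar> powr \<alpha>) \<le> (\<Sum>b\<in>(Basis::'a set). norm \<zeta> powr \<alpha>)"
        using stability_index_pos by (intro sum_mono powr_mono2) (auto simp: Basis_le_norm)
      then have "(s / d) * (\<Sum>b\<in>Basis. \<bar>\<zeta> \<bullet> b\<bar> powr \<alpha>) \<le> (s / d) * (d * norm \<zeta> powr \<alpha>)"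
        using s d by (intro mult_left_mono) (auto simp: d_def)
      then have "(\<Sum>b\<in>Basis. (s / d) * \<bar>\<zeta> \<bullet> b\<bar> powr \<alpha>) \<le> s * norm \<zeta> powr \<alpha>"
        using d by (simp add: sum_distrib_left)
      then show ?thesis
        by (simp add: exp_sum[symmetric] sum_negf)
    qed
    define g where "g = (LINT y|p s. exp (- (norm (x + y))\<^sup>2 / 2))"
    have "complex_of_real g = (LINT \<zeta>|std_gauss. iexp (x \<bullet> \<zeta>) * complex_of_real (exp (- s * norm \<zeta> powr \<alpha>)))"
      using gauss_smoothing[where \<mu>="p s" and \<sigma>=1 and x=x, OF prob_kernel sets_kernel] s
      unfolding g_def by (simp add: char_kernel)
    then have "\<bar>g\<bar> = norm (LINT \<zeta>|std_gauss. iexp (x \<bullet> \<zeta>) * complex_of_real (exp (- s * norm \<zeta> powr \<alpha>)))"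
      by (metis norm_of_real)
    also have "\<dots> \<le> (LINT \<zeta>|std_gauss. norm (iexp (x \<bullet> \<zeta>) * complex_of_real (exp (- s * norm \<zeta> powr \<alpha>))))"
      by (rule integral_norm_bound)
    also have "\<dots> = (LINT \<zeta>|std_gauss. exp (- s * norm (\<zeta>::'a) powr \<alpha>))"
      by (simp add: norm_mult)
    also have "\<dots> \<le> (LINT \<zeta>|std_gauss. (\<Prod>b\<in>Basis. exp (- (s / d) * \<bar>(\<zeta>::'a) \<bullet> b\<bar> powr \<alpha>)))"
      using s d by (intro integral_mono coord N.integrable_const_bound[where B=1])
        (auto intro!: prod_le_1 simp: abs_prod)
    also have "\<dots> = (\<Prod>b\<in>(Basis::'a set). LINT r|std_normal_distribution. exp (- (s / d) * \<bar>r\<bar> powr \<alpha>))"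
      using s d by (intro integral_std_gauss_prod R.integrable_const_bound[where B=1]) auto
    also have "\<dots> \<le> (\<Prod>b\<in>(Basis::'a set). K * (s / d) powr (- 1 / \<alpha>))"
      using s d by (intro prod_mono conjI Kb) (auto intro!: integral_nonneg_AE)
    also have "\<dots> = (K * (1 / d) powr (- 1 / \<alpha>)) ^ DIM('a) * (s powr (- 1 / \<alpha>)) ^ DIM('a)"
      using s d powr_mult[of s "1/d" "- 1 / \<alpha>"] by (simp add: power_mult_distrib)
    also have "(s powr (- 1 / \<alpha>)) ^ DIM('a) = s powr (- d / \<alpha>)"
      using s by (simp add: powr_powr d_def flip: powr_realpow)
    finally have g: "g \<le> (K * (1 / d) powr (- 1 / \<alpha>)) ^ DIM('a) * s powr (- d / \<alpha>)"
      by simp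
    have "(\<integral>\<^sup>+y. indicator (cball 0 1) (x + y) \<partial>p s) \<le> (\<integral>\<^sup>+y. ennreal (exp (1/2) * exp (- (norm (x + y))\<^sup>2 / 2)) \<partial>p s)"
    proof (rule nn_integral_mono)
      fix y
      have "(norm (x + y))\<^sup>2 \<le> 1" if "norm (x + y) \<le> 1" using that by (simp add: power_le_one)
      then show "indicator (cball 0 1) (x + y) \<le> ennreal (exp (1/2) * exp (- (norm (x + y))\<^sup>2 / 2))"
        by (auto simp: indicator_def mem_cball_0 simp flip: exp_add)
    qed
    also have "\<dots> = ennreal (exp (1/2) * g)"
    proof -
      have "- 1 \<le> (norm (x + y))\<^sup>2" for y by (rule order_trans[of _ 0]) auto
      then show ?thesis
        unfolding g_def
        by (subst nn_integral_eq_integral) (auto intro!: ps.integrable_const_bound[where B="exp(1/2)"])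
    qed
    also have "\<dots> \<le> ennreal (C * s powr (- d / \<alpha>))"
    proof (rule ennreal_leI)
      have "exp (1/2) * g \<le> exp (1/2) * ((K * (1 / d) powr (- 1 / \<alpha>)) ^ DIM('a) * s powr (- d / \<alpha>))"
        using g by (rule mult_left_mono) simp
      also have "\<dots> \<le> C * s powr (- d / \<alpha>)"
        unfolding mult.assoc[symmetric] C_def by (intro mult_right_mono) auto
      finally show "exp (1/2) * g \<le> C * s powr (- d / \<alpha>)" .
    qed
    finally show "(\<integral>\<^sup>+y. indicator (cball 0 1) (x + y) \<partial>p s) \<le> ennreal (C * s powr (- real DIM('a) / \<alpha>))"
      by (simp add: d_def)
  qed
qed

end

section \<open>Green operator and the marking recursion\<close>

context stable_semigroup
begin

lemma measurable_kernel_integral: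
  assumes f: "(\<lambda>(x, y). f x y) \<in> borel_measurable (N \<Otimes>\<^sub>M borel)" and g: "g \<in> borel_measurable N"
  shows "(\<lambda>x. \<integral>\<^sup>+y. f x y \<partial>p (g x)) \<in> borel_measurable N"
  using nn_integral_measurable_subprob_algebra2[OF f measurable_compose[OF g kernel]] .

text \<open>The expectation of \<open>\<psi>\<close> at the time and place of death of a particle that is born at the
  space-time point \<open>z\<close>.\<close>

definition step :: "real \<Rightarrow> (real \<times> 'a \<Rightarrow> ennreal) \<Rightarrow> real \<times> 'a \<Rightarrow> ennreal" where
  "step V \<psi> z = (\<integral>\<^sup>+l. ennreal (exponential_density V l) *
     (\<integral>\<^sup>+y. \<psi> (fst z + l, snd z + y) \<partial>p l) \<partial>lborel)"

text \<open>Along a line of descent deaths occur at rate \<open>V\<close>, so this is the sum of all positive powers of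
  \<open>step\<close>: the Green operator of the branching times without its identity part.\<close>

definition green :: "real \<Rightarrow> (real \<times> 'a \<Rightarrow> ennreal) \<Rightarrow> real \<times> 'a \<Rightarrow> ennreal" where
  "green V \<psi> z = (\<integral>\<^sup>+s. ennreal V * indicator {0..} s *
     (\<integral>\<^sup>+y. \<psi> (fst z + s, snd z + y) \<partial>p s) \<partial>lborel)"

lemma measurable_displaced [measurable]:
  assumes [measurable]: "\<psi> \<in> borel_measurable (borel \<Otimes>\<^sub>M borel)"
  shows "(\<lambda>(z, l). \<integral>\<^sup>+y. \<psi> (fst z + l, snd z + y) \<partial>p l) \<in> borel_measurable ((borel \<Otimes>\<^sub>M borel) \<Otimes>\<^sub>M borel)"
  unfolding split_beta' by (rule measurable_kernel_integral) measurable

lemma measurable_displaced_fixed [measurable]: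
  assumes [measurable]: "\<psi> \<in> borel_measurable (borel \<Otimes>\<^sub>M borel)"
  shows "(\<lambda>l. \<integral>\<^sup>+y. \<psi> (t + l, x + y) \<partial>p l) \<in> borel_measurable borel"
  by (rule measurable_kernel_integral) measurable

lemma measurable_step [measurable]:
  assumes [measurable]: "\<psi> \<in> borel_measurable (borel \<Otimes>\<^sub>M borel)"
  shows "step V \<psi> \<in> borel_measurable (borel \<Otimes>\<^sub>M borel)"
proof -
  have "(\<lambda>(z, l). ennreal (exponential_density V l) * (case (z, l) of (z, l) \<Rightarrow> \<integral>\<^sup>+y. \<psi> (fst z + l, snd z + y) \<partial>p l))
    \<in> borel_measurable ((borel \<Otimes>\<^sub>M borel) \<Otimes>\<^sub>M lborel)"
    by measurable
  then show ?thesis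
    unfolding step_def[abs_def] by (intro lborel.borel_measurable_nn_integral) (simp add: split_beta')
qed

lemma measurable_green [measurable]:
  assumes [measurable]: "\<psi> \<in> borel_measurable (borel \<Otimes>\<^sub>M borel)"
  shows "green V \<psi> \<in> borel_measurable (borel \<Otimes>\<^sub>M borel)"
proof -
  have "(\<lambda>(z, l). ennreal V * indicator {0..} l * (case (z, l) of (z, l) \<Rightarrow> \<integral>\<^sup>+y. \<psi> (fst z + l, snd z + y) \<partial>p l))
    \<in> borel_measurable ((borel \<Otimes>\<^sub>M borel) \<Otimes>\<^sub>M lborel)"
    by measurable
  then show ?thesis
    unfolding green_def[abs_def] by (intro lborel.borel_measurable_nn_integral) (simp add: split_beta')
qed

lemma step_mono: "(\<And>z. \<psi> z \<le> \<psi>' z) \<Longrightarrow> step V \<psi> z \<le> step V \<psi>' z"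
  unfolding step_def by (intro nn_integral_mono mult_left_mono) auto

lemma step_add:
  assumes [measurable]: "\<psi> \<in> borel_measurable (borel \<Otimes>\<^sub>M borel)" "\<psi>' \<in> borel_measurable (borel \<Otimes>\<^sub>M borel)"
  shows "step V (\<lambda>z. \<psi> z + \<psi>' z) z = step V \<psi> z + step V \<psi>' z"
  unfolding step_def
  by (subst nn_integral_add[symmetric]) (simp_all add: nn_integral_add distrib_left)

lemma step_cmult:
  assumes [measurable]: "\<psi> \<in> borel_measurable (borel \<Otimes>\<^sub>M borel)"
  shows "step V (\<lambda>z. c * \<psi> z) z = c * step V \<psi> z"
  unfolding step_def
  by (subst nn_integral_cmult[symmetric]) (simp_all add: nn_integral_cmult mult.left_commute)

lemma step_const:
  assumes "0 < V"
  shows "step V (\<lambda>_. c) z = c"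
proof -
  have "(\<integral>\<^sup>+l. ennreal (exponential_density V l) \<partial>lborel) = 1"
    using prob_space.emeasure_space_1[OF prob_space_exponential_density[OF assms]]
    by (simp add: emeasure_density)
  then show ?thesis
    unfolding step_def by (simp add: nn_integral_multc)
qed

text \<open>The renewal equation for \<open>green\<close>. A death at time \<open>l\<close> is followed by further deaths at rate
  \<open>V\<close>; integrating out \<open>l \<le> r\<close>, the density of the first death at \<open>r\<close> and that of the later ones
  add up to the constant \<open>V\<close>.\<close>

lemma green_step:
  assumes V: "0 < V" and [measurable]: "\<psi> \<in> borel_measurable (borel \<Otimes>\<^sub>M borel)"
  shows "step V (\<lambda>z. \<psi> z + green V \<psi> z) z = green V \<psi> z"
proof -
  obtain t x where z: "z = (t, x)" by (cases z)
  define k where "k r = (\<integral>\<^sup>+y. \<psi> (t + r, x + y) \<partial>p r)" for r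
  have [measurable]: "k \<in> borel_measurable borel" unfolding k_def by measurable
  have moved: "(\<integral>\<^sup>+y. green V \<psi> (t + l, x + y) \<partial>p l) = (\<integral>\<^sup>+r. ennreal V * (if l \<le> r then 1 else 0) * k r \<partial>lborel)"
    if l: "0 \<le> l" for l
  proof -
    interpret pl: prob_space "p l" by (rule prob_kernel)
    interpret P: pair_sigma_finite lborel "p l" ..
    have [measurable]: "(\<lambda>w. \<integral>\<^sup>+y'. \<psi> (t + l + fst w, x + snd w + y') \<partial>p (fst w)) \<in> borel_measurable (borel \<Otimes>\<^sub>M borel)"
      by (rule measurable_kernel_integral) measurable
    have "(\<integral>\<^sup>+y. green V \<psi> (t + l, x + y) \<partial>p l) =
      (\<integral>\<^sup>+y. \<integral>\<^sup>+s. ennreal V * indicator {0..} s * (\<integral>\<^sup>+y'. \<psi> (t + l + s, x + y + y') \<partial>p s) \<partial>lborel \<partial>p l)"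
      by (simp add: green_def)
    also have "\<dots> = (\<integral>\<^sup>+s. \<integral>\<^sup>+y. ennreal V * indicator {0..} s * (\<integral>\<^sup>+y'. \<psi> (t + l + s, x + y + y') \<partial>p s) \<partial>p l \<partial>lborel)"
      by (rule P.Fubini') (simp add: split_beta')
    also have "\<dots> = (\<integral>\<^sup>+s. ennreal V * indicator {0..} s * k (l + s) \<partial>lborel)"
    proof (intro nn_integral_cong)
      fix s :: real
      have [measurable]: "(\<lambda>y. \<integral>\<^sup>+y'. \<psi> (t + l + s, x + y + y') \<partial>p s) \<in> borel_measurable borel"
        by (rule measurable_kernel_integral) measurable
      have "(\<integral>\<^sup>+y. \<integral>\<^sup>+y'. \<psi> (t + l + s, x + y + y') \<partial>p s \<partial>p l) = k (l + s)" if "0 \<le> s"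
        using kernel_semigroup[OF l that, of "\<lambda>w. \<psi> (t + l + s, x + w)"]
        by (simp add: k_def add.assoc)
      then show "(\<integral>\<^sup>+y. ennreal V * indicator {0..} s * (\<integral>\<^sup>+y'. \<psi> (t + l + s, x + y + y') \<partial>p s) \<partial>p l) =
        ennreal V * indicator {0..} s * k (l + s)"
        by (subst nn_integral_cmult) (auto simp: indicator_def)
    qed
    also have "\<dots> = (\<integral>\<^sup>+r. ennreal V * (if l \<le> r then 1 else 0) * k r \<partial>lborel)"
      by (subst nn_integral_real_affine[where c=1 and t="- l"])
         (auto intro!: nn_integral_cong simp: indicator_def)
    finally show ?thesis .
  qed
  have exp_mass: "ennreal (exponential_density V r) + (\<integral>\<^sup>+l. ennreal (exponential_density V l) * (ennreal V * (if l \<le> r then 1 else 0)) \<partial>lborel)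
      = ennreal V * indicator {0..} r" for r
  proof -
    have "(\<integral>\<^sup>+l. ennreal (exponential_density V l) * (ennreal V * (if l \<le> r then 1 else 0)) \<partial>lborel)
        = (\<integral>\<^sup>+l. ennreal V * (ennreal (exponential_density V l) * indicator {..r} l) \<partial>lborel)"
      by (intro nn_integral_cong) (auto simp: indicator_def mult.commute)
    also have "\<dots> = ennreal V * ennreal (erlang_CDF 0 V r)"
      using emeasure_erlang_density[OF V, of 0 r]
      by (simp add: nn_integral_cmult emeasure_density)
    finally show ?thesis
      using V
      by (auto simp: erlang_CDF_def exponential_density_def indicator_def mult.commute field_simps
           simp flip: ennreal_mult ennreal_plus)
  qed
  have "step V (\<lambda>z. \<psi> z + green V \<psi> z) z =
    (\<integral>\<^sup>+l. ennreal (exponential_density V l) * k l +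
        ennreal (exponential_density V l) * (\<integral>\<^sup>+r. ennreal V * (if l \<le> r then 1 else 0) * k r \<partial>lborel) \<partial>lborel)"
    unfolding step_def
  proof (intro nn_integral_cong)
    fix l
    show "ennreal (exponential_density V l) * (\<integral>\<^sup>+y. \<psi> (fst z + l, snd z + y) + green V \<psi> (fst z + l, snd z + y) \<partial>p l) =
       ennreal (exponential_density V l) * k l +
        ennreal (exponential_density V l) * (\<integral>\<^sup>+r. ennreal V * (if l \<le> r then 1 else 0) * k r \<partial>lborel)"
    proof (cases "0 \<le> l")
      case True
      then show ?thesis
        by (subst nn_integral_add) (simp_all add: z k_def[symmetric] moved distrib_left)
    qed (simp add: exponential_density_def)
  qed
  also have "\<dots> = (\<integral>\<^sup>+l. ennreal (exponential_density V l) * k l \<partial>lborel) +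
     (\<integral>\<^sup>+l. \<integral>\<^sup>+r. ennreal (exponential_density V l) * (ennreal V * (if l \<le> r then 1 else 0) * k r) \<partial>lborel \<partial>lborel)"
    by (subst nn_integral_add) (simp_all add: nn_integral_cmult)
  also have "(\<integral>\<^sup>+l. \<integral>\<^sup>+r. ennreal (exponential_density V l) * (ennreal V * (if l \<le> r then 1 else 0) * k r) \<partial>lborel \<partial>lborel)
     = (\<integral>\<^sup>+r. \<integral>\<^sup>+l. ennreal (exponential_density V l) * (ennreal V * (if l \<le> r then 1 else 0) * k r) \<partial>lborel \<partial>lborel)"
    by (rule lborel_pair.Fubini') measurable
  also have "\<dots> = (\<integral>\<^sup>+r. (\<integral>\<^sup>+l. ennreal (exponential_density V l) * (ennreal V * (if l \<le> r then 1 else 0)) \<partial>lborel) * k r \<partial>lborel)"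
    by (intro nn_integral_cong) (subst nn_integral_multc[symmetric], simp_all add: mult.assoc)
  also have "(\<integral>\<^sup>+l. ennreal (exponential_density V l) * k l \<partial>lborel) + \<dots> =
     (\<integral>\<^sup>+r. (ennreal (exponential_density V r) + (\<integral>\<^sup>+l. ennreal (exponential_density V l) * (ennreal V * (if l \<le> r then 1 else 0)) \<partial>lborel)) * k r \<partial>lborel)"
    by (subst nn_integral_add[symmetric]) (simp_all add: distrib_right)
  also have "\<dots> = green V \<psi> z"
    unfolding exp_mass by (simp add: green_def z k_def)
  finally show ?thesis .
qed

text \<open>Every generation discounts \<open>exp (- t)\<close> by the Laplace transform of the lifetime at 1. This makes
  the contribution of late generations negligible.\<close>

lemma step_exp:
  assumes "0 < V" "0 \<le> D"
  shows "step V (\<lambda>z. ennreal (D * exp (- fst z))) z = ennreal (V / (V + 1)) * ennreal (D * exp (- fst z))"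
proof -
  have "step V (\<lambda>z. ennreal (D * exp (- fst z))) z
    = (\<integral>\<^sup>+l. ennreal (V / (V + 1) * (D * exp (- fst z))) * ennreal (exponential_density (V + 1) l) \<partial>lborel)"
    unfolding step_def
  proof (intro nn_integral_cong)
    fix l :: real
    have "exponential_density V l * (D * exp (- (fst z + l))) =
      V / (V + 1) * (D * exp (- fst z)) * exponential_density (V + 1) l"
      using assms by (auto simp: exponential_density_def field_simps simp flip: exp_add)
    then show "ennreal (exponential_density V l) * (\<integral>\<^sup>+y. ennreal (D * exp (- fst (fst z + l, snd z + y))) \<partial>p l) =
      ennreal (V / (V + 1) * (D * exp (- fst z))) * ennreal (exponential_density (V + 1) l)"
      using assms by (simp add: exponential_density_nonneg flip: ennreal_mult)
  qed
  also have "\<dots> = ennreal (V / (V + 1) * (D * exp (- fst z)))"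
  proof -
    have "(\<integral>\<^sup>+l. ennreal (exponential_density (V + 1) l) \<partial>lborel) = 1"
      using prob_space.emeasure_space_1[OF prob_space_exponential_density[of "V + 1"]] assms
      by (simp add: emeasure_density)
    then show ?thesis by (simp add: nn_integral_cmult)
  qed
  finally show ?thesis using assms by (subst ennreal_mult[symmetric]) auto
qed

text \<open>Mark each particle born at \<open>z\<close> with probability \<open>a z\<close>. Then \<open>mark_prob V \<beta> a g z\<close> is the
  probability that some particle of the first \<open>g\<close> generations of a family started at \<open>z\<close> is
  marked: either the ancestor is, or at its death, if each child independently leads to a mark with
  probability \<open>r\<close>, some child does with probability \<open>r - r powr (1 + \<beta>) / (1 + \<beta>)\<close>, by the
  offspring generating function at \<open>1 - r\<close>.\<close>

fun mark_prob :: "real \<Rightarrow> real \<Rightarrow> (real \<times> 'a \<Rightarrow> real) \<Rightarrow> nat \<Rightarrow> real \<times> 'a \<Rightarrow> real" where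
  "mark_prob V \<beta> a 0 z = 0"
| "mark_prob V \<beta> a (Suc g) z = a z + (1 - a z) *
     enn2real (step V (\<lambda>z. ennreal (mark_prob V \<beta> a g z - mark_prob V \<beta> a g z powr (1 + \<beta>) / (1 + \<beta>))) z)"

lemma measurable_mark_prob [measurable]:
  assumes [measurable]: "a \<in> borel_measurable (borel \<Otimes>\<^sub>M borel)"
  shows "mark_prob V \<beta> a g \<in> borel_measurable (borel \<Otimes>\<^sub>M borel)"
  by (induction g) (simp_all add: mark_prob.simps[abs_def])

lemma branching_bounds:
  fixes \<beta> r :: real
  assumes "0 < \<beta>" "0 \<le> r" "r \<le> 1"
  shows "0 \<le> r - r powr (1 + \<beta>) / (1 + \<beta>)" "r - r powr (1 + \<beta>) / (1 + \<beta>) \<le> r"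
proof -
  have "r powr (1 + \<beta>) \<le> r"
    using powr_mono'[of 1 "1 + \<beta>" r] assms by simp
  moreover have "r powr (1 + \<beta>) / (1 + \<beta>) \<le> r powr (1 + \<beta>)"
    using assms by (simp add: divide_le_eq mult_left_mono distrib_left)
  ultimately show "0 \<le> r - r powr (1 + \<beta>) / (1 + \<beta>)" by linarith
  show "r - r powr (1 + \<beta>) / (1 + \<beta>) \<le> r" using assms by simp
qed

lemma mark_prob_bounds:
  assumes "0 < V" "0 < \<beta>" "\<And>z. 0 \<le> a z" "\<And>z. a z \<le> 1"
  shows "0 \<le> mark_prob V \<beta> a g z" "mark_prob V \<beta> a g z \<le> 1"
proof -
  have "0 \<le> mark_prob V \<beta> a g z \<and> mark_prob V \<beta> a g z \<le> 1"
  proof (induction g arbitrary: z)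
    case (Suc g)
    define b where "b = enn2real (step V (\<lambda>z. ennreal (mark_prob V \<beta> a g z - mark_prob V \<beta> a g z powr (1 + \<beta>) / (1 + \<beta>))) z)"
    have "step V (\<lambda>z. ennreal (mark_prob V \<beta> a g z - mark_prob V \<beta> a g z powr (1 + \<beta>) / (1 + \<beta>))) z \<le> step V (\<lambda>_. 1) z"
    proof (rule step_mono)
      fix z
      have "mark_prob V \<beta> a g z - mark_prob V \<beta> a g z powr (1 + \<beta>) / (1 + \<beta>) \<le> 1"
        using Suc.IH[of z] branching_bounds(2)[OF assms(2), of "mark_prob V \<beta> a g z"] by linarith
      then show "ennreal (mark_prob V \<beta> a g z - mark_prob V \<beta> a g z powr (1 + \<beta>) / (1 + \<beta>)) \<le> 1"
        by simp
    qed
    then have "b \<le> 1"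
      unfolding b_def step_const[OF assms(1)] by (metis enn2real_leI ennreal_1 zero_le_one)
    moreover have "0 \<le> b" by (simp add: b_def)
    ultimately have "(1 - a z) * b \<le> (1 - a z) * 1"
      using assms by (intro mult_left_mono) auto
    with \<open>0 \<le> b\<close> show ?case
      using assms by (simp add: b_def[symmetric])
  qed simp
  then show "0 \<le> mark_prob V \<beta> a g z" "mark_prob V \<beta> a g z \<le> 1" by auto
qed

text \<open>Here \<open>h\<close> is the mean number of marks. One generation loses against \<open>h\<close> the nonlinear part of
  the generating function, at most \<open>h powr (1 + \<beta>) / (1 + \<beta>)\<close> at the death of the ancestor, and
  the product \<open>a * b\<close> of the probabilities of a mark on the ancestor and of one among its
  descendants. Both factors are at most 1 and at most \<open>h\<close>, and \<open>\<beta> \<le> 1\<close>, so the product is at most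
  \<open>h powr (1 + \<beta>)\<close>. The error term solves the recursion for these losses. The last term stands for
  the generations from \<open>g\<close> on.\<close>

lemma mark_prob_comparison:
  assumes V: "0 < V" and \<beta>: "0 < \<beta>" "\<beta> \<le> 1"
    and [measurable]: "a \<in> borel_measurable (borel \<Otimes>\<^sub>M borel)" and a: "\<And>z. 0 \<le> a z" "\<And>z. a z \<le> 1"
    and [measurable]: "h \<in> borel_measurable (borel \<Otimes>\<^sub>M borel)" and h0: "\<And>z. 0 \<le> h z"
    and h: "\<And>z. ennreal (h z) = ennreal (a z) + green V (\<lambda>z. ennreal (a z)) z"
    and D: "0 \<le> D" "\<And>z. h z \<le> D * exp (- fst z)"
  defines "\<psi> \<equiv> \<lambda>z. ennreal (h z powr (1 + \<beta>))"
  shows "mark_prob V \<beta> a g z \<le> h z"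
    and "ennreal (h z) \<le> ennreal (mark_prob V \<beta> a g z) +
      (\<psi> z + ennreal (1 + 1 / (1 + \<beta>)) * green V \<psi> z) + ennreal ((V / (V + 1)) ^ g) * ennreal (D * exp (- fst z))"
proof -
  let ?c = "1 / (1 + \<beta>)"
  let ?v = "mark_prob V \<beta> a"
  let ?w = "\<lambda>g z. ?v g z - ?v g z powr (1 + \<beta>) / (1 + \<beta>)"
  let ?e = "\<lambda>z. \<psi> z + ennreal (1 + ?c) * green V \<psi> z"
  let ?d = "\<lambda>g z. ennreal ((V / (V + 1)) ^ g) * ennreal (D * exp (- fst z))"
  have vb: "0 \<le> ?v g z" "?v g z \<le> 1" for g z
    using mark_prob_bounds[OF V \<beta>(1), of a] a by auto
  have [measurable]: "\<psi> \<in> borel_measurable (borel \<Otimes>\<^sub>M borel)" unfolding \<psi>_def by measurable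
  have step_h: "step V (\<lambda>z. ennreal (h z)) z = green V (\<lambda>z. ennreal (a z)) z" for z
    unfolding h by (rule green_step[OF V]) measurable
  have step_h_le: "step V (\<lambda>z. ennreal (h z)) z \<le> ennreal (h z)" for z
    by (subst step_h, subst h) simp
  have a_le_h: "a z \<le> h z" for z
  proof -
    have "ennreal (a z) \<le> ennreal (h z)" by (simp add: h)
    then show ?thesis using a h0 by (simp add: ennreal_le_iff)
  qed
  have both: "?v g z \<le> h z \<and> ennreal (h z) \<le> ennreal (?v g z) + ?e z + ?d g z" for z
  proof (induction g arbitrary: z)
    case 0
    have "ennreal (h z) \<le> ennreal (D * exp (- fst z))" using D by (intro ennreal_leI)
    then show ?case using h0 by (auto intro: add_increasing)
  next
    case (Suc g)
    define b where "b = enn2real (step V (\<lambda>z. ennreal (?w g z)) z)"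
    have w: "0 \<le> ?w g z" "?w g z \<le> ?v g z" for z
      using branching_bounds[OF \<beta>(1), of "?v g z"] vb[of g z] by auto
    have step_le1: "step V (\<lambda>z. ennreal (?w g z)) z \<le> 1"
    proof -
      have "step V (\<lambda>z. ennreal (?w g z)) z \<le> step V (\<lambda>_. 1) z"
        using order_trans[OF w(2) vb(2)] by (intro step_mono) simp
      then show ?thesis unfolding step_const[OF V] .
    qed
    have b: "ennreal b = step V (\<lambda>z. ennreal (?w g z)) z"
      using step_le1 unfolding b_def by (intro ennreal_enn2real) (auto intro: order.strict_trans1)
    have b01: "0 \<le> b" "b \<le> 1"
      using step_le1 unfolding b[symmetric] by (auto simp: b_def)
    have step_w_le: "step V (\<lambda>z. ennreal (?w g z)) z \<le> step V (\<lambda>z. ennreal (h z)) z"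
      using order_trans[OF w(2) conjunct1[OF Suc.IH]] by (intro step_mono ennreal_leI)
    have b_le_h: "b \<le> h z"
      using order_trans[OF step_w_le step_h_le] h0 unfolding b[symmetric] by (simp add: ennreal_le_iff)
    have v_Suc: "?v (Suc g) z = a z + b - a z * b"
      by (simp add: b_def algebra_simps)
    have upper: "?v (Suc g) z \<le> h z"
    proof -
      have "ennreal (a z + b) \<le> ennreal (h z)"
        unfolding h using a b01 step_w_le step_h by (simp add: b ennreal_plus add_left_mono)
      then have "a z + b \<le> h z" using h0 by (simp add: ennreal_le_iff)
      moreover have "0 \<le> a z * b" using a b01 by simp
      ultimately show ?thesis unfolding v_Suc by linarith
    qed
    have prod_le: "a z * b \<le> h z powr (1 + \<beta>)"
    proof -
      define m where "m = max (a z) b"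
      have m: "0 \<le> m" "m \<le> 1" "m \<le> h z" using a b01 a_le_h b_le_h by (auto simp: m_def)
      have "a z * b \<le> m * m" using a b01 by (intro mult_mono) (auto simp: m_def)
      also have "\<dots> = m powr 2" using m by (simp add: power2_eq_square)
      also have "\<dots> \<le> m powr (1 + \<beta>)" using m \<beta> by (intro powr_mono') auto
      also have "\<dots> \<le> h z powr (1 + \<beta>)" using m \<beta> by (intro powr_mono2) auto
      finally show ?thesis .
    qed
    have split_h: "ennreal (h z) \<le> ennreal (?w g z) + (ennreal (1 + ?c) * (\<psi> z + green V \<psi> z)) + ?d g z" for z
    proof -
      have "ennreal (?v g z) = ennreal (?w g z) + ennreal (?c * ?v g z powr (1 + \<beta>))"
        using w[of z] \<beta> by (subst ennreal_plus[symmetric]) auto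
      also have "\<dots> \<le> ennreal (?w g z) + ennreal ?c * \<psi> z"
        unfolding \<psi>_def using \<beta> Suc.IH[of z] vb[of g z]
        by (intro add_left_mono) (auto simp: ennreal_mult[symmetric] intro!: ennreal_leI divide_right_mono powr_mono2)
      finally have "ennreal (h z) \<le> (ennreal (?w g z) + ennreal ?c * \<psi> z) + ?e z + ?d g z"
        using Suc.IH[of z] by (auto intro: order_trans add_mono)
      also have "\<dots> = ennreal (?w g z) + (ennreal (1 + ?c) * (\<psi> z + green V \<psi> z)) + ?d g z"
      proof -
        have "ennreal (1 + ?c) = 1 + ennreal ?c"
          using \<beta> by (subst ennreal_plus) auto
        then show ?thesis by (simp only: distrib_left distrib_right mult_1_left add_ac)
      qed
      finally show ?thesis .
    qed
    have "step V (\<lambda>z. ennreal (h z)) z \<le>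
        step V (\<lambda>z. ennreal (?w g z) + (ennreal (1 + ?c) * (\<psi> z + green V \<psi> z)) + ?d g z) z"
      by (intro step_mono split_h)
    also have "\<dots> = ennreal b + ennreal (1 + ?c) * green V \<psi> z + ?d (Suc g) z"
    proof -
      have "step V (\<lambda>z. ennreal (?w g z) + (ennreal (1 + ?c) * (\<psi> z + green V \<psi> z)) + ?d g z) z
        = step V (\<lambda>z. ennreal (?w g z) + (ennreal (1 + ?c) * (\<psi> z + green V \<psi> z))) z + step V (?d g) z"
        by (rule step_add) measurable
      also have "step V (\<lambda>z. ennreal (?w g z) + (ennreal (1 + ?c) * (\<psi> z + green V \<psi> z))) z
        = ennreal b + step V (\<lambda>z. ennreal (1 + ?c) * (\<psi> z + green V \<psi> z)) z"
        unfolding b by (rule step_add) measurable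
      also have "step V (\<lambda>z. ennreal (1 + ?c) * (\<psi> z + green V \<psi> z)) z = ennreal (1 + ?c) * green V \<psi> z"
        by (subst step_cmult) (measurable, subst green_step[OF V \<open>\<psi> \<in> _\<close>], rule refl)
      also have "step V (?d g) z = ?d (Suc g) z"
      proof -
        have "ennreal ((V / (V + 1)) ^ Suc g) = ennreal ((V / (V + 1)) ^ g) * ennreal (V / (V + 1))"
          using V by (subst ennreal_mult[symmetric]) (auto simp: mult.commute)
        moreover have "step V (?d g) z = ennreal ((V / (V + 1)) ^ g) * step V (\<lambda>z. ennreal (D * exp (- fst z))) z"
          by (rule step_cmult) measurable
        ultimately show ?thesis by (simp only: step_exp[OF V D(1)] mult.assoc)
      qed
      finally show ?thesis by (simp only: add.assoc)
    qed
    finally have "ennreal (h z) \<le> ennreal (a z) + (ennreal b + ennreal (1 + ?c) * green V \<psi> z + ?d (Suc g) z)"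
      by (subst h, subst step_h[symmetric]) (rule add_left_mono)
    also have "\<dots> = ennreal (a z + b) + ennreal (1 + ?c) * green V \<psi> z + ?d (Suc g) z"
      using a b01 by (simp add: ennreal_plus add_ac del: power_Suc)
    also have "ennreal (a z + b) = ennreal (?v (Suc g) z) + ennreal (a z * b)"
      using vb[of "Suc g" z] a b01 unfolding v_Suc by (subst ennreal_plus[symmetric]) auto
    also have "\<dots> \<le> ennreal (?v (Suc g) z) + \<psi> z"
      unfolding \<psi>_def using prod_le by (intro add_left_mono ennreal_leI)
    finally have "ennreal (h z) \<le> ennreal (?v (Suc g) z) + ?e z + ?d (Suc g) z"
      by (simp add: add_ac add_right_mono del: power_Suc mark_prob.simps)
    with upper show ?case by blast
  qed
  show "?v g z \<le> h z" "ennreal (h z) \<le> ennreal (?v g z) + ?e z + ?d g z"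
    using both by blast+
qed

end

section \<open>Occupation of the unit ball\<close>

text \<open>Hoelder's inequality with weight \<open>w\<close>, obtained by integrating Young's inequality (the tangent of
  \<open>r powr (1 + \<beta>)\<close> at the weighted mean \<open>F / W\<close>).\<close>

lemma weighted_power_mean:
  fixes f w :: "'b \<Rightarrow> real"
  assumes [measurable]: "f \<in> borel_measurable N" "w \<in> borel_measurable N"
    and f: "\<And>s. 0 \<le> f s" and w: "\<And>s. 0 \<le> w s" and null: "\<And>s. w s = 0 \<Longrightarrow> f s = 0"
    and W: "(\<integral>\<^sup>+s. ennreal (w s) \<partial>N) = ennreal W" "0 < W"
    and F: "(\<integral>\<^sup>+s. ennreal (f s) \<partial>N) = ennreal F" "0 \<le> F"
    and \<beta>: "0 < \<beta>"
  shows "ennreal (F powr (1 + \<beta>)) \<le> ennreal (W powr \<beta>) * (\<integral>\<^sup>+s. ennreal (f s powr (1 + \<beta>) * w s powr (- \<beta>)) \<partial>N)"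
proof -
  define l where "l = F / W"
  have l: "0 \<le> l" using F W by (simp add: l_def)
  have young: "(1 + \<beta>) * l powr \<beta> * f s \<le> f s powr (1 + \<beta>) * w s powr (- \<beta>) + \<beta> * l powr (1 + \<beta>) * w s" for s
  proof (cases "w s = 0")
    case True
    then show ?thesis using null[OF True] by simp
  next
    case False
    then have ws: "0 < w s" using w[of s] by linarith
    define u where "u = f s / w s"
    have u: "0 \<le> u" using f ws by (simp add: u_def)
    have "u * l powr \<beta> \<le> u powr (1 + \<beta>) / (1 + \<beta>) + (l powr \<beta>) powr ((1 + \<beta>) / \<beta>) / ((1 + \<beta>) / \<beta>)"
      using u \<beta> by (intro Youngs_inequality) (auto simp: field_simps)
    also have "(l powr \<beta>) powr ((1 + \<beta>) / \<beta>) = l powr (1 + \<beta>)"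
      using \<beta> by (simp add: powr_powr)
    finally have "(1 + \<beta>) * (u * l powr \<beta>) \<le> (1 + \<beta>) * (u powr (1 + \<beta>) / (1 + \<beta>) + l powr (1 + \<beta>) / ((1 + \<beta>) / \<beta>))"
      using \<beta> by (intro mult_left_mono) auto
    also have "\<dots> = u powr (1 + \<beta>) + \<beta> * l powr (1 + \<beta>)"
      using \<beta> by (simp add: distrib_left)
    finally have "(1 + \<beta>) * (u * l powr \<beta>) * w s \<le> (u powr (1 + \<beta>) + \<beta> * l powr (1 + \<beta>)) * w s"
      using ws by (intro mult_right_mono) auto
    moreover have "u * w s = f s" using ws by (simp add: u_def)
    moreover have "u powr (1 + \<beta>) * w s = f s powr (1 + \<beta>) * w s powr (- \<beta>)"
      using ws f[of s] by (simp add: u_def powr_divide powr_add powr_minus field_simps)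
    moreover have "(1 + \<beta>) * (u * l powr \<beta>) * w s = (1 + \<beta>) * l powr \<beta> * (u * w s)"
      by (simp add: algebra_simps)
    ultimately show ?thesis by (simp add: distrib_right)
  qed
  define X where "X = (\<integral>\<^sup>+s. ennreal (f s powr (1 + \<beta>) * w s powr (- \<beta>)) \<partial>N)"
  have "ennreal ((1 + \<beta>) * l powr \<beta> * F) = (\<integral>\<^sup>+s. ennreal ((1 + \<beta>) * l powr \<beta> * f s) \<partial>N)"
    using \<beta> F f by (simp add: ennreal_mult F(1)[symmetric] nn_integral_cmult)
  also have "\<dots> \<le> (\<integral>\<^sup>+s. ennreal (f s powr (1 + \<beta>) * w s powr (- \<beta>) + \<beta> * l powr (1 + \<beta>) * w s) \<partial>N)"
    by (intro nn_integral_mono ennreal_leI young)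
  also have "\<dots> = (\<integral>\<^sup>+s. ennreal (f s powr (1 + \<beta>) * w s powr (- \<beta>)) + ennreal (\<beta> * l powr (1 + \<beta>)) * ennreal (w s) \<partial>N)"
    using \<beta> w by (intro nn_integral_cong) (simp add: ennreal_plus ennreal_mult)
  also have "\<dots> = X + ennreal (\<beta> * l powr (1 + \<beta>)) * ennreal W"
    unfolding X_def W(1)[symmetric] by (subst nn_integral_add) (simp_all add: nn_integral_cmult)
  also have "\<dots> = X + ennreal (\<beta> * l powr \<beta> * F)"
  proof -
    have "l powr (1 + \<beta>) * W = l powr \<beta> * F"
      using l W F(2) by (simp add: powr_add l_def)
    then have "\<beta> * l powr (1 + \<beta>) * W = \<beta> * l powr \<beta> * F" by simp
    moreover have "0 \<le> \<beta> * l powr (1 + \<beta>)" using \<beta> by simp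
    ultimately show ?thesis using W(2) by (metis ennreal_mult less_imp_le)
  qed
  finally have main: "ennreal ((1 + \<beta>) * l powr \<beta> * F) \<le> X + ennreal (\<beta> * l powr \<beta> * F)" .
  show ?thesis
  proof (cases X)
    case (real x)
    with main have "(1 + \<beta>) * l powr \<beta> * F \<le> x + \<beta> * l powr \<beta> * F"
      using \<beta> F by (simp flip: ennreal_plus)
    then have "l powr \<beta> * F \<le> x" by (simp add: algebra_simps)
    then have "W powr \<beta> * (l powr \<beta> * F) \<le> W powr \<beta> * x"
      by (intro mult_left_mono) auto
    moreover have "W powr \<beta> * (l powr \<beta> * F) = F powr (1 + \<beta>)"
      using W F by (simp add: l_def powr_divide powr_add)
    ultimately show ?thesis
      using real by (simp add: X_def[symmetric] ennreal_mult[symmetric] ennreal_leI)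
  next
    case top
    then show ?thesis using W by (simp add: X_def[symmetric] ennreal_mult_top)
  qed
qed

lemma nn_integral_powr_from_0:
  fixes e c :: real
  assumes "- 1 < e" "0 \<le> c"
  shows "(\<integral>\<^sup>+s. ennreal (indicator {0<..c} s * s powr e) \<partial>lborel) = ennreal (c powr (e + 1) / (e + 1))"
proof -
  have "(\<integral>\<^sup>+s. ennreal (indicator {0<..c} s * s powr e) \<partial>lborel) = (\<integral>\<^sup>+s. ennreal (indicator {0..c} s * s powr e) \<partial>lborel)"
    by (intro nn_integral_cong_AE eventually_mono[OF AE_lborel_singleton[of 0]]) (auto simp: indicator_def)
  also have "\<dots> = ennreal (c powr (e + 1) / (e + 1))"
  proof (rule nn_integral_has_integral_lborel)
    have "((\<lambda>x. x powr e) has_integral (c powr (e + 1) / (e + 1))) {0..c}"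
      using assms by (rule has_integral_powr_from_0)
    then show "((\<lambda>s. indicator {0..c} s * s powr e) has_integral (c powr (e + 1) / (e + 1))) UNIV"
      by (subst (asm) has_integral_restrict_UNIV[symmetric])
         (auto elim!: has_integral_eq[rotated] simp: indicator_def)
  qed auto
  finally show ?thesis .
qed

lemma add_powr_le:
  fixes u w r :: real
  assumes "0 \<le> u" "0 \<le> w" "0 \<le> r"
  shows "(u + w) powr r \<le> 2 powr r * (u powr r + w powr r)"
proof -
  have "(u + w) powr r \<le> (2 * max u w) powr r"
    using assms by (intro powr_mono2) auto
  also have "\<dots> = 2 powr r * max u w powr r"
    using assms by (simp add: powr_mult)
  also have "\<dots> \<le> 2 powr r * (u powr r + w powr r)"
    by (intro mult_left_mono) (auto simp: max_def)
  finally show ?thesis .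
qed

lemma cball_in_borel [measurable]: "cball c r \<in> sets borel"
  by simp

text \<open>The marking probability of a birth: \<open>\<theta>\<close> for births in the unit ball between \<open>T\<close> and \<open>S\<close>.\<close>

definition window :: "real \<Rightarrow> real \<Rightarrow> real \<Rightarrow> real \<times> 'a::euclidean_space \<Rightarrow> real" where
  "window \<theta> T S z = \<theta> * indicator {T..S} (fst z) * indicator (cball 0 1) (snd z)"

lemma measurable_window [measurable]: "window \<theta> T S \<in> borel_measurable (borel \<Otimes>\<^sub>M borel)"
  unfolding window_def[abs_def] by measurable

context stable_semigroup
begin

lemma kernel_lebesgue_invariant:
  assumes [measurable]: "f \<in> borel_measurable borel"
  shows "(\<integral>\<^sup>+x. \<integral>\<^sup>+y. f (x + y) \<partial>p s \<partial>lborel) = (\<integral>\<^sup>+x. f x \<partial>lborel)"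
proof -
  interpret ps: prob_space "p s" by (rule prob_kernel)
  interpret P: pair_sigma_finite lborel "p s" ..
  have "(\<integral>\<^sup>+x. \<integral>\<^sup>+y. f (x + y) \<partial>p s \<partial>lborel) = (\<integral>\<^sup>+y. \<integral>\<^sup>+x. f (x + y) \<partial>lborel \<partial>p s)"
    by (rule P.Fubini'[symmetric]) measurable
  also have "\<dots> = (\<integral>\<^sup>+y. \<integral>\<^sup>+x. f x \<partial>lborel \<partial>p s)"
  proof (rule nn_integral_cong)
    fix y
    show "(\<integral>\<^sup>+x. f (x + y) \<partial>lborel) = (\<integral>\<^sup>+x. f x \<partial>lborel)"
      using nn_integral_lborel_scale[of f 1 y] by (simp add: add.commute)
  qed
  finally show ?thesis by simp
qed

definition visit :: "real \<Rightarrow> 'a \<Rightarrow> ennreal" where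
  "visit s x = (\<integral>\<^sup>+y. indicator (cball 0 1) (x + y) \<partial>p s)"

lemma measurable_visit [measurable]: "(\<lambda>(s, x). visit s x) \<in> borel_measurable (borel \<Otimes>\<^sub>M borel)"
  unfolding visit_def split_beta' by (rule measurable_kernel_integral) measurable

lemma visit_total: "(\<integral>\<^sup>+x. visit s x \<partial>lborel) = emeasure lborel (cball (0::'a) 1)"
  unfolding visit_def by (subst kernel_lebesgue_invariant) simp_all

lemma visit_le_1: "visit s x \<le> 1"
proof -
  have "visit s x \<le> (\<integral>\<^sup>+y. 1 \<partial>p s)" unfolding visit_def by (intro nn_integral_mono) (auto simp: indicator_def)
  then show ?thesis by simp
qed

definition visit_density_bound :: "real \<Rightarrow> real \<Rightarrow> bool" where
  "visit_density_bound C a0 \<longleftrightarrow> 1 \<le> C \<and> 0 \<le> a0 \<and> (\<forall>s>0. \<forall>x. visit s x \<le> ennreal (C * s powr (- a0)))"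

text \<open>After time 1 lowering the exponent from \<open>d / \<alpha>\<close> to \<open>a0\<close> only weakens the bound, and before
  time 1 the trivial bound by 1 suffices.\<close>

lemma visit_density_bound_exists:
  assumes "0 \<le> a0" "a0 \<le> real DIM('a) / \<alpha>"
  obtains C where "visit_density_bound C a0"
proof -
  obtain C where C: "1 \<le> C" and
    Cb: "\<And>s x. 0 < s \<Longrightarrow> visit s x \<le> ennreal (C * s powr (- real DIM('a) / \<alpha>))"
    using kernel_unit_ball_bound unfolding visit_def by blast
  have "visit s x \<le> ennreal (C * s powr (- a0))" if s: "0 < s" for s x
  proof (cases "1 \<le> s")
    case True
    have "s powr (- real DIM('a) / \<alpha>) \<le> s powr (- a0)"
      using True assms by (intro powr_mono) auto
    then have "C * s powr (- real DIM('a) / \<alpha>) \<le> C * s powr (- a0)"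
      using C by (intro mult_left_mono) auto
    then show ?thesis using Cb[OF s, of x] by (meson ennreal_leI order_trans)
  next
    case False
    then have "1 \<le> s powr (- a0)"
      using powr_mono'[of "- a0" 0 s] s assms by simp
    then have "1 \<le> C * s powr (- a0)"
      using C mult_mono[of 1 C 1 "s powr (- a0)"] by simp
    then show ?thesis using visit_le_1[of s x]
      by (meson ennreal_1 ennreal_leI order_trans le_numeral_extra(4) ennreal_ge_1)
  qed
  then have "visit_density_bound C a0" using C assms by (auto simp: visit_density_bound_def)
  then show ?thesis by (rule that)
qed

text \<open>The mean time spent in the unit ball up to \<open>S\<close> by a single motion started at \<open>x\<close>.\<close>

definition occupation :: "real \<Rightarrow> 'a \<Rightarrow> real" where
  "occupation S x = enn2real (\<integral>\<^sup>+s. indicator {0<..S} s * visit s x \<partial>lborel)"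

lemma measurable_occupation_integral [measurable]:
  "(\<lambda>x. \<integral>\<^sup>+s. indicator {0<..S} s * visit s x \<partial>lborel) \<in> borel_measurable borel"
proof -
  have "(\<lambda>(x, s). indicator {0<..S} s * (case (s, x) of (s, x) \<Rightarrow> visit s x)) \<in> borel_measurable (borel \<Otimes>\<^sub>M lborel)"
    by measurable
  then show ?thesis by (intro lborel.borel_measurable_nn_integral) (simp add: split_beta')
qed

lemma measurable_occupation [measurable]: "occupation S \<in> borel_measurable borel"
  unfolding occupation_def[abs_def] by measurable

lemma occupation_eq:
  assumes "0 \<le> S"
  shows "ennreal (occupation S x) = (\<integral>\<^sup>+s. indicator {0<..S} s * visit s x \<partial>lborel)"
proof -
  have "(\<integral>\<^sup>+s. indicator {0<..S} s * visit s x \<partial>lborel) \<le> (\<integral>\<^sup>+s. indicator {0<..S} s \<partial>lborel)"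
    using visit_le_1 by (intro nn_integral_mono) (metis mult.right_neutral mult_left_mono zero_le)
  also have "\<dots> < \<infinity>" using assms by simp
  finally show ?thesis unfolding occupation_def by (intro ennreal_enn2real) simp
qed

text \<open>Since \<open>\<integral> visit s x dx\<close> does not depend on \<open>s\<close>, the integral of \<open>visit s x powr (1 + \<beta>)\<close>
  over \<open>x\<close> is of order \<open>s powr (- a0 * \<beta>) = s powr (- a1 * (1 + \<beta>))\<close>. Hoelder's inequality with
  weight \<open>s powr (- a1)\<close>, which is integrable at 0 as \<open>a1 < 1\<close>, combines the different times.\<close>

lemma occupation_norm:
  assumes C: "visit_density_bound C a0" and \<beta>: "0 < \<beta>"
    and a1: "a1 * (1 + \<beta>) = a0 * \<beta>" "a1 < 1" and S: "0 < S"
  shows "(\<integral>\<^sup>+x. ennreal (occupation S x powr (1 + \<beta>)) \<partial>lborel) \<le>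
    ennreal (C powr \<beta> * (S powr (1 - a1) / (1 - a1)) powr (1 + \<beta>)) * emeasure lborel (cball (0::'a) 1)"
proof -
  define W where "W = S powr (1 - a1) / (1 - a1)"
  have W: "0 < W" using a1 S by (simp add: W_def)
  define w where "w s = indicator {0<..S} s * s powr (- a1)" for s :: real
  have [measurable]: "w \<in> borel_measurable borel" unfolding w_def by measurable
  have w: "0 \<le> w s" for s by (simp add: w_def)
  have W_int: "(\<integral>\<^sup>+s. ennreal (w s) \<partial>lborel) = ennreal W"
    unfolding w_def W_def using nn_integral_powr_from_0[of "- a1" S] a1 S by simp
  define q where "q s x = enn2real (visit s x)" for s x
  have [measurable]: "(\<lambda>(s, x). q s x) \<in> borel_measurable (borel \<Otimes>\<^sub>M borel)"
    unfolding q_def split_beta' by measurable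
  have [measurable]: "(\<lambda>s. q s x) \<in> borel_measurable borel" for x
  proof -
    have "(\<lambda>s. case (s, x) of (s, x) \<Rightarrow> q s x) \<in> borel_measurable borel" by measurable
    then show ?thesis by simp
  qed
  have q: "visit s x = ennreal (q s x)" "0 \<le> q s x" for s x
    unfolding q_def using le_less_trans[OF visit_le_1[of s x], of top] by (simp_all add: ennreal_enn2real)
  have pointwise: "ennreal (occupation S x powr (1 + \<beta>)) \<le>
      ennreal (W powr \<beta>) * (\<integral>\<^sup>+s. ennreal ((indicator {0<..S} s * q s x) powr (1 + \<beta>) * w s powr (- \<beta>)) \<partial>lborel)" for x
  proof (rule weighted_power_mean[OF _ _ _ _ _ W_int W _ _ \<beta>])
    show "(\<integral>\<^sup>+s. ennreal (indicator {0<..S} s * q s x) \<partial>lborel) = ennreal (occupation S x)"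
      using S by (simp add: occupation_eq q ennreal_mult' ennreal_indicator)
    show "0 \<le> occupation S x" by (simp add: occupation_def)
  qed (auto simp: w_def q indicator_def)
  have inner: "(\<integral>\<^sup>+x. ennreal ((indicator {0<..S} s * q s x) powr (1 + \<beta>) * w s powr (- \<beta>)) \<partial>lborel)
      \<le> ennreal (C powr \<beta>) * emeasure lborel (cball (0::'a) 1) * ennreal (w s)" for s
  proof (cases "s \<in> {0<..S}")
    case True
    then have s: "0 < s" "indicator {0<..S} s = (1::real)" by auto
    have "(\<integral>\<^sup>+x. ennreal ((indicator {0<..S} s * q s x) powr (1 + \<beta>) * w s powr (- \<beta>)) \<partial>lborel)
       \<le> (\<integral>\<^sup>+x. ennreal (C powr \<beta> * w s) * visit s x \<partial>lborel)"
    proof (rule nn_integral_mono)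
      fix x
      have Cq: "q s x \<le> C * s powr (- a0)"
        using C s unfolding visit_density_bound_def q(1) by (auto simp: ennreal_le_iff)
      have "q s x powr (1 + \<beta>) = q s x powr \<beta> * q s x"
        using q(2)[of s x] by (cases "q s x = 0") (auto simp: powr_add)
      also have "\<dots> \<le> (C * s powr (- a0)) powr \<beta> * q s x"
        using Cq q(2) \<beta> by (intro mult_right_mono powr_mono2) auto
      also have "(C * s powr (- a0)) powr \<beta> = C powr \<beta> * s powr (- (a1 * (1 + \<beta>)))"
        using C s by (simp add: powr_mult powr_powr a1 visit_density_bound_def)
      finally have "q s x powr (1 + \<beta>) * w s powr (- \<beta>) \<le> (C powr \<beta> * s powr (- (a1 * (1 + \<beta>))) * q s x) * w s powr (- \<beta>)"
        by (intro mult_right_mono) auto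
      also have wb: "w s powr (- \<beta>) = s powr (a1 * \<beta>)"
        using s by (simp add: w_def powr_powr)
      also have "(C powr \<beta> * s powr (- (a1 * (1 + \<beta>))) * q s x) * s powr (a1 * \<beta>) = C powr \<beta> * w s * q s x"
      proof -
        have "s powr (- (a1 * (1 + \<beta>))) * s powr (a1 * \<beta>) = w s"
          using s by (simp add: w_def algebra_simps flip: powr_add)
        then show ?thesis by (metis mult.assoc mult.commute)
      qed
      finally show "ennreal ((indicator {0<..S} s * q s x) powr (1 + \<beta>) * w s powr (- \<beta>)) \<le> ennreal (C powr \<beta> * w s) * visit s x"
        using s q(2) w by (simp add: q(1) wb ennreal_mult[symmetric] ennreal_leI)
    qed
    also have "\<dots> = ennreal (C powr \<beta> * w s) * emeasure lborel (cball (0::'a) 1)"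
      by (simp add: nn_integral_cmult visit_total)
    finally show ?thesis using s by (simp add: w_def ennreal_mult mult_ac)
  next
    case False
    then show ?thesis by simp
  qed
  define k where "k x s = ennreal ((indicator {0<..S} s * q s x) powr (1 + \<beta>) * w s powr (- \<beta>))" for x s
  have k: "(\<lambda>(x, s). k x s) \<in> borel_measurable (lborel \<Otimes>\<^sub>M lborel)"
  proof -
    have "(\<lambda>(x, s). ennreal ((indicator {0<..S} s * (case (s, x) of (s, x) \<Rightarrow> q s x)) powr (1 + \<beta>) * w s powr (- \<beta>)))
      \<in> borel_measurable (borel \<Otimes>\<^sub>M borel)"
      by measurable
    then show ?thesis by (simp add: k_def split_beta')
  qed
  have "(\<integral>\<^sup>+x. ennreal (occupation S x powr (1 + \<beta>)) \<partial>lborel) \<le>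
    (\<integral>\<^sup>+x. ennreal (W powr \<beta>) * (\<integral>\<^sup>+s. k x s \<partial>lborel) \<partial>lborel)"
    unfolding k_def by (intro nn_integral_mono pointwise)
  also have "\<dots> = ennreal (W powr \<beta>) * (\<integral>\<^sup>+x. \<integral>\<^sup>+s. k x s \<partial>lborel \<partial>lborel)"
    by (rule nn_integral_cmult) (rule lborel.borel_measurable_nn_integral[OF k])
  also have "(\<integral>\<^sup>+x. \<integral>\<^sup>+s. k x s \<partial>lborel \<partial>lborel) = (\<integral>\<^sup>+s. \<integral>\<^sup>+x. k x s \<partial>lborel \<partial>lborel)"
    by (rule lborel_pair.Fubini'[OF k, symmetric])
  also have "ennreal (W powr \<beta>) * (\<integral>\<^sup>+s. \<integral>\<^sup>+x. k x s \<partial>lborel \<partial>lborel)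
      \<le> ennreal (W powr \<beta>) * (\<integral>\<^sup>+s. ennreal (C powr \<beta>) * emeasure lborel (cball (0::'a) 1) * ennreal (w s) \<partial>lborel)"
    using inner unfolding k_def by (intro mult_left_mono nn_integral_mono) auto
  also have "\<dots> = ennreal (W powr \<beta>) * (ennreal (C powr \<beta>) * emeasure lborel (cball (0::'a) 1) * ennreal W)"
    by (simp add: nn_integral_cmult W_int)
  also have "\<dots> = ennreal (C powr \<beta> * (W * W powr \<beta>)) * emeasure lborel (cball (0::'a) 1)"
    using W by (simp add: ennreal_mult mult_ac)
  also have "W * W powr \<beta> = W powr (1 + \<beta>)"
    using W by (simp add: powr_add)
  finally show ?thesis unfolding W_def .
qed

text \<open>The mean number of marks in a family started at \<open>z\<close>.\<close>

definition marks :: "real \<Rightarrow> real \<Rightarrow> real \<Rightarrow> real \<Rightarrow> real \<times> 'a \<Rightarrow> ennreal" where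
  "marks V \<theta> T S z = ennreal (window \<theta> T S z) + green V (\<lambda>z. ennreal (window \<theta> T S z)) z"

lemma green_window:
  assumes "0 \<le> \<theta>"
  shows "green V (\<lambda>z. ennreal (window \<theta> T S z)) (t, x) =
    ennreal \<theta> * (ennreal V * (\<integral>\<^sup>+s. indicator {0..} s * indicator {T..S} (t + s) * visit s x \<partial>lborel))"
proof -
  have [measurable]: "(\<lambda>s. visit s x) \<in> borel_measurable borel"
  proof -
    have "(\<lambda>s. case (s, x) of (s, x) \<Rightarrow> visit s x) \<in> borel_measurable borel" by measurable
    then show ?thesis by simp
  qed
  have "(\<integral>\<^sup>+y. ennreal (window \<theta> T S (t + s, x + y)) \<partial>p s) = ennreal \<theta> * indicator {T..S} (t + s) * visit s x" for s
  proof -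
    have "(\<integral>\<^sup>+y. ennreal (window \<theta> T S (t + s, x + y)) \<partial>p s) =
      (\<integral>\<^sup>+y. ennreal \<theta> * indicator {T..S} (t + s) * indicator (cball 0 1) (x + y) \<partial>p s)"
      using assms by (intro nn_integral_cong) (auto simp: window_def indicator_def)
    then show ?thesis by (simp add: nn_integral_cmult visit_def)
  qed
  then show ?thesis
    unfolding green_def
    by (simp add: nn_integral_cmult[symmetric]) (simp add: mult_ac)
qed

lemma marks_bounds:
  assumes "0 \<le> \<theta>" "0 < V" "0 \<le> T" "T \<le> S"
  shows "marks V \<theta> T S z \<le> ennreal (\<theta> * (1 + V * S))"
    and "S < fst z \<Longrightarrow> marks V \<theta> T S z = 0"
    and "0 \<le> fst z \<Longrightarrow> marks V \<theta> T S z \<le> ennreal (\<theta> * (indicator (cball 0 1) (snd z) + V * occupation S (snd z)))"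
proof -
  obtain t x where z: "z = (t, x)" by (cases z)
  define I where "I = (\<integral>\<^sup>+s. indicator {0..} s * indicator {T..S} (t + s) * visit s x \<partial>lborel)"
  have m: "marks V \<theta> T S z = ennreal (window \<theta> T S z) + ennreal \<theta> * (ennreal V * I)"
    unfolding marks_def z green_window[OF assms(1)] I_def ..
  have "I \<le> (\<integral>\<^sup>+s. indicator {T - t..S - t} s \<partial>lborel)"
    unfolding I_def using visit_le_1
    by (intro nn_integral_mono) (auto simp: indicator_def)
  also have "\<dots> \<le> ennreal S" using assms by (simp add: ennreal_leI)
  finally have I_le: "I \<le> ennreal S" .
  have "marks V \<theta> T S z \<le> ennreal \<theta> + ennreal \<theta> * (ennreal V * ennreal S)"
    unfolding m using I_le assms
    by (intro add_mono mult_left_mono ennreal_leI) (auto simp: window_def indicator_def)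
  also have "\<dots> = ennreal (\<theta> * (1 + V * S))"
    using assms by (simp add: distrib_left ennreal_mult[symmetric] ennreal_plus[symmetric] del: ennreal_plus)
  finally show "marks V \<theta> T S z \<le> ennreal (\<theta> * (1 + V * S))" .
  show "marks V \<theta> T S z = 0" if "S < fst z"
  proof -
    have "I = (\<integral>\<^sup>+(s::real). 0 \<partial>lborel)"
      unfolding I_def using that z by (intro nn_integral_cong) (auto simp: indicator_def)
    then show ?thesis unfolding m using that by (simp add: window_def)
  qed
  show "marks V \<theta> T S z \<le> ennreal (\<theta> * (indicator (cball 0 1) (snd z) + V * occupation S (snd z)))" if "0 \<le> fst z"
  proof -
    have "I \<le> (\<integral>\<^sup>+s. indicator {0<..S} s * visit s x \<partial>lborel)"
      unfolding I_def
      by (intro nn_integral_mono_AE eventually_mono[OF AE_lborel_singleton[of 0]])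
         (use that z in \<open>auto simp: indicator_def\<close>)
    then have I_occ: "I \<le> ennreal (occupation S x)"
      using assms by (simp add: occupation_eq)
    have "marks V \<theta> T S z \<le> ennreal (\<theta> * indicator (cball 0 1) x) + ennreal \<theta> * (ennreal V * ennreal (occupation S x))"
      unfolding m using I_occ assms
      by (intro add_mono mult_left_mono ennreal_leI) (auto simp: window_def indicator_def z)
    also have "\<dots> = ennreal (\<theta> * (indicator (cball 0 1) x + V * occupation S x))"
      using assms by (simp add: distrib_left ennreal_mult[symmetric] ennreal_plus[symmetric] occupation_def del: ennreal_plus)
    finally show ?thesis by (simp add: z)
  qed
qed

text \<open>Lebesgue measure is invariant under the motion, so the integral over the starting point only sees
  the time component of the Green operator.\<close>

lemma green_total:
  assumes [measurable]: "\<psi> \<in> borel_measurable (borel \<Otimes>\<^sub>M borel)"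
  shows "(\<integral>\<^sup>+x. green V \<psi> (t, x) \<partial>lborel) = (\<integral>\<^sup>+s. ennreal V * indicator {0..} s * (\<integral>\<^sup>+x. \<psi> (t + s, x) \<partial>lborel) \<partial>lborel)"
proof -
  have [measurable]: "(\<lambda>w. \<integral>\<^sup>+y. \<psi> (t + snd w, fst w + y) \<partial>p (snd w)) \<in> borel_measurable (borel \<Otimes>\<^sub>M borel)"
    by (rule measurable_kernel_integral) measurable
  have [measurable]: "(\<lambda>x. \<integral>\<^sup>+y. \<psi> (t + s, x + y) \<partial>p s) \<in> borel_measurable borel" for s
    by (rule measurable_kernel_integral) measurable
  have "(\<integral>\<^sup>+x. green V \<psi> (t, x) \<partial>lborel) =
     (\<integral>\<^sup>+x. \<integral>\<^sup>+s. ennreal V * indicator {0..} s * (\<integral>\<^sup>+y. \<psi> (t + s, x + y) \<partial>p s) \<partial>lborel \<partial>lborel)"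
    by (simp add: green_def)
  also have "\<dots> = (\<integral>\<^sup>+s. \<integral>\<^sup>+x. ennreal V * indicator {0..} s * (\<integral>\<^sup>+y. \<psi> (t + s, x + y) \<partial>p s) \<partial>lborel \<partial>lborel)"
    by (rule lborel_pair.Fubini'[symmetric]) (simp add: split_beta')
  also have "\<dots> = (\<integral>\<^sup>+s. ennreal V * indicator {0..} s * (\<integral>\<^sup>+x. \<psi> (t + s, x) \<partial>lborel) \<partial>lborel)"
  proof (rule nn_integral_cong)
    fix s
    show "(\<integral>\<^sup>+x. ennreal V * indicator {0..} s * (\<integral>\<^sup>+y. \<psi> (t + s, x + y) \<partial>p s) \<partial>lborel) =
      ennreal V * indicator {0..} s * (\<integral>\<^sup>+x. \<psi> (t + s, x) \<partial>lborel)"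
      using kernel_lebesgue_invariant[of "\<lambda>x. \<psi> (t + s, x)" s]
      by (simp add: nn_integral_cmult)
  qed
  finally show ?thesis .
qed

lemma emeasure_unit_ball: 
  obtains Q where "0 < Q" "emeasure lborel (cball (0::'a) 1) = ennreal Q"
proof
  show "emeasure lborel (cball (0::'a) 1) = ennreal (measure lborel (cball (0::'a) 1))"
    using emeasure_lborel_cball_finite[of "0::'a" 1] by (intro emeasure_eq_ennreal_measure) auto
  show "0 < measure lborel (cball (0::'a) 1)"
    using content_ball_pos[of 1 "0::'a"] content_cball_conv_ball[of "0::'a" 1] by (simp add: measure_completion)
qed

lemma marks_power_total:
  assumes \<theta>: "0 \<le> \<theta>" and V: "0 < V" and T: "0 \<le> T" "T \<le> S" "1 \<le> S" and t: "0 \<le> t"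
    and C: "visit_density_bound C a0" and \<beta>: "0 < \<beta>" and a1: "a1 * (1 + \<beta>) = a0 * \<beta>" "a1 < 1"
  shows "(\<integral>\<^sup>+x. ennreal (enn2real (marks V \<theta> T S (t, x)) powr (1 + \<beta>)) \<partial>lborel) \<le>
    ennreal (\<theta> powr (1 + \<beta>) * (2 powr (1 + \<beta>) * (1 + V powr (1 + \<beta>) * C powr \<beta> * (1 / (1 - a1)) powr (1 + \<beta>))) *
      S powr ((1 - a1) * (1 + \<beta>))) * emeasure lborel (cball (0::'a) 1)"
proof -
  define B where "B = emeasure lborel (cball (0::'a) 1)"
  define r where "r = 1 + \<beta>"
  have r: "0 < r" using \<beta> by (simp add: r_def)
  have occ0: "0 \<le> occupation S x" for x by (simp add: occupation_def)
  have pw: "enn2real (marks V \<theta> T S (t, x)) powr r \<le>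
    \<theta> powr r * (2 powr r * (indicator (cball 0 1) x + V powr r * occupation S x powr r))" for x
  proof -
    have "enn2real (marks V \<theta> T S (t, x)) \<le> \<theta> * (indicator (cball 0 1) x + V * occupation S x)"
      using marks_bounds(3)[OF \<theta> V T(1,2), of "(t, x)"] \<theta> V t occ0
      by (intro enn2real_leI) auto
    then have "enn2real (marks V \<theta> T S (t, x)) powr r \<le> (\<theta> * (indicator (cball 0 1) x + V * occupation S x)) powr r"
      using r by (intro powr_mono2) auto
    also have "\<dots> = \<theta> powr r * (indicator (cball 0 1) x + V * occupation S x) powr r"
      using \<theta> V occ0 by (simp add: powr_mult)
    also have "\<dots> \<le> \<theta> powr r * (2 powr r * (indicator (cball 0 1) x powr r + (V * occupation S x) powr r))"
      using V occ0 r by (intro mult_left_mono add_powr_le) auto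
    also have "\<dots> = \<theta> powr r * (2 powr r * (indicator (cball 0 1) x + V powr r * occupation S x powr r))"
      using V occ0 r by (simp add: powr_mult indicator_def)
    finally show ?thesis .
  qed
  have "(\<integral>\<^sup>+x. ennreal (enn2real (marks V \<theta> T S (t, x)) powr r) \<partial>lborel) \<le>
    (\<integral>\<^sup>+x. ennreal (\<theta> powr r * 2 powr r) * (indicator (cball 0 1) x + ennreal (V powr r) * ennreal (occupation S x powr r)) \<partial>lborel)"
  proof (rule nn_integral_mono)
    fix x
    have "ennreal (enn2real (marks V \<theta> T S (t, x)) powr r) \<le> ennreal (\<theta> powr r * (2 powr r * (indicator (cball 0 1) x + V powr r * occupation S x powr r)))"
      by (intro ennreal_leI pw)
    also have "\<dots> = ennreal (\<theta> powr r * 2 powr r) * (indicator (cball 0 1) x + ennreal (V powr r) * ennreal (occupation S x powr r))"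
      by (simp add: ennreal_mult mult.assoc ennreal_indicator)
    finally show "ennreal (enn2real (marks V \<theta> T S (t, x)) powr r) \<le> ennreal (\<theta> powr r * 2 powr r) * (indicator (cball 0 1) x + ennreal (V powr r) * ennreal (occupation S x powr r))" .
  qed
  also have "\<dots> = ennreal (\<theta> powr r * 2 powr r) * (B + ennreal (V powr r) * (\<integral>\<^sup>+x. ennreal (occupation S x powr r) \<partial>lborel))"
    unfolding B_def by (simp add: nn_integral_cmult nn_integral_add)
  also have "\<dots> \<le> ennreal (\<theta> powr r * 2 powr r) * (ennreal (S powr ((1 - a1) * r)) * B + ennreal (V powr r) * (ennreal (C powr \<beta> * (S powr (1 - a1) / (1 - a1)) powr r) * B))"
  proof (intro mult_left_mono add_mono)
    have "1 \<le> S powr ((1 - a1) * r)" using T a1 r by (intro ge_one_powr_ge_zero) auto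
    then have "1 \<le> ennreal (S powr ((1 - a1) * r))" by simp
    then show "B \<le> ennreal (S powr ((1 - a1) * r)) * B"
      using mult_right_mono[of 1 "ennreal (S powr ((1 - a1) * r))" B] by simp
    show "(\<integral>\<^sup>+x. ennreal (occupation S x powr r) \<partial>lborel) \<le> ennreal (C powr \<beta> * (S powr (1 - a1) / (1 - a1)) powr r) * B"
      unfolding r_def B_def using occupation_norm[OF C \<beta> a1] T by simp
  qed auto
  also have "(S powr (1 - a1) / (1 - a1)) powr r = S powr ((1 - a1) * r) * (1 / (1 - a1)) powr r"
    using a1 by (simp add: powr_mult[symmetric] powr_powr[symmetric])
  also have "ennreal (\<theta> powr r * 2 powr r) * (ennreal (S powr ((1 - a1) * r)) * B + ennreal (V powr r) * (ennreal (C powr \<beta> * (S powr ((1 - a1) * r) * (1 / (1 - a1)) powr r)) * B))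
     = ennreal (\<theta> powr r * (2 powr r * (1 + V powr r * C powr \<beta> * (1 / (1 - a1)) powr r)) * S powr ((1 - a1) * r)) * B"
  proof -
    have "ennreal (S powr ((1 - a1) * r)) * B + ennreal (V powr r) * (ennreal (C powr \<beta> * (S powr ((1 - a1) * r) * (1 / (1 - a1)) powr r)) * B)
      = ennreal (S powr ((1 - a1) * r) + V powr r * (C powr \<beta> * (S powr ((1 - a1) * r) * (1 / (1 - a1)) powr r))) * B"
      by (subst ennreal_plus) (auto simp: ennreal_mult distrib_right mult.assoc)
    also have "ennreal (\<theta> powr r * 2 powr r) * \<dots> = ennreal ((\<theta> powr r * 2 powr r) * (S powr ((1 - a1) * r) + V powr r * (C powr \<beta> * (S powr ((1 - a1) * r) * (1 / (1 - a1)) powr r)))) * B"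
      by (subst ennreal_mult) (auto simp: mult.assoc)
    finally show ?thesis by (simp add: algebra_simps)
  qed
  finally show ?thesis unfolding r_def B_def .
qed

text \<open>Reversing the roles of starting point and displacement: if the displacement at time \<open>s\<close> is
  at most \<open>R - 1\<close>, then every starting point from which it leads into the unit ball lies in the
  ball of radius \<open>R\<close>. This happens with probability at least 1/2.\<close>

lemma marks_ball_total:
  assumes \<theta>: "0 \<le> \<theta>" and V: "0 < V" and T: "0 < T" "T \<le> S"
    and tight: "\<And>s. 0 < s \<Longrightarrow> ennreal (1 / 2) \<le> emeasure (p s) {y. norm y \<le> c * s powr (1 / \<alpha>)}" "0 < c"
    and R: "1 + c * S powr (1 / \<alpha>) \<le> R"
  shows "ennreal (\<theta> * V * (S - T) / 2) * emeasure lborel (cball (0::'a) 1) \<le> (\<integral>\<^sup>+x. marks V \<theta> T S (0, x) * indicator (cball 0 R) x \<partial>lborel)"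
proof -
  define B where "B = emeasure lborel (cball (0::'a) 1)"
  have at: "ennreal (1 / 2) * B \<le> (\<integral>\<^sup>+x. visit s x * indicator (cball 0 R) x \<partial>lborel)" if s: "s \<in> {T..S}" for s
  proof -
    interpret ps: prob_space "p s" by (rule prob_kernel)
    interpret P: pair_sigma_finite lborel "p s" ..
    have s0: "0 < s" using s T by auto
    have "s powr (1 / \<alpha>) \<le> S powr (1 / \<alpha>)"
      using s s0 stability_index_pos by (intro powr_mono2) auto
    then have cs: "c * s powr (1 / \<alpha>) \<le> R - 1" using tight(2) R
      by (smt (verit) mult_left_mono)
    have "(\<integral>\<^sup>+x. visit s x * indicator (cball 0 R) x \<partial>lborel) =
      (\<integral>\<^sup>+x. \<integral>\<^sup>+y. indicator (cball 0 1) (x + y) * indicator (cball 0 R) x \<partial>p s \<partial>lborel)"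
      unfolding visit_def by (intro nn_integral_cong nn_integral_multc[symmetric]) measurable
    also have "\<dots> = (\<integral>\<^sup>+y. \<integral>\<^sup>+x. indicator (cball 0 1) (x + y) * indicator (cball 0 R) x \<partial>lborel \<partial>p s)"
      by (rule P.Fubini'[symmetric]) measurable
    also have "\<dots> \<ge> (\<integral>\<^sup>+y. B * indicator {y. norm y \<le> c * s powr (1 / \<alpha>)} y \<partial>p s)"
    proof (rule nn_integral_mono)
      fix y :: 'a
      show "B * indicator {y. norm y \<le> c * s powr (1 / \<alpha>)} y \<le> (\<integral>\<^sup>+x. indicator (cball 0 1) (x + y) * indicator (cball 0 R) x \<partial>lborel)"
      proof (cases "norm y \<le> c * s powr (1 / \<alpha>)")
        case True
        then have y: "norm y \<le> R - 1" using cs by simp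
        have "B = (\<integral>\<^sup>+x. indicator (cball (0::'a) 1) x \<partial>lborel)" by (simp add: B_def)
        also have "\<dots> = (\<integral>\<^sup>+x. indicator (cball 0 1) (x + y) \<partial>lborel)"
          using nn_integral_lborel_scale[of "indicator (cball (0::'a) 1)" 1 y] by (simp add: add.commute)
        also have "\<dots> = (\<integral>\<^sup>+x. indicator (cball 0 1) (x + y) * indicator (cball 0 R) x \<partial>lborel)"
        proof (rule nn_integral_cong)
          fix x
          have "norm x \<le> R" if "norm (x + y) \<le> 1"
            using that y norm_triangle_ineq4[of "x + y" y] by simp
          then show "indicator (cball 0 1) (x + y) = (indicator (cball 0 1) (x + y) * indicator (cball 0 R) x :: ennreal)"
            by (auto simp: indicator_def)
        qed
        finally show ?thesis using True by simp
      qed simp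
    qed
    also have "(\<integral>\<^sup>+y. B * indicator {y. norm y \<le> c * s powr (1 / \<alpha>)} y \<partial>p s) = B * emeasure (p s) {y. norm y \<le> c * s powr (1 / \<alpha>)}"
      by (subst nn_integral_cmult_indicator) auto
    finally have "B * emeasure (p s) {y. norm y \<le> c * s powr (1 / \<alpha>)} \<le> (\<integral>\<^sup>+x. visit s x * indicator (cball 0 R) x \<partial>lborel)" .
    moreover have "B * ennreal (1 / 2) \<le> B * emeasure (p s) {y. norm y \<le> c * s powr (1 / \<alpha>)}"
      by (rule mult_left_mono[OF tight(1)[OF s0]]) simp
    ultimately show ?thesis unfolding mult.commute[of _ B] by (rule order_trans[rotated])
  qed
  have [measurable]: "(\<lambda>x. visit (fst x) (snd x)) \<in> borel_measurable (borel \<Otimes>\<^sub>M borel)"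
    using measurable_visit by (simp add: split_beta')
  have "ennreal (\<theta> * V * (S - T) / 2) * B = ennreal \<theta> * (ennreal V * (\<integral>\<^sup>+s. ennreal (1/2) * B * indicator {T..S} s \<partial>lborel))"
  proof -
    have eq: "ennreal (\<theta> * (V * ((S - T) * h))) = ennreal \<theta> * (ennreal V * (ennreal (S - T) * ennreal h))" if "0 \<le> h" for h
      using \<theta> V T that by (simp add: ennreal_mult)
    have "(\<integral>\<^sup>+s. ennreal (1/2) * B * indicator {T..S} s \<partial>lborel) = ennreal (1/2) * B * ennreal (S - T)"
      using T by (subst nn_integral_cmult_indicator) auto
    moreover have "ennreal (\<theta> * V * (S - T) / 2) = ennreal \<theta> * (ennreal V * (ennreal (S - T) * ennreal (1/2)))"
      using eq[of "1/2"] by (simp only: times_divide_eq_right mult_1_right mult.assoc)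
    ultimately show ?thesis by (simp only: mult_ac)
  qed
  also have "\<dots> \<le> ennreal \<theta> * (ennreal V * (\<integral>\<^sup>+s. \<integral>\<^sup>+x. indicator {0..} s * indicator {T..S} s * visit s x * indicator (cball 0 R) x \<partial>lborel \<partial>lborel))"
  proof (intro mult_left_mono nn_integral_mono)
    fix s
    show "ennreal (1 / 2) * B * indicator {T..S} s \<le> (\<integral>\<^sup>+x. indicator {0..} s * indicator {T..S} s * visit s x * indicator (cball 0 R) x \<partial>lborel)"
      using at[of s] T by (auto simp: indicator_def)
  qed auto
  also have "\<dots> = ennreal \<theta> * (ennreal V * (\<integral>\<^sup>+x. \<integral>\<^sup>+s. indicator {0..} s * indicator {T..S} s * visit s x * indicator (cball 0 R) x \<partial>lborel \<partial>lborel))"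
    by (subst lborel_pair.Fubini') (simp_all add: split_beta')
  also have "\<dots> = (\<integral>\<^sup>+x. ennreal \<theta> * (ennreal V * (\<integral>\<^sup>+s. indicator {0..} s * indicator {T..S} s * visit s x \<partial>lborel)) * indicator (cball 0 R) x \<partial>lborel)"
  proof -
    have [measurable]: "(\<lambda>s. visit s x) \<in> borel_measurable borel" for x
      using measurable_compose[OF _ measurable_visit, of "\<lambda>s. (s, x)" borel] by simp
    have [measurable]: "(\<lambda>x. \<integral>\<^sup>+s. indicator {0..} s * indicator {T..S} s * visit s x \<partial>lborel) \<in> borel_measurable borel"
    proof -
      have "(\<lambda>(x, s). indicator {0..} s * indicator {T..S} s * visit s x) \<in> borel_measurable (borel \<Otimes>\<^sub>M lborel)"
        using measurable_compose[OF _ measurable_visit, of "\<lambda>(x, s). (s, x)" "borel \<Otimes>\<^sub>M lborel"]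
        by (simp add: split_beta')
      then show ?thesis by (intro lborel.borel_measurable_nn_integral) (simp add: split_beta')
    qed
    show ?thesis
      by (simp add: nn_integral_multc nn_integral_cmult mult.assoc[symmetric])
         (simp add: nn_integral_cmult mult.assoc)
  qed
  also have "\<dots> \<le> (\<integral>\<^sup>+x. marks V \<theta> T S (0, x) * indicator (cball 0 R) x \<partial>lborel)"
    unfolding marks_def green_window[OF \<theta>]
    by (intro nn_integral_mono mult_right_mono) auto
  finally show ?thesis unfolding B_def .
qed

end

section \<open>The mass of marked families\<close>

context stable_semigroup
begin

lemma measurable_marks [measurable]: "marks V \<theta> T S \<in> borel_measurable (borel \<Otimes>\<^sub>M borel)"
  unfolding marks_def[abs_def] by measurable

text \<open>Integrates \<open>mark_prob_comparison\<close> over the starting points in a ball; the generation \<open>g\<close> is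
  taken so large that the term for the later generations is below \<open>\<epsilon>\<close>.\<close>

lemma mark_prob_ball_total:
  assumes \<theta>: "0 < \<theta>" "\<theta> \<le> 1" and V: "0 < V" and \<beta>: "0 < \<beta>" "\<beta> \<le> 1" and S: "0 \<le> T" "T \<le> S" "1 \<le> S"
    and N: "\<And>t. 0 \<le> t \<Longrightarrow> (\<integral>\<^sup>+x. ennreal (enn2real (marks V \<theta> T S (t, x)) powr (1 + \<beta>)) \<partial>lborel) \<le> ennreal N" "0 \<le> N"
    and H: "ennreal H \<le> (\<integral>\<^sup>+x. marks V \<theta> T S (0, x) * indicator (cball 0 R) x \<partial>lborel)" "0 < \<epsilon>"
  obtains g where "ennreal H \<le>
    (\<integral>\<^sup>+x. ennreal (mark_prob V \<beta> (window \<theta> T S) g (0, x)) * indicator (cball 0 R) x \<partial>lborel) + ennreal ((1 + 2 * V) * S * N + \<epsilon>)"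
proof -
  define h where "h z = enn2real (marks V \<theta> T S z)" for z
  have [measurable]: "h \<in> borel_measurable (borel \<Otimes>\<^sub>M borel)" unfolding h_def by measurable
  have marks_h: "marks V \<theta> T S z = ennreal (h z)" for z
    using marks_bounds(1)[of \<theta> V T S z] \<theta> V S unfolding h_def
    by (intro ennreal_enn2real[symmetric]) (auto intro: le_less_trans)
  define \<psi> where "\<psi> z = ennreal (h z powr (1 + \<beta>))" for z
  have [measurable]: "\<psi> \<in> borel_measurable (borel \<Otimes>\<^sub>M borel)" unfolding \<psi>_def by measurable
  \<comment> \<open>No marks are left after \<open>S\<close>, so that the bounded function \<open>h\<close> lies below a multiple of
    \<open>exp (- t)\<close>.\<close>
  define D where "D = \<theta> * (1 + V * S) * exp S"
  have D0: "0 \<le> D" using \<theta> V S by (simp add: D_def)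
  have D: "h z \<le> D * exp (- fst z)" for z
  proof (cases "S < fst z")
    case True
    then have "h z = 0" using marks_bounds(2)[of \<theta> V T S z] \<theta> V S by (simp add: h_def)
    then show ?thesis using D0 by simp
  next
    case False
    have "h z \<le> \<theta> * (1 + V * S)"
      unfolding h_def using marks_bounds(1)[of \<theta> V T S z] \<theta> V S by (intro enn2real_leI) auto
    also have "\<dots> \<le> \<theta> * (1 + V * S) * exp (S - fst z)"
      using False \<theta> V S mult_left_mono[of 1 "exp (S - fst z)" "\<theta> * (1 + V * S)"] by simp
    also have "\<dots> = D * exp (- fst z)" by (simp add: D_def exp_diff exp_minus field_simps)
    finally show ?thesis .
  qed
  have a: "0 \<le> window \<theta> T S z" "window \<theta> T S z \<le> 1" for z :: "real \<times> 'a"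
    using \<theta> by (auto simp: window_def indicator_def)
  have comparison: "ennreal (h z) \<le> ennreal (mark_prob V \<beta> (window \<theta> T S) g z) +
      (\<psi> z + ennreal (1 + 1 / (1 + \<beta>)) * green V \<psi> z) + ennreal ((V / (V + 1)) ^ g) * ennreal (D * exp (- fst z))" for z g
    unfolding \<psi>_def
    by (rule mark_prob_comparison(2)[OF V \<beta> measurable_window a _ _ _ D0 D])
       (use \<open>h \<in> _\<close> in \<open>simp_all add: marks_h[symmetric] marks_def[symmetric]\<close>, simp add: h_def)
  have \<psi>_total: "(\<integral>\<^sup>+x. \<psi> (t, x) \<partial>lborel) \<le> ennreal N * indicator {..S} t" if "0 \<le> t" for t
  proof (cases "t \<le> S")
    case True
    then show ?thesis using N(1)[OF that] by (simp add: \<psi>_def h_def)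
  next
    case False
    then have "\<psi> (t, x) = 0" for x
      using marks_bounds(2)[of \<theta> V T S "(t, x)"] \<theta> V S by (simp add: \<psi>_def h_def)
    then show ?thesis by simp
  qed
  have green_\<psi>: "(\<integral>\<^sup>+x. green V \<psi> (0, x) \<partial>lborel) \<le> ennreal (V * S * N)"
  proof -
    have "(\<integral>\<^sup>+x. green V \<psi> (0, x) \<partial>lborel) \<le> (\<integral>\<^sup>+s. ennreal (V * N) * indicator {0..S} s \<partial>lborel)"
      unfolding green_total[OF \<open>\<psi> \<in> _\<close>]
    proof (rule nn_integral_mono)
      fix s :: real
      have "ennreal V * (\<integral>\<^sup>+x. \<psi> (s, x) \<partial>lborel) \<le> ennreal V * (ennreal N * indicator {..S} s)" if "0 \<le> s"
        by (intro mult_left_mono \<psi>_total that) simp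
      then show "ennreal V * indicator {0..} s * (\<integral>\<^sup>+x. \<psi> (0 + s, x) \<partial>lborel) \<le> ennreal (V * N) * indicator {0..S} s"
        using V N(2) by (auto simp: indicator_def ennreal_mult split: if_splits)
    qed
    also have "\<dots> = ennreal (V * N * S)"
      using V N(2) S by (subst nn_integral_cmult_indicator) (auto simp: ennreal_mult)
    finally show ?thesis by (simp add: mult_ac)
  qed
  have error: "(\<integral>\<^sup>+x. \<psi> (0, x) + ennreal (1 + 1 / (1 + \<beta>)) * green V \<psi> (0, x) \<partial>lborel) \<le> ennreal ((1 + 2 * V) * S * N)"
  proof -
    have "(\<integral>\<^sup>+x. \<psi> (0, x) + ennreal (1 + 1 / (1 + \<beta>)) * green V \<psi> (0, x) \<partial>lborel) =
      (\<integral>\<^sup>+x. \<psi> (0, x) \<partial>lborel) + ennreal (1 + 1 / (1 + \<beta>)) * (\<integral>\<^sup>+x. green V \<psi> (0, x) \<partial>lborel)"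
      by (subst nn_integral_add) (simp_all add: nn_integral_cmult)
    also have "\<dots> \<le> ennreal N + ennreal 2 * ennreal (V * S * N)"
      using \<psi>_total[of 0] green_\<psi> S \<beta> by (intro add_mono mult_mono ennreal_leI) auto
    also have "\<dots> = ennreal (N + 2 * (V * S * N))"
      using V S N(2) by (simp add: ennreal_mult[symmetric] ennreal_plus[symmetric] del: ennreal_plus ennreal_numeral)
    also have "\<dots> \<le> ennreal ((1 + 2 * V) * S * N)"
      using mult_right_mono[of 1 S N] S N(2) by (intro ennreal_leI) (simp add: algebra_simps)
    finally show ?thesis .
  qed
  obtain L where L: "emeasure lborel (cball (0::'a) R) = ennreal L" "0 \<le> L"
    using emeasure_lborel_cball_finite[of "0::'a" R] by (cases "emeasure lborel (cball (0::'a) R)") auto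
  have "(\<lambda>g. (V / (V + 1)) ^ g * (D * L)) \<longlonglongrightarrow> 0 * (D * L)"
    using V by (intro tendsto_intros LIMSEQ_power_zero) auto
  then have "eventually (\<lambda>g. (V / (V + 1)) ^ g * (D * L) < \<epsilon>) sequentially"
    using H(2) by (intro order_tendstoD) auto
  then obtain g where g: "(V / (V + 1)) ^ g * (D * L) < \<epsilon>" by (auto simp: eventually_sequentially)
  let ?v = "\<lambda>x. ennreal (mark_prob V \<beta> (window \<theta> T S) g (0, x))"
  let ?e = "\<lambda>x. \<psi> (0, x) + ennreal (1 + 1 / (1 + \<beta>)) * green V \<psi> (0, x)"
  let ?d = "ennreal ((V / (V + 1)) ^ g * D)"
  have "ennreal H \<le> (\<integral>\<^sup>+x. (?v x * indicator (cball 0 R) x + ?e x) + ?d * indicator (cball 0 R) x \<partial>lborel)"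
    unfolding marks_h
  proof (rule order_trans[OF H(1)[unfolded marks_h] nn_integral_mono])
    fix x :: 'a
    have "ennreal (h (0, x)) \<le> ?v x + ?e x + ?d"
      using comparison[of "(0, x)" g] V D0 by (simp add: ennreal_mult)
    then show "ennreal (h (0, x)) * indicator (cball 0 R) x \<le> (?v x * indicator (cball 0 R) x + ?e x) + ?d * indicator (cball 0 R) x"
      by (auto simp: indicator_def)
  qed
  also have "\<dots> = (\<integral>\<^sup>+x. ?v x * indicator (cball 0 R) x \<partial>lborel) + (\<integral>\<^sup>+x. ?e x \<partial>lborel) + ?d * ennreal L"
    by (simp add: nn_integral_add nn_integral_cmult_indicator L)
  also have "\<dots> \<le> (\<integral>\<^sup>+x. ?v x * indicator (cball 0 R) x \<partial>lborel) + ennreal ((1 + 2 * V) * S * N) + ennreal \<epsilon>"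
    using g V D0 L(2) by (intro add_mono order_refl error) (simp add: ennreal_mult[symmetric] ennreal_leI mult.assoc)
  also have "\<dots> = (\<integral>\<^sup>+x. ?v x * indicator (cball 0 R) x \<partial>lborel) + ennreal ((1 + 2 * V) * S * N + \<epsilon>)"
    using V S N(2) H(2) by (simp add: add.assoc ennreal_plus[symmetric] del: ennreal_plus)
  finally show ?thesis by (rule that)
qed

lemma initial_intensity_ball_bound:
  assumes "0 \<le> \<gamma>" "1 \<le> R" and [measurable]: "f \<in> borel_measurable borel"
  shows "ennreal (R powr (- \<gamma>) / 2) * (\<integral>\<^sup>+x. f x * indicator (cball 0 R) x \<partial>lborel)
    \<le> (\<integral>\<^sup>+(x::'a). f x * indicator (cball 0 R) x \<partial>initial_intensity \<gamma>)"
proof -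
  have "ennreal (R powr (- \<gamma>) / 2) * (\<integral>\<^sup>+(x::'a). f x * indicator (cball 0 R) x \<partial>lborel) =
     (\<integral>\<^sup>+(x::'a). ennreal (R powr (- \<gamma>) / 2) * (f x * indicator (cball 0 R) x) \<partial>lborel)"
    by (rule nn_integral_cmult[symmetric]) measurable
  also have "\<dots> \<le> (\<integral>\<^sup>+(x::'a). ennreal (1 / (1 + norm x powr \<gamma>)) * (f x * indicator (cball 0 R) x) \<partial>lborel)"
  proof (rule nn_integral_mono)
    fix x :: 'a
    have "R powr (- \<gamma>) / 2 \<le> 1 / (1 + norm x powr \<gamma>)" if "norm x \<le> R"
    proof -
      have "norm x powr \<gamma> \<le> R powr \<gamma>" using that assms by (intro powr_mono2) auto
      moreover have "1 \<le> R powr \<gamma>" using assms by (intro ge_one_powr_ge_zero)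
      ultimately have "1 + norm x powr \<gamma> \<le> 2 * R powr \<gamma>" by linarith
      then have "1 / (2 * R powr \<gamma>) \<le> 1 / (1 + norm x powr \<gamma>)"
        using assms by (intro divide_left_mono mult_pos_pos) (auto intro: add_pos_nonneg)
      then show ?thesis by (simp add: powr_minus field_simps)
    qed
    then show "ennreal (R powr (- \<gamma>) / 2) * (f x * indicator (cball 0 R) x) \<le> ennreal (1 / (1 + norm x powr \<gamma>)) * (f x * indicator (cball 0 R) x)"
      by (auto simp: indicator_def intro!: mult_right_mono ennreal_leI)
  qed
  also have "\<dots> = (\<integral>\<^sup>+(x::'a). f x * indicator (cball 0 R) x \<partial>initial_intensity \<gamma>)"
    unfolding initial_intensity_def by (subst nn_integral_density) auto
  finally show ?thesis .
qed

text \<open>The choice of the marking probability. With \<open>\<delta> = 1 - \<gamma> / \<alpha>\<close> and \<open>S = 2 T\<close>, the mean number of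
  marks, integrated over starting points in a ball of radius of order \<open>S powr (1 / \<alpha>)\<close>, is at least \<open>\<theta> * V * S * Q / 4\<close>, where \<open>Q\<close>
  is the volume of the unit ball, and \<open>\<theta> = \<kappa> * S powr (- \<delta>)\<close> is the largest order for which the
  nonlinear error stays a small fraction of it. The intensity contributes
  \<open>S powr (- \<gamma> / \<alpha>)\<close>, and \<open>- \<delta> + 1 - \<gamma> / \<alpha> = 0\<close>.\<close>

lemma marked_mass_bounded_below:
  assumes V: "0 < V" and \<beta>: "0 < \<beta>" "\<beta> \<le> 1" and \<gamma>: "0 \<le> \<gamma>" "\<gamma> < \<alpha>"
    and dim: "\<alpha> / \<beta> + \<gamma> \<le> real DIM('a)"
  obtains m where "0 < m" and
    "\<And>T. 1 \<le> T \<Longrightarrow> \<exists>\<theta> R g. 0 < \<theta> \<and> \<theta> \<le> 1 \<and>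
      ennreal m \<le> (\<integral>\<^sup>+x. ennreal (mark_prob V \<beta> (window \<theta> T (2 * T)) g (0, x)) * indicator (cball 0 R) x \<partial>initial_intensity \<gamma>)"
proof -
  note \<alpha> = stability_index_pos
  define a0 where "a0 = 1 / \<beta> + \<gamma> / \<alpha>"
  define a1 where "a1 = a0 * \<beta> / (1 + \<beta>)"
  define \<delta> where "\<delta> = 1 - \<gamma> / \<alpha>"
  have a0: "0 \<le> a0" "a0 \<le> real DIM('a) / \<alpha>"
    using \<alpha> \<beta> \<gamma> dim divide_right_mono[OF dim, of \<alpha>] by (auto simp: a0_def add_divide_distrib)
  have a0\<beta>: "a0 * \<beta> = 1 + \<beta> * (\<gamma> / \<alpha>)" using \<beta> by (simp add: a0_def distrib_right)
  have a1: "a1 * (1 + \<beta>) = a0 * \<beta>" using \<beta> by (simp add: a1_def)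
  \<comment> \<open>Integrability at 0 of the weight \<open>s powr (- a1)\<close> is the assumption \<open>\<gamma> < \<alpha>\<close>.\<close>
  have "\<beta> * (\<gamma> / \<alpha>) < \<beta> * 1" using \<alpha> \<beta> \<gamma> by (intro mult_strict_left_mono) auto
  then have a1_less: "a1 < 1" using \<beta> by (simp add: a1_def a0\<beta>)
  have exponent: "(1 - a1) * (1 + \<beta>) = \<delta> * \<beta>"
    using a1 a0\<beta> by (simp add: \<delta>_def algebra_simps)
  obtain C where C: "visit_density_bound C a0" using visit_density_bound_exists[OF a0] .
  obtain c where c: "0 < c" "\<And>s. 0 < s \<Longrightarrow> ennreal (1 / 2) \<le> emeasure (p s) {y. norm y \<le> c * s powr (1 / \<alpha>)}"
    using kernel_tight by blast
  obtain Q where Q: "0 < Q" "emeasure lborel (cball (0::'a) 1) = ennreal Q" using emeasure_unit_ball by blast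
  define K where "K = 2 powr (1 + \<beta>) * (1 + V powr (1 + \<beta>) * C powr \<beta> * (1 / (1 - a1)) powr (1 + \<beta>)) * Q"
  have K: "0 < K" unfolding K_def using Q V a1_less by (intro mult_pos_pos) (auto intro: add_pos_nonneg)
  \<comment> \<open>Chosen such that the nonlinear error is at most \<open>\<theta> * V * S * Q / 16\<close>.\<close>
  define \<kappa> where "\<kappa> = min 1 ((V * Q / (16 * (1 + 2 * V) * K)) powr (1 / \<beta>))"
  have \<kappa>: "0 < \<kappa>" "\<kappa> \<le> 1" unfolding \<kappa>_def using V Q K by auto
  have \<kappa>\<beta>: "\<kappa> powr \<beta> \<le> V * Q / (16 * (1 + 2 * V) * K)"
  proof -
    have "\<kappa> powr \<beta> \<le> ((V * Q / (16 * (1 + 2 * V) * K)) powr (1 / \<beta>)) powr \<beta>"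
      using \<kappa> \<beta> by (intro powr_mono2) (auto simp: \<kappa>_def)
    also have "\<dots> = V * Q / (16 * (1 + 2 * V) * K)"
      using V Q K \<beta> by (simp add: powr_powr)
    finally show ?thesis .
  qed
  define m where "m = (1 + c) powr (- \<gamma>) / 2 * (\<kappa> * V * Q / 8)"
  show ?thesis
  proof
    show "0 < m" unfolding m_def using c V Q \<kappa> by simp
    fix T :: real assume T: "1 \<le> T"
    define S where "S = 2 * T"
    have S: "1 \<le> S" "0 < S" "T \<le> S" "0 \<le> T" "S - T = S / 2" using T by (auto simp: S_def)
    define \<theta> where "\<theta> = \<kappa> * S powr (- \<delta>)"
    have "0 \<le> \<delta>" using \<alpha> \<gamma> by (simp add: \<delta>_def)
    then have "S powr (- \<delta>) \<le> 1" using powr_mono[of "- \<delta>" 0 S] S by simp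
    then have \<theta>: "0 < \<theta>" "\<theta> \<le> 1"
      using \<kappa> S mult_mono[of \<kappa> 1 "S powr (- \<delta>)" 1] by (auto simp: \<theta>_def)
    define N where "N = \<theta> * \<kappa> powr \<beta> * K"
    have N0: "0 \<le> N" using \<theta> K by (simp add: N_def)
    have N: "(\<integral>\<^sup>+x. ennreal (enn2real (marks V \<theta> T S (t, x)) powr (1 + \<beta>)) \<partial>lborel) \<le> ennreal N" if "0 \<le> t" for t
    proof -
      have "\<theta> powr (1 + \<beta>) * S powr (\<delta> * \<beta>) = \<theta> * \<kappa> powr \<beta>"
      proof -
        have "\<theta> powr (1 + \<beta>) = \<theta> * \<theta> powr \<beta>" using \<theta> by (simp add: powr_add)
        also have "\<theta> powr \<beta> = \<kappa> powr \<beta> * S powr (- (\<delta> * \<beta>))"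
          using \<kappa> S by (simp add: \<theta>_def powr_mult powr_powr)
        finally show ?thesis using S by (simp add: mult.assoc flip: powr_add)
      qed
      moreover have "u * z * y * q = (u * y) * (z * q)" for u y z q :: real by simp
      ultimately have "\<theta> powr (1 + \<beta>) * (2 powr (1 + \<beta>) * (1 + V powr (1 + \<beta>) * C powr \<beta> * (1 / (1 - a1)) powr (1 + \<beta>))) *
          S powr ((1 - a1) * (1 + \<beta>)) * Q = N"
        unfolding N_def K_def exponent by metis
      then show ?thesis
        using marks_power_total[OF less_imp_le[OF \<theta>(1)] V S(4,3,1) that C \<beta>(1) a1 a1_less] Q
        by (simp add: ennreal_mult''[symmetric])
    qed
    define R where "R = (1 + c) * S powr (1 / \<alpha>)"
    have "1 \<le> S powr (1 / \<alpha>)" using S \<alpha> by (intro ge_one_powr_ge_zero) auto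
    then have R: "1 + c * S powr (1 / \<alpha>) \<le> R" "1 \<le> R"
      using c mult_mono[of 1 "1 + c" 1 "S powr (1 / \<alpha>)"] by (auto simp: R_def distrib_right)
    define H where "H = \<theta> * V * (S - T) / 2 * Q"
    have H: "ennreal H \<le> (\<integral>\<^sup>+x. marks V \<theta> T S (0, x) * indicator (cball 0 R) x \<partial>lborel)"
      using marks_ball_total[OF less_imp_le[OF \<theta>(1)] V _ S(3) c(2,1) R(1)] Q T
      by (simp add: H_def ennreal_mult''[symmetric])
    define \<epsilon> where "\<epsilon> = \<theta> * V * S * Q / 16"
    have \<epsilon>: "0 < \<epsilon>" using \<theta> V S Q by (simp add: \<epsilon>_def)
    obtain g where g: "ennreal H \<le>
        (\<integral>\<^sup>+x. ennreal (mark_prob V \<beta> (window \<theta> T S) g (0, x)) * indicator (cball 0 R) x \<partial>lborel) + ennreal ((1 + 2 * V) * S * N + \<epsilon>)"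
      using mark_prob_ball_total[OF \<theta> V \<beta> S(4,3,1) N N0 H \<epsilon>] by blast
    have err: "(1 + 2 * V) * S * N \<le> \<theta> * V * S * Q / 16"
    proof -
      have "(1 + 2 * V) * S * N = (1 + 2 * V) * S * \<theta> * K * \<kappa> powr \<beta>" by (simp add: N_def mult_ac)
      also have "\<dots> \<le> (1 + 2 * V) * S * \<theta> * K * (V * Q / (16 * (1 + 2 * V) * K))"
        using \<kappa>\<beta> V S \<theta> K by (intro mult_left_mono) auto
      also have "\<dots> = \<theta> * V * S * Q / 16"
      proof -
        have "u * S * \<theta> * K * (V * Q / (16 * u * K)) = \<theta> * V * S * Q / 16" if "u \<noteq> 0" for u
          using K that by (simp add: field_simps)
        from this[of "1 + 2 * V"] V show ?thesis by linarith
      qed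
      finally show ?thesis .
    qed
    let ?X = "\<integral>\<^sup>+x. ennreal (mark_prob V \<beta> (window \<theta> T S) g (0, x)) * indicator (cball 0 R) x \<partial>lborel"
    have "(1 + 2 * V) * S * N + \<epsilon> \<le> \<theta> * V * S * Q / 8"
      using err unfolding \<epsilon>_def by linarith
    then have "?X + ennreal ((1 + 2 * V) * S * N + \<epsilon>) \<le> ?X + ennreal (\<theta> * V * S * Q / 8)"
      by (intro add_left_mono ennreal_leI)
    with g have g': "ennreal H \<le> ?X + ennreal (\<theta> * V * S * Q / 8)" by (rule order_trans)
    have half: "ennreal H = ennreal (\<theta> * V * S * Q / 8) + ennreal (\<theta> * V * S * Q / 8)"
      using \<theta> V S Q by (subst ennreal_plus[symmetric]) (auto simp: H_def S(5))
    have "ennreal (\<theta> * V * S * Q / 8) + ennreal (\<theta> * V * S * Q / 8) \<le> ennreal (\<theta> * V * S * Q / 8) + ?X"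
      using g' unfolding half add.commute[of ?X] .
    then have low: "ennreal (\<theta> * V * S * Q / 8) \<le> ?X"
      by (subst (asm) ennreal_add_left_cancel_le) simp
    have "ennreal m = ennreal (R powr (- \<gamma>) / 2) * ennreal (\<theta> * V * S * Q / 8)"
    proof -
      have "S powr (- (\<gamma> / \<alpha>)) * (S powr (- \<delta>) * S) = S powr (- (\<gamma> / \<alpha>) + (- \<delta> + 1))"
        using S by (simp only: powr_add powr_one)
      also have "\<dots> = 1" using S by (simp add: \<delta>_def)
      finally have cancel: "S powr (- (\<gamma> / \<alpha>)) * (S powr (- \<delta>) * S) = 1" .
      have "R powr (- \<gamma>) = (1 + c) powr (- \<gamma>) * S powr (- (\<gamma> / \<alpha>))"
        using c S by (simp add: R_def powr_mult powr_powr)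
      then have "R powr (- \<gamma>) / 2 * (\<theta> * V * S * Q / 8) = m * (S powr (- (\<gamma> / \<alpha>)) * (S powr (- \<delta>) * S))"
        by (simp add: m_def \<theta>_def)
      then have "m = R powr (- \<gamma>) / 2 * (\<theta> * V * S * Q / 8)" by (simp add: cancel)
      moreover have "ennreal (R powr (- \<gamma>) / 2 * (\<theta> * V * S * Q / 8)) = ennreal (R powr (- \<gamma>) / 2) * ennreal (\<theta> * V * S * Q / 8)"
        using \<theta> V S Q by (intro ennreal_mult) auto
      ultimately show ?thesis by metis
    qed
    also have "\<dots> \<le> ennreal (R powr (- \<gamma>) / 2) * (\<integral>\<^sup>+x. ennreal (mark_prob V \<beta> (window \<theta> T S) g (0, x)) * indicator (cball 0 R) x \<partial>lborel)"
      using low by (rule mult_left_mono) simp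
    also have "\<dots> \<le> (\<integral>\<^sup>+x. ennreal (mark_prob V \<beta> (window \<theta> T S) g (0, x)) * indicator (cball 0 R) x \<partial>initial_intensity \<gamma>)"
      using \<gamma> R(2) by (intro initial_intensity_ball_bound) measurable
    finally show "\<exists>\<theta> R g. 0 < \<theta> \<and> \<theta> \<le> 1 \<and>
      ennreal m \<le> (\<integral>\<^sup>+x. ennreal (mark_prob V \<beta> (window \<theta> T (2 * T)) g (0, x)) * indicator (cball 0 R) x \<partial>initial_intensity \<gamma>)"
      using \<theta> unfolding S_def by blast
  qed
qed

end

section \<open>Cadlag paths and lines of descent\<close>

instance label :: countable
  by countable_datatype

text \<open>The limit of \<open>w\<close> along rational times that tend to \<open>l\<close> from the right. For \<open>l \<ge> 0\<close> it agrees
  with \<open>w l\<close> on cadlag paths and, unlike evaluation of a path at a random time, is measurable in \<open>l\<close> and \<open>w\<close> jointly with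
  respect to the product of the Borel sets.\<close>

definition right_limit :: "real \<Rightarrow> (real \<Rightarrow> 'a::euclidean_space) \<Rightarrow> 'a" where
  "right_limit l w = lim (\<lambda>k. w ((real (nat \<lfloor>real (Suc k) * l\<rfloor>) + 1) / real (Suc k)))"

lemma measurable_right_limit [measurable]:
  "(\<lambda>(l, w). right_limit l w) \<in> borel \<Otimes>\<^sub>M (\<Pi>\<^sub>M t\<in>{0..}. borel) \<rightarrow>\<^sub>M borel"
proof -
  have "(\<lambda>q. snd q ((real (nat \<lfloor>real (Suc k) * fst q\<rfloor>) + 1) / real (Suc k)))
      \<in> borel \<Otimes>\<^sub>M (\<Pi>\<^sub>M t\<in>{0..}. borel) \<rightarrow>\<^sub>M (borel :: 'a measure)" for k
  proof (rule measurable_compose_countable[where f="\<lambda>i q. snd q ((real i + 1) / real (Suc k))"])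
    fix i :: nat
    show "(\<lambda>q. snd q ((real i + 1) / real (Suc k))) \<in> borel \<Otimes>\<^sub>M (\<Pi>\<^sub>M t\<in>{0..}. borel) \<rightarrow>\<^sub>M (borel :: 'a measure)"
      by (rule measurable_compose[OF measurable_snd measurable_component_singleton]) simp
  qed measurable
  then show ?thesis
    unfolding right_limit_def split_beta' by (intro borel_measurable_lim_metric)
qed

lemma right_limit_cadlag:
  assumes "cadlag w" "0 \<le> l"
  shows "right_limit l w = w l"
proof -
  define r where "r k = (real (nat \<lfloor>real (Suc k) * l\<rfloor>) + 1) / real (Suc k)" for k
  have r: "l < r k" "r k \<le> l + 1 / real (Suc k)" for k
  proof -
    have "0 \<le> real (Suc k) * l" using assms by simp
    then have nf: "real (nat \<lfloor>real (Suc k) * l\<rfloor>) = of_int \<lfloor>real (Suc k) * l\<rfloor>" by simp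
    have "real (Suc k) * l < of_int \<lfloor>real (Suc k) * l\<rfloor> + 1" by linarith
    then show "l < r k" unfolding r_def nf by (simp add: field_simps del: of_nat_Suc)
    have "of_int \<lfloor>real (Suc k) * l\<rfloor> + 1 \<le> real (Suc k) * l + 1" by linarith
    then have "r k \<le> (real (Suc k) * l + 1) / real (Suc k)"
      unfolding r_def nf by (rule divide_right_mono) simp
    then show "r k \<le> l + 1 / real (Suc k)" by (simp add: add_divide_distrib del: of_nat_Suc)
  qed
  have "r \<longlonglongrightarrow> l"
  proof (rule tendsto_sandwich[of "\<lambda>_. l" r sequentially "\<lambda>k. l + inverse (real (Suc k))"])
    have "(\<lambda>k. l + inverse (real (Suc k))) \<longlonglongrightarrow> l + 0"
      by (intro tendsto_intros LIMSEQ_inverse_real_of_nat)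
    then show "(\<lambda>k. l + inverse (real (Suc k))) \<longlonglongrightarrow> l" by simp
  qed (use r in \<open>auto simp: less_imp_le inverse_eq_divide simp del: of_nat_Suc\<close>)
  then have "filterlim r (at_right l) sequentially"
    using r(1) by (auto simp: filterlim_at intro!: always_eventually dest: less_imp_neq)
  moreover have "(w \<longlongrightarrow> w l) (at_right l)" using assms by (auto simp: cadlag_def)
  ultimately have "(\<lambda>k. w (r k)) \<longlonglongrightarrow> w l" by (rule filterlim_compose[rotated])
  then show ?thesis unfolding right_limit_def r_def by (rule limI)
qed

fun descends :: "label \<Rightarrow> label \<Rightarrow> bool" where
  "descends u (Root i) \<longleftrightarrow> u = Root i"
| "descends u (Child w k) \<longleftrightarrow> u = Child w k \<or> descends u w"

lemma descends_refl [simp]: "descends u u"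
  by (cases u) auto

lemma descends_size: "descends u w \<Longrightarrow> size u \<le> size w"
  by (induction w) auto

lemma descends_Child: "descends (Child u k) w \<Longrightarrow> descends u w"
  by (induction w) auto

lemma not_descends_Child [simp]: "\<not> descends (Child u k) u"
  using descends_size[of "Child u k" u] by auto

lemma descends_sibling: "descends (Child u j) w \<Longrightarrow> descends (Child u k) w \<Longrightarrow> j = k"
  by (induction w) auto

lemma descends_Root: "descends (Root i) w \<Longrightarrow> descends (Root j) w \<Longrightarrow> i = j"
  by (induction w) auto

definition sources_of :: "label set \<Rightarrow> source set" where
  "sources_of U = Motion ` U \<union> Lifetime ` U \<union> Offspring ` U"

lemma sources_of_mono: "U \<subseteq> W \<Longrightarrow> sources_of U \<subseteq> sources_of W"
  by (auto simp: sources_of_def)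

lemma sources_of_disjoint: "U \<inter> W = {} \<Longrightarrow> sources_of U \<inter> sources_of W = {}"
  by (auto simp: sources_of_def)

section \<open>Decoupling the sources of randomness\<close>

context branching_particle_system
begin

abbreviation source_event :: "source \<Rightarrow> 'w set set" where
  "source_event \<equiv> source_events M n x motion lifetime offspring"

text \<open>The information contained in a set of sources, as a measurable space on the sample space.\<close>

definition info :: "source set \<Rightarrow> 'w measure" where
  "info I = sigma (space M) (\<Union>i\<in>I. source_event i)"

lemma source_event_events: "source_event i \<subseteq> events"
  using independence by (auto simp: indep_sets_def)

lemma Int_stable_source_event: "Int_stable (source_event i)"
  by (cases i) (auto simp: sets.Int_stable)

lemma space_info [simp]: "space (info I) = space M"
  by (simp add: info_def space_measure_of_conv)

lemma sets_info: "sets (info I) = sigma_sets (space M) (\<Union>i\<in>I. source_event i)"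
proof -
  have "(\<Union>i\<in>I. source_event i) \<subseteq> Pow (space M)"
    using source_event_events sets.space_closed by blast
  then show ?thesis unfolding info_def by (rule sets_measure_of)
qed

lemma sets_info_events: "sets (info I) \<subseteq> events"
  unfolding sets_info using source_event_events by (intro sets.sigma_sets_subset) auto

lemma measurable_info_id [measurable]: "(\<lambda>\<omega>. \<omega>) \<in> M \<rightarrow>\<^sub>M info I"
  using sets_info_events by (intro measurableI) auto

lemma measurable_info_mono:
  assumes "I \<subseteq> J"
  shows "(\<lambda>\<omega>. \<omega>) \<in> info J \<rightarrow>\<^sub>M info I"
proof (rule measurableI)
  fix A assume A: "A \<in> sets (info I)"
  have "sets (info I) \<subseteq> sets (info J)"
    unfolding sets_info using assms by (intro sigma_sets_mono') auto
  moreover have "A \<subseteq> space M" using sets.sets_into_space[OF A] by simp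
  ultimately show "(\<lambda>\<omega>. \<omega>) -` A \<inter> space (info J) \<in> sets (info J)"
    using A by (auto simp: Int_absorb2)
qed simp

lemma measurable_info_weaken: "f \<in> info I \<rightarrow>\<^sub>M N \<Longrightarrow> I \<subseteq> J \<Longrightarrow> f \<in> info J \<rightarrow>\<^sub>M N"
  using measurable_compose[OF measurable_info_mono] .

lemma measurable_from_info:
  assumes "f \<in> info I \<rightarrow>\<^sub>M N"
  shows "f \<in> M \<rightarrow>\<^sub>M N"
  using measurable_compose[OF measurable_info_id assms] .

text \<open>Fubini's theorem for independent information: a function of two disjoint groups of sources has
  the same expectation when the two groups are read from independent copies of the sample space.
  Every use of independence between motions, lifetimes, offspring numbers and the initial
  configuration goes through this lemma.\<close>

lemma decouple:
  assumes disj: "I \<inter> J = {}" and f: "(\<lambda>(\<omega>, \<omega>'). f \<omega> \<omega>') \<in> borel_measurable (info I \<Otimes>\<^sub>M info J)"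
  shows "(\<integral>\<^sup>+\<omega>. f \<omega> \<omega> \<partial>M) = (\<integral>\<^sup>+\<omega>. \<integral>\<^sup>+\<omega>'. f \<omega> \<omega>' \<partial>M \<partial>M)"
proof -
  let ?K = "\<lambda>b::bool. if b then I else J"
  have "indep_sets (\<lambda>b. sigma_sets (space M) (\<Union>i\<in>?K b. source_event i)) UNIV"
    by (rule indep_sets_collect_sigma)
       (use disj in \<open>auto intro!: indep_sets_mono_index[OF _ independence] Int_stable_source_event simp: disjoint_family_on_def\<close>)
  then have indep: "prob (A \<inter> B) = prob A * prob B" if "A \<in> sets (info I)" "B \<in> sets (info J)" for A B
    using indep_setsD[of "\<lambda>b. sigma_sets (space M) (\<Union>i\<in>?K b. source_event i)" UNIV UNIV "\<lambda>b. if b then A else B"] that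
    by (simp add: UNIV_bool sets_info Int_commute mult.commute)
  define MI where "MI = distr M (info I) (\<lambda>\<omega>. \<omega>)"
  define MJ where "MJ = distr M (info J) (\<lambda>\<omega>. \<omega>)"
  interpret MI: prob_space MI unfolding MI_def by (rule prob_space_distr) measurable
  interpret MJ: prob_space MJ unfolding MJ_def by (rule prob_space_distr) measurable
  interpret P: pair_prob_space MI MJ ..
  have [measurable_cong]: "sets MI = sets (info I)" "sets MJ = sets (info J)" by (simp_all add: MI_def MJ_def)
  have "MI \<Otimes>\<^sub>M MJ = distr M (info I \<Otimes>\<^sub>M info J) (\<lambda>\<omega>. (\<omega>, \<omega>))"
  proof (rule pair_measure_eqI)
    show "sigma_finite_measure MI" "sigma_finite_measure MJ" ..
    show "sets (MI \<Otimes>\<^sub>M MJ) = sets (distr M (info I \<Otimes>\<^sub>M info J) (\<lambda>\<omega>. (\<omega>, \<omega>)))"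
      by (simp cong: sets_pair_measure_cong add: MI_def MJ_def)
    fix A B assume "A \<in> sets MI" "B \<in> sets MJ"
    then have AB: "A \<in> sets (info I)" "B \<in> sets (info J)" by (simp_all add: MI_def MJ_def)
    then have sub: "A \<subseteq> space M" "B \<subseteq> space M" using sets.sets_into_space by fastforce+
    have ev: "A \<in> events" "B \<in> events" using AB sets_info_events by auto
    have "emeasure MI A * emeasure MJ B = emeasure M A * emeasure M B"
      using AB sub by (simp add: MI_def MJ_def emeasure_distr Int_absorb2)
    also have "\<dots> = emeasure M (A \<inter> B)"
      using indep[OF AB] by (simp add: emeasure_eq_measure ennreal_mult)
    also have "\<dots> = emeasure (distr M (info I \<Otimes>\<^sub>M info J) (\<lambda>\<omega>. (\<omega>, \<omega>))) (A \<times> B)"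
      using AB sub by (subst emeasure_distr) (auto intro!: arg_cong[where f="emeasure M"])
    finally show "emeasure MI A * emeasure MJ B = emeasure (distr M (info I \<Otimes>\<^sub>M info J) (\<lambda>\<omega>. (\<omega>, \<omega>))) (A \<times> B)" .
  qed
  then have "(\<integral>\<^sup>+\<omega>. f \<omega> \<omega> \<partial>M) = (\<integral>\<^sup>+q. f (fst q) (snd q) \<partial>(MI \<Otimes>\<^sub>M MJ))"
    using f by (simp add: nn_integral_distr split_beta')
  also have "\<dots> = (\<integral>\<^sup>+\<omega>. \<integral>\<^sup>+\<omega>'. f \<omega> \<omega>' \<partial>MJ \<partial>MI)"
    using f by (subst MJ.nn_integral_fst[symmetric]) (simp_all add: split_beta' cong: measurable_cong_sets sets_pair_measure_cong)
  also have "\<dots> = (\<integral>\<^sup>+\<omega>. \<integral>\<^sup>+\<omega>'. f \<omega> \<omega>' \<partial>M \<partial>M)"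
  proof -
    have inner: "(\<integral>\<^sup>+\<omega>'. f \<omega> \<omega>' \<partial>MJ) = (\<integral>\<^sup>+\<omega>'. f \<omega> \<omega>' \<partial>M)" if "\<omega> \<in> space M" for \<omega>
      using measurable_compose_Pair1[OF _ f, of \<omega>] that unfolding MJ_def by (subst nn_integral_distr) auto
    have m: "(\<lambda>\<omega>. \<integral>\<^sup>+\<omega>'. f \<omega> \<omega>' \<partial>MJ) \<in> borel_measurable (info I)"
      using f by (intro MJ.borel_measurable_nn_integral) (simp cong: measurable_cong_sets sets_pair_measure_cong)
    have "(\<integral>\<^sup>+\<omega>. \<integral>\<^sup>+\<omega>'. f \<omega> \<omega>' \<partial>MJ \<partial>MI) = (\<integral>\<^sup>+\<omega>. \<integral>\<^sup>+\<omega>'. f \<omega> \<omega>' \<partial>MJ \<partial>M)"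
      using m unfolding MI_def by (simp add: nn_integral_distr)
    also have "\<dots> = (\<integral>\<^sup>+\<omega>. \<integral>\<^sup>+\<omega>'. f \<omega> \<omega>' \<partial>M \<partial>M)"
      by (intro nn_integral_cong inner)
    finally show ?thesis .
  qed
  finally show ?thesis .
qed

lemma expectation_prod_disjoint:
  fixes f :: "nat \<Rightarrow> 'w \<Rightarrow> ennreal"
  assumes f: "\<And>k. k < m \<Longrightarrow> f k \<in> borel_measurable (info (J k))"
    and disj: "\<And>j k. j < k \<Longrightarrow> k < m \<Longrightarrow> J j \<inter> J k = {}"
  shows "(\<integral>\<^sup>+\<omega>. (\<Prod>k<m. f k \<omega>) \<partial>M) = (\<Prod>k<m. \<integral>\<^sup>+\<omega>. f k \<omega> \<partial>M)"
  using assms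
proof (induction m)
  case 0
  then show ?case by (simp add: emeasure_space_1)
next
  case (Suc m)
  let ?I = "\<Union>k<m. J k"
  have prev: "(\<lambda>\<omega>. \<Prod>k<m. f k \<omega>) \<in> borel_measurable (info ?I)"
    by (intro borel_measurable_prod_ennreal measurable_info_weaken[OF Suc.prems(1)]) auto
  have last: "f m \<in> borel_measurable (info (J m))" using Suc.prems(1) by simp
  note [measurable] = prev last
  have "(\<integral>\<^sup>+\<omega>. (\<Prod>k<Suc m. f k \<omega>) \<partial>M) = (\<integral>\<^sup>+\<omega>. (\<Prod>k<m. f k \<omega>) * f m \<omega> \<partial>M)" by simp
  also have "\<dots> = (\<integral>\<^sup>+\<omega>. \<integral>\<^sup>+\<omega>'. (\<Prod>k<m. f k \<omega>) * f m \<omega>' \<partial>M \<partial>M)"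
    using Suc.prems(2) by (intro decouple[where I="?I" and J="J m"]) (force, measurable)
  also have "\<dots> = (\<integral>\<^sup>+\<omega>. (\<Prod>k<m. f k \<omega>) \<partial>M) * (\<integral>\<^sup>+\<omega>. f m \<omega> \<partial>M)"
    using measurable_from_info[OF prev] measurable_from_info[OF last]
    by (simp add: nn_integral_cmult nn_integral_multc)
  finally show ?case using Suc by simp
qed

end

section \<open>Marks in the family of a single particle\<close>

context branching_particle_system
begin

lemma measurable_source_event:
  assumes "X \<in> space M \<rightarrow> space N" and "\<And>A. A \<in> sets N \<Longrightarrow> X -` A \<inter> space M \<in> source_event i" and "i \<in> I"
  shows "X \<in> info I \<rightarrow>\<^sub>M N"
  using assms by (intro measurableI) (auto simp: sets_info intro!: sigma_sets.Basic)

lemma measurable_initial: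
  assumes "Initial \<in> I"
  shows "(\<lambda>\<omega>. (n \<omega>, \<lambda>i. x i \<omega>)) \<in> info I \<rightarrow>\<^sub>M count_space UNIV \<Otimes>\<^sub>M (\<Pi>\<^sub>M i\<in>UNIV. borel)"
  using assms by (intro measurable_source_event[of _ _ Initial])
    (auto simp: space_pair_measure space_PiM in_vimage_algebra)

lemma measurable_lifetime:
  assumes "Lifetime u \<in> I"
  shows "lifetime u \<in> info I \<rightarrow>\<^sub>M borel"
  using assms by (intro measurable_source_event[of _ _ "Lifetime u"])
    (auto simp: in_vimage_algebra)

lemma measurable_offspring_info:
  assumes "Offspring u \<in> I"
  shows "offspring u \<in> info I \<rightarrow>\<^sub>M count_space UNIV"
  using assms by (intro measurable_source_event[of _ _ "Offspring u"])
    (auto simp: in_vimage_algebra)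

definition trajectory :: "label \<Rightarrow> 'w \<Rightarrow> real \<Rightarrow> 'a" where
  "trajectory u \<omega> = (\<lambda>t\<in>{0..}. motion u t \<omega>)"

text \<open>Almost surely the displacement of \<open>u\<close> over its lifetime, in a form that is measurable with
  respect to the motion and the lifetime of \<open>u\<close>.\<close>

definition displacement :: "label \<Rightarrow> 'w \<Rightarrow> 'a" where
  "displacement u \<omega> = right_limit (lifetime u \<omega>) (trajectory u \<omega>)"

lemma measurable_trajectory:
  "Motion u \<in> I \<Longrightarrow> trajectory u \<in> info I \<rightarrow>\<^sub>M (\<Pi>\<^sub>M t\<in>{0..}. borel)"
  unfolding trajectory_def[abs_def] by (rule measurable_source_event[of _ _ "Motion u"])
    (auto simp: space_PiM in_vimage_algebra)

lemma measurable_displacement: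
  assumes "Motion u \<in> I" "Lifetime u \<in> I"
  shows "displacement u \<in> info I \<rightarrow>\<^sub>M borel"
proof -
  have "(\<lambda>\<omega>. (lifetime u \<omega>, trajectory u \<omega>)) \<in> info I \<rightarrow>\<^sub>M borel \<Otimes>\<^sub>M (\<Pi>\<^sub>M t\<in>{0..}. borel)"
    using assms by (intro measurable_Pair measurable_lifetime measurable_trajectory)
  from measurable_compose[OF this measurable_right_limit] show ?thesis
    by (simp add: displacement_def[abs_def])
qed

lemma AE_trajectory_regular: "AE \<omega> in M. \<forall>u. 0 < lifetime u \<omega> \<and> motion u 0 \<omega> = 0 \<and> cadlag (trajectory u \<omega>)"
proof -
  have "AE \<omega> in M. 0 < lifetime u \<omega> \<and> motion u 0 \<omega> = 0 \<and> cadlag (trajectory u \<omega>)" for u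
  proof -
    have start: "AE \<omega> in M. motion u 0 \<omega> = 0" and regular: "AE \<omega> in M. cadlag (\<lambda>t. motion u t \<omega>)"
      using stable_motion[of u] by (auto simp: stable_levy_process_def levy_process_def)
    have positive: "AE \<omega> in M. 0 < lifetime u \<omega>"
    proof -
      have "AE l in density lborel (exponential_density V). 0 < l"
        by (subst AE_density) (auto simp: exponential_density_def intro!: eventually_mono[OF AE_lborel_singleton[of 0]])
      then have "AE l in distr M lborel (lifetime u). 0 < l"
        unfolding distributed_distr_eq_density[OF exponential_lifetime[of u]] .
      then show ?thesis
        using distributed_measurable[OF exponential_lifetime[of u]] by (subst (asm) AE_distr_iff) auto
    qed
    have cadlag_trajectory: "cadlag (trajectory u \<omega>)" if c: "cadlag (\<lambda>t. motion u t \<omega>)" for \<omega>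
      unfolding cadlag_def
    proof (intro conjI allI impI)
      fix t :: real assume t: "0 \<le> t"
      have "((\<lambda>t. motion u t \<omega>) \<longlongrightarrow> motion u t \<omega>) (at_right t)" using c t by (auto simp: cadlag_def)
      moreover have "eventually (\<lambda>s. motion u s \<omega> = trajectory u \<omega> s) (at_right t)"
        using t by (auto simp: eventually_at_filter trajectory_def)
      ultimately have "(trajectory u \<omega> \<longlongrightarrow> motion u t \<omega>) (at_right t)"
        by (rule Lim_transform_eventually)
      moreover have "trajectory u \<omega> t = motion u t \<omega>" using t by (simp add: trajectory_def)
      ultimately show "(trajectory u \<omega> \<longlongrightarrow> trajectory u \<omega> t) (at_right t)" by (simp only:)
    next
      fix t :: real assume t: "0 < t"
      then obtain l where "((\<lambda>t. motion u t \<omega>) \<longlongrightarrow> l) (at_left t)" using c by (auto simp: cadlag_def)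
      moreover have "eventually (\<lambda>s. motion u s \<omega> = trajectory u \<omega> s) (at_left t)"
        using eventually_at_left_real[OF t] by eventually_elim (auto simp: trajectory_def)
      ultimately have "(trajectory u \<omega> \<longlongrightarrow> l) (at_left t)" by (rule Lim_transform_eventually)
      then show "\<exists>l. (trajectory u \<omega> \<longlongrightarrow> l) (at_left t)" ..
    qed
    show ?thesis
      using start regular positive by eventually_elim (auto intro: cadlag_trajectory)
  qed
  then show ?thesis by (simp add: AE_all_countable)
qed

lemma AE_right_limit_trajectory: 
  assumes "0 \<le> l"
  shows "AE \<omega> in M. right_limit l (trajectory u \<omega>) = motion u l \<omega>"
  using AE_trajectory_regular
proof eventually_elim
  case (elim \<omega>)
  then show ?case using assms right_limit_cadlag[of "trajectory u \<omega>" l] by (simp add: trajectory_def)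
qed

lemma AE_displacement: "AE \<omega> in M. \<forall>u. displacement u \<omega> = motion u (lifetime u \<omega>) \<omega>"
  using AE_trajectory_regular
proof eventually_elim
  case (elim \<omega>)
  then have "displacement u \<omega> = motion u (lifetime u \<omega>) \<omega>" for u
    using right_limit_cadlag[of "trajectory u \<omega>" "lifetime u \<omega>"] elim[rule_format, of u]
    by (simp add: displacement_def less_imp_le) (simp add: trajectory_def less_imp_le)
  then show ?case ..
qed

text \<open>The law of one particular motion serves as the reference; by \<open>char_unique\<close> all motions share
  it. Through \<open>right_limit\<close> it depends measurably on the time.\<close>

definition motion_law :: "real \<Rightarrow> 'a measure" where
  "motion_law l = distr M borel (\<lambda>\<omega>. right_limit l (trajectory (Root 0) \<omega>))"

lemma measurable_right_limit_trajectory [measurable]: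
  "(\<lambda>(l, \<omega>). right_limit l (trajectory u \<omega>)) \<in> borel \<Otimes>\<^sub>M info {Motion u} \<rightarrow>\<^sub>M borel"
proof -
  have "(\<lambda>q. (fst q, trajectory u (snd q))) \<in> borel \<Otimes>\<^sub>M info {Motion u} \<rightarrow>\<^sub>M borel \<Otimes>\<^sub>M (\<Pi>\<^sub>M t\<in>{0..}. borel)"
    by (intro measurable_Pair measurable_fst measurable_compose[OF measurable_snd measurable_trajectory]) simp
  from measurable_compose[OF this measurable_right_limit] show ?thesis
    by (simp add: split_beta')
qed

lemma measurable_right_limit_trajectory_M [measurable]:
  "(\<lambda>(l, \<omega>). right_limit l (trajectory u \<omega>)) \<in> borel \<Otimes>\<^sub>M M \<rightarrow>\<^sub>M borel"
proof -
  have "(\<lambda>q. (fst q, snd q)) \<in> borel \<Otimes>\<^sub>M M \<rightarrow>\<^sub>M (borel :: real measure) \<Otimes>\<^sub>M info {Motion u}"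
    by (intro measurable_Pair measurable_fst measurable_compose[OF measurable_snd measurable_info_id])
  from measurable_compose[OF this measurable_right_limit_trajectory] show ?thesis by (simp add: split_beta')
qed

lemma measurable_right_limit_trajectory_fixed [measurable]:
  "(\<lambda>\<omega>. right_limit l (trajectory u \<omega>)) \<in> M \<rightarrow>\<^sub>M borel"
  using measurable_compose_Pair1[OF _ measurable_right_limit_trajectory_M, of l u] by simp

lemma char_trajectory:
  assumes "0 \<le> l"
  shows "(LINT y|distr M borel (\<lambda>\<omega>. right_limit l (trajectory u \<omega>)). iexp (z \<bullet> y)) = complex_of_real (exp (- l * norm z powr \<alpha>))"
proof -
  have [measurable]: "motion u l \<in> borel_measurable M"
    using stable_motion[of u] assms by (auto simp: stable_levy_process_def levy_process_def)
  have "(LINT y|distr M borel (\<lambda>\<omega>. right_limit l (trajectory u \<omega>)). iexp (z \<bullet> y)) = (LINT \<omega>|M. iexp (z \<bullet> right_limit l (trajectory u \<omega>)))"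
    by (rule integral_distr) measurable
  also have "\<dots> = (LINT \<omega>|M. iexp (z \<bullet> motion u l \<omega>))"
    by (rule integral_cong_AE) (use AE_right_limit_trajectory[OF assms, of u] in auto)
  also have "\<dots> = complex_of_real (exp (- l * norm z powr \<alpha>))"
    using stable_motion[of u] assms by (simp add: stable_levy_process_def)
  finally show ?thesis .
qed

lemma stable_semigroup_motion_law:
  assumes "0 < \<alpha>"
  shows "stable_semigroup motion_law \<alpha>"
proof (rule stable_semigroup.intro)
  show "motion_law \<in> borel \<rightarrow>\<^sub>M subprob_algebra borel"
    unfolding motion_law_def[abs_def]
    by (rule measurable_distr2[where M=M])
       (auto intro: prob_space_imp_subprob_space prob_space_axioms simp: space_subprob_algebra)
  show "prob_space (motion_law s)" for s unfolding motion_law_def by (rule prob_space_distr) measurable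
qed (use assms in \<open>auto simp: motion_law_def char_trajectory\<close>)

lemma motion_law_trajectory:
  assumes "0 \<le> l"
  shows "distr M borel (\<lambda>\<omega>. right_limit l (trajectory u \<omega>)) = motion_law l"
  unfolding motion_law_def
  by (rule char_unique) (auto intro!: prob_space_distr simp: char_trajectory assms)

text \<open>The lifetime is independent of the motion, so the motion may be evaluated at a fixed time first.\<close>

lemma expectation_displaced:
  assumes [measurable]: "\<psi> \<in> borel_measurable (borel \<Otimes>\<^sub>M borel)" and \<alpha>: "0 < \<alpha>"
  shows "(\<integral>\<^sup>+\<omega>. \<psi> (fst z + lifetime u \<omega>, snd z + displacement u \<omega>) \<partial>M) = stable_semigroup.step motion_law V \<psi> z"
proof -
  interpret stable_semigroup motion_law \<alpha> by (rule stable_semigroup_motion_law[OF \<alpha>])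
  let ?I = "{Lifetime u}" and ?J = "{Motion u}"
  have [measurable]: "lifetime u \<in> info ?I \<rightarrow>\<^sub>M borel" by (rule measurable_lifetime) simp
  have [measurable]: "lifetime u \<in> M \<rightarrow>\<^sub>M borel" by (rule measurable_from_info) fact
  have [measurable]: "(\<lambda>q. right_limit (lifetime u (fst q)) (trajectory u (snd q))) \<in> info ?I \<Otimes>\<^sub>M info ?J \<rightarrow>\<^sub>M borel"
  proof -
    have "(\<lambda>q. (lifetime u (fst q), snd q)) \<in> info ?I \<Otimes>\<^sub>M info ?J \<rightarrow>\<^sub>M borel \<Otimes>\<^sub>M info ?J" by measurable
    from measurable_compose[OF this measurable_right_limit_trajectory] show ?thesis by simp
  qed
  define k where "k l = (\<integral>\<^sup>+y. \<psi> (fst z + l, snd z + y) \<partial>motion_law l)" for l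
  have [measurable]: "k \<in> borel_measurable borel" unfolding k_def by measurable
  have "(\<integral>\<^sup>+\<omega>. \<psi> (fst z + lifetime u \<omega>, snd z + displacement u \<omega>) \<partial>M)
    = (\<integral>\<^sup>+\<omega>. \<integral>\<^sup>+\<omega>'. \<psi> (fst z + lifetime u \<omega>, snd z + right_limit (lifetime u \<omega>) (trajectory u \<omega>')) \<partial>M \<partial>M)"
    unfolding displacement_def
    by (rule decouple[where I="?I" and J="?J"]) (auto simp: split_beta')
  also have "\<dots> = (\<integral>\<^sup>+\<omega>. k (lifetime u \<omega>) \<partial>M)"
  proof (rule nn_integral_cong_AE, use AE_trajectory_regular in eventually_elim)
    case (elim \<omega>)
    then have l: "0 \<le> lifetime u \<omega>" by (simp add: less_imp_le)
    show ?case
      unfolding k_def motion_law_trajectory[OF l, of u, symmetric] by (subst nn_integral_distr) auto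
  qed
  also have "\<dots> = (\<integral>\<^sup>+l. ennreal (exponential_density V l) * k l \<partial>lborel)"
    by (rule distributed_nn_integral[OF exponential_lifetime, symmetric]) simp
  also have "\<dots> = step V \<psi> z" by (simp add: step_def k_def)
  finally show ?thesis .
qed

text \<open>At \<open>s = 0\<close> the bound follows by monotonicity from the values of the generating function to the
  right of 0.\<close>

lemma offspring_generating_bound:
  assumes \<beta>: "0 < \<beta>" and s: "0 \<le> s" "s \<le> 1"
  shows "(\<integral>\<^sup>+\<omega>. ennreal (s ^ offspring u \<omega>) \<partial>M) \<le> ennreal (s + (1 - s) powr (1 + \<beta>) / (1 + \<beta>))"
proof -
  note measurable_offspring[measurable]
  have inner: "(\<integral>\<^sup>+\<omega>. ennreal (r ^ offspring u \<omega>) \<partial>M) = ennreal (r + (1 - r) powr (1 + \<beta>) / (1 + \<beta>))" if "0 < r" "r < 1" for r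
  proof -
    have "(\<integral>\<^sup>+\<omega>. ennreal (r ^ offspring u \<omega>) \<partial>M) = ennreal (expectation (\<lambda>\<omega>. r ^ offspring u \<omega>))"
      using that by (intro nn_integral_eq_integral integrable_const_bound[where B=1])
        (auto simp: power_le_one abs_of_nonneg)
    then show ?thesis using offspring_generating_function[OF that, of u] by simp
  qed
  show ?thesis
  proof (cases "s = 0 \<or> s = 1")
    case False
    then show ?thesis using inner[of s] s by simp
  next
    case True
    then consider "s = 1" | "s = 0" by auto
    then show ?thesis
    proof cases
      case 1
      then show ?thesis by (simp add: emeasure_space_1)
    next
      case 2
      have "((\<lambda>r. ennreal (r + (1 - r) powr (1 + \<beta>) / (1 + \<beta>))) \<longlongrightarrow> ennreal (0 + (1 - 0) powr (1 + \<beta>) / (1 + \<beta>))) (at_right 0)"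
        using \<beta> by (intro tendsto_intros) auto
      moreover have "eventually (\<lambda>r. (\<integral>\<^sup>+\<omega>. ennreal (s ^ offspring u \<omega>) \<partial>M) \<le> ennreal (r + (1 - r) powr (1 + \<beta>) / (1 + \<beta>))) (at_right 0)"
        using eventually_at_right_real[of 0 1, OF zero_less_one]
      proof eventually_elim
        case (elim r)
        then show ?case
          unfolding inner[of r, symmetric, OF greaterThanLessThan_iff[THEN iffD1, OF elim, THEN conjunct1] greaterThanLessThan_iff[THEN iffD1, OF elim, THEN conjunct2]]
          using 2 by (intro nn_integral_mono ennreal_leI power_mono) auto
      qed
      ultimately have "(\<integral>\<^sup>+\<omega>. ennreal (s ^ offspring u \<omega>) \<partial>M) \<le> ennreal (0 + (1 - 0) powr (1 + \<beta>) / (1 + \<beta>))"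
        by (intro tendsto_lowerbound) auto
      then show ?thesis using 2 by simp
    qed
  qed
qed

text \<open>The conditional probability, given motions, lifetimes and offspring numbers, that no particle of the
  first \<open>g\<close> generations of the family of \<open>u\<close> is marked, when \<open>u\<close> is born at the
  space-time point \<open>z\<close> and each birth at \<open>z'\<close> is marked with probability \<open>a z'\<close>.\<close>

fun avoidance :: "(real \<times> 'a \<Rightarrow> real) \<Rightarrow> nat \<Rightarrow> label \<Rightarrow> real \<times> 'a \<Rightarrow> 'w \<Rightarrow> ennreal" where
  "avoidance a 0 u z \<omega> = 1"
| "avoidance a (Suc g) u z \<omega> = ennreal (1 - a z) *
     (\<Prod>k<offspring u \<omega>. avoidance a g (Child u k) (fst z + lifetime u \<omega>, snd z + displacement u \<omega>) \<omega>)"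

lemma measurable_children_prod:
  fixes F :: "nat \<Rightarrow> real \<times> 'a \<Rightarrow> 'w \<Rightarrow> ennreal"
  assumes F: "\<And>k. (\<lambda>(z, \<omega>). F k z \<omega>) \<in>
    borel_measurable ((borel \<Otimes>\<^sub>M borel) \<Otimes>\<^sub>M info (sources_of {w. descends (Child u k) w}))"
  shows "(\<lambda>(z, \<omega>). \<Prod>k<offspring u \<omega>. F k (fst z + lifetime u \<omega>, snd z + displacement u \<omega>) \<omega>)
    \<in> borel_measurable ((borel \<Otimes>\<^sub>M borel) \<Otimes>\<^sub>M info (sources_of {w. descends u w}))"
proof -
  let ?I = "sources_of {w. descends u w}"
  have in_I: "Motion u \<in> ?I" "Lifetime u \<in> ?I" "Offspring u \<in> ?I" by (auto simp: sources_of_def)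
  note [measurable] = measurable_lifetime[OF in_I(2)] measurable_displacement[OF in_I(1,2)] measurable_offspring_info[OF in_I(3)]
  have child [measurable]: "(\<lambda>q. F k (fst (fst q) + lifetime u (snd q), snd (fst q) + displacement u (snd q)) (snd q))
      \<in> borel_measurable ((borel \<Otimes>\<^sub>M borel) \<Otimes>\<^sub>M info ?I)" for k
  proof -
    have [measurable]: "(\<lambda>q. snd q) \<in> (borel \<Otimes>\<^sub>M borel) \<Otimes>\<^sub>M info ?I \<rightarrow>\<^sub>M info (sources_of {w. descends (Child u k) w})"
      by (intro measurable_compose[OF measurable_snd measurable_info_mono] sources_of_mono) (auto dest: descends_Child)
    have "(\<lambda>q. ((fst (fst q) + lifetime u (snd q), snd (fst q) + displacement u (snd q)), snd q))
      \<in> (borel \<Otimes>\<^sub>M borel) \<Otimes>\<^sub>M info ?I \<rightarrow>\<^sub>M (borel \<Otimes>\<^sub>M borel) \<Otimes>\<^sub>M info (sources_of {w. descends (Child u k) w})"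
      by measurable
    from measurable_compose[OF this F] show ?thesis by simp
  qed
  show ?thesis
    unfolding split_beta'
    by (rule measurable_compose_countable[where f="\<lambda>m q. \<Prod>k<m. F k (fst (fst q) + lifetime u (snd q), snd (fst q) + displacement u (snd q)) (snd q)"])
       measurable
qed

lemma measurable_avoidance:
  assumes [measurable]: "a \<in> borel_measurable (borel \<Otimes>\<^sub>M borel)"
  shows "(\<lambda>(z, \<omega>). avoidance a g u z \<omega>) \<in> borel_measurable ((borel \<Otimes>\<^sub>M borel) \<Otimes>\<^sub>M info (sources_of {w. descends u w}))"
proof (induction g arbitrary: u)
  case (Suc g)
  from measurable_children_prod[of "\<lambda>k. avoidance a g (Child u k)", OF Suc] show ?case
    by (simp add: split_beta')
qed (simp add: split_beta')

lemma measurable_avoidance_fixed: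
  assumes "a \<in> borel_measurable (borel \<Otimes>\<^sub>M borel)"
  shows "avoidance a g u z \<in> borel_measurable (info (sources_of {w. descends u w}))"
  using measurable_compose_Pair1[OF _ measurable_avoidance[OF assms], of z] by (simp add: space_pair_measure)

text \<open>Given the lifetime, displacement and offspring number of \<open>u\<close>, its children start independent
  families from the same space-time point, so that the expectation of the product over the children
  is a power, to which the bound on the offspring generating function applies.\<close>

lemma expectation_avoidance:
  assumes [measurable]: "a \<in> borel_measurable (borel \<Otimes>\<^sub>M borel)" and a: "\<And>z. 0 \<le> a z" "\<And>z. a z \<le> 1"
    and \<alpha>: "0 < \<alpha>" and \<beta>: "0 < \<beta>" and V: "0 < V"
  shows "(\<integral>\<^sup>+\<omega>. avoidance a g u z \<omega> \<partial>M) \<le> ennreal (1 - stable_semigroup.mark_prob motion_law V \<beta> a g z)"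
proof (induction g arbitrary: u z)
  interpret stable_semigroup motion_law \<alpha> by (rule stable_semigroup_motion_law[OF \<alpha>])
  case 0
  then show ?case by (simp add: emeasure_space_1)
next
  interpret stable_semigroup motion_law \<alpha> by (rule stable_semigroup_motion_law[OF \<alpha>])
  case (Suc g)
  let ?v = "mark_prob V \<beta> a g"
  let ?I = "{Motion u, Lifetime u}" and ?J = "sources_of {w. \<exists>k. descends (Child u k) w}"
  let ?next = "\<lambda>\<omega>. (fst z + lifetime u \<omega>, snd z + displacement u \<omega>)"
  have v: "0 \<le> ?v z" "?v z \<le> 1" for z
    using mark_prob_bounds[OF V \<beta>, of a] a by auto
  note [measurable] = measurable_lifetime[of u ?I, simplified] measurable_displacement[of u ?I, simplified]
  have step1: "(\<integral>\<^sup>+\<omega>. (\<Prod>k<offspring u \<omega>. avoidance a g (Child u k) (?next \<omega>) \<omega>) \<partial>M) =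
    (\<integral>\<^sup>+\<omega>. \<integral>\<^sup>+\<omega>'. (\<Prod>k<offspring u \<omega>. avoidance a g (Child u k) (?next \<omega>) \<omega>') \<partial>M \<partial>M)"
  proof (rule decouple)
    let ?I' = "sources_of {u}"
    show "?I' \<inter> ?J = {}" by (rule sources_of_disjoint) auto
    have in_I: "Motion u \<in> ?I'" "Lifetime u \<in> ?I'" "Offspring u \<in> ?I'" by (auto simp: sources_of_def)
    note [measurable] = measurable_lifetime[OF in_I(2)] measurable_displacement[OF in_I(1,2)] measurable_offspring_info[OF in_I(3)]
    have child: "(\<lambda>q. avoidance a g (Child u k) (?next (fst q)) (snd q)) \<in> borel_measurable (info ?I' \<Otimes>\<^sub>M info ?J)" for k
    proof -
      have [measurable]: "(\<lambda>q. snd q) \<in> info ?I' \<Otimes>\<^sub>M info ?J \<rightarrow>\<^sub>M info (sources_of {w. descends (Child u k) w})"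
        by (intro measurable_compose[OF measurable_snd measurable_info_mono] sources_of_mono) auto
      have "(\<lambda>q. (?next (fst q), snd q)) \<in> info ?I' \<Otimes>\<^sub>M info ?J \<rightarrow>\<^sub>M (borel \<Otimes>\<^sub>M borel) \<Otimes>\<^sub>M info (sources_of {w. descends (Child u k) w})"
        by measurable
      from measurable_compose[OF this measurable_avoidance[OF assms(1)]] show ?thesis by simp
    qed
    have "(\<lambda>q. \<Prod>k<offspring u (fst q). avoidance a g (Child u k) (?next (fst q)) (snd q)) \<in> borel_measurable (info ?I' \<Otimes>\<^sub>M info ?J)"
      by (rule measurable_compose_countable[where f="\<lambda>m q. \<Prod>k<m. avoidance a g (Child u k) (?next (fst q)) (snd q)"])
         (use child in measurable)
    then show "(\<lambda>(\<omega>, \<omega>'). \<Prod>k<offspring u \<omega>. avoidance a g (Child u k) (?next \<omega>) \<omega>') \<in> borel_measurable (info ?I' \<Otimes>\<^sub>M info ?J)"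
      by (simp add: split_beta')
  qed
  have children: "(\<integral>\<^sup>+\<omega>'. (\<Prod>k<m. avoidance a g (Child u k) z' \<omega>') \<partial>M) \<le> ennreal ((1 - ?v z') ^ m)" for m z'
  proof -
    have "(\<integral>\<^sup>+\<omega>'. (\<Prod>k<m. avoidance a g (Child u k) z' \<omega>') \<partial>M) = (\<Prod>k<m. \<integral>\<^sup>+\<omega>'. avoidance a g (Child u k) z' \<omega>' \<partial>M)"
      by (rule expectation_prod_disjoint[OF measurable_avoidance_fixed[OF assms(1)]])
         (auto intro!: sources_of_disjoint dest: descends_sibling)
    also have "\<dots> \<le> ennreal (1 - ?v z') ^ m"
      by (induction m) (auto simp: mult.commute intro!: mult_mono Suc)
    also have "\<dots> = ennreal ((1 - ?v z') ^ m)"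
      using v by (simp add: ennreal_power)
    finally show ?thesis .
  qed
  have step2: "(\<integral>\<^sup>+\<omega>. ennreal ((1 - ?v (?next \<omega>)) ^ offspring u \<omega>) \<partial>M) =
     (\<integral>\<^sup>+\<omega>. \<integral>\<^sup>+\<omega>'. ennreal ((1 - ?v (?next \<omega>)) ^ offspring u \<omega>') \<partial>M \<partial>M)"
  proof (rule decouple[where I="?I" and J="{Offspring u}"])
    have [measurable]: "offspring u \<in> info {Offspring u} \<rightarrow>\<^sub>M count_space UNIV" by (rule measurable_offspring_info) simp
    show "(\<lambda>(\<omega>, \<omega>'). ennreal ((1 - ?v (?next \<omega>)) ^ offspring u \<omega>')) \<in> borel_measurable (info ?I \<Otimes>\<^sub>M info {Offspring u})"
      unfolding split_beta'
      by (rule measurable_compose_countable[where f="\<lambda>m q. ennreal ((1 - ?v (?next (fst q))) ^ m)"]) measurable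
  qed auto
  define f where "f z = ?v z - ?v z powr (1 + \<beta>) / (1 + \<beta>)" for z
  have f: "0 \<le> f z" "f z \<le> 1" for z
    using branching_bounds[OF \<beta>, of "?v z"] v[of z] unfolding f_def by auto
  have [measurable]: "f \<in> borel_measurable (borel \<Otimes>\<^sub>M borel)" unfolding f_def by measurable
  define b where "b = step V (\<lambda>z. ennreal (f z)) z"
  have b1: "b \<le> 1"
  proof -
    have "b \<le> step V (\<lambda>_. 1) z" unfolding b_def using f by (intro step_mono) simp
    then show ?thesis unfolding step_const[OF V] .
  qed
  have "(\<integral>\<^sup>+\<omega>. (\<Prod>k<offspring u \<omega>. avoidance a g (Child u k) (?next \<omega>) \<omega>) \<partial>M)
     \<le> (\<integral>\<^sup>+\<omega>. ennreal ((1 - ?v (?next \<omega>)) ^ offspring u \<omega>) \<partial>M)"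
    unfolding step1 by (intro nn_integral_mono children)
  also have "\<dots> \<le> (\<integral>\<^sup>+\<omega>. ennreal (1 - f (?next \<omega>)) \<partial>M)"
    unfolding step2
  proof (rule nn_integral_mono)
    fix \<omega>
    show "(\<integral>\<^sup>+\<omega>'. ennreal ((1 - ?v (?next \<omega>)) ^ offspring u \<omega>') \<partial>M) \<le> ennreal (1 - f (?next \<omega>))"
    proof -
      have eq: "1 - f (?next \<omega>) = (1 - ?v (?next \<omega>)) + (1 - (1 - ?v (?next \<omega>))) powr (1 + \<beta>) / (1 + \<beta>)"
        by (simp add: f_def)
      show ?thesis unfolding eq by (rule offspring_generating_bound[OF \<beta>]) (use v in auto)
    qed
  qed
  also have "\<dots> = 1 - b"
  proof -
    have m: "(\<lambda>\<omega>. ennreal (f (?next \<omega>))) \<in> borel_measurable M"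
      by (rule measurable_from_info[of _ ?I]) measurable
    have "(\<integral>\<^sup>+\<omega>. ennreal (1 - f (?next \<omega>)) \<partial>M) = (\<integral>\<^sup>+\<omega>. 1 - ennreal (f (?next \<omega>)) \<partial>M)"
      using f by (intro nn_integral_cong) (simp add: ennreal_minus ennreal_1[symmetric] del: ennreal_1)
    also have "\<dots> = (\<integral>\<^sup>+\<omega>. 1 \<partial>M) - (\<integral>\<^sup>+\<omega>. ennreal (f (?next \<omega>)) \<partial>M)"
    proof -
      have "step V (\<lambda>z. ennreal (f z)) z \<noteq> \<infinity>" using b1 unfolding b_def by (auto simp: top_unique)
      then show ?thesis
        using m f by (intro nn_integral_diff) (auto simp: expectation_displaced[of "\<lambda>z. ennreal (f z)", OF _ \<alpha>])
    qed
    also have "\<dots> = 1 - b"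
      by (simp add: expectation_displaced[of "\<lambda>z. ennreal (f z)", OF _ \<alpha>] b_def emeasure_space_1)
    finally show ?thesis .
  qed
  finally have main: "(\<integral>\<^sup>+\<omega>. (\<Prod>k<offspring u \<omega>. avoidance a g (Child u k) (?next \<omega>) \<omega>) \<partial>M) \<le> 1 - b" .
  have mm: "(\<lambda>\<omega>. \<Prod>k<offspring u \<omega>. avoidance a g (Child u k) (?next \<omega>) \<omega>) \<in> borel_measurable M"
    using measurable_compose_Pair1[OF _ measurable_children_prod[of "\<lambda>k. avoidance a g (Child u k)", OF measurable_avoidance[OF assms(1)]], of z]
    by (intro measurable_from_info) (simp add: space_pair_measure)
  have "(\<integral>\<^sup>+\<omega>. avoidance a (Suc g) u z \<omega> \<partial>M) = ennreal (1 - a z) * (\<integral>\<^sup>+\<omega>. (\<Prod>k<offspring u \<omega>. avoidance a g (Child u k) (?next \<omega>) \<omega>) \<partial>M)"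
    using mm by (simp add: nn_integral_cmult)
  also have "\<dots> \<le> ennreal (1 - a z) * (1 - b)"
    using main by (rule mult_left_mono) simp
  also have "\<dots> = ennreal (1 - mark_prob V \<beta> a (Suc g) z)"
  proof -
    have "b = ennreal (enn2real b)" using b1 by (metis ennreal_enn2real ennreal_one_less_top order_le_less_trans)
    moreover have "enn2real b \<le> 1" using b1 by (intro enn2real_leI) auto
    ultimately have "1 - b = ennreal (1 - enn2real b)" 
      by (metis ennreal_1 ennreal_minus enn2real_nonneg)
    moreover have "1 - mark_prob V \<beta> a (Suc g) z = (1 - a z) * (1 - enn2real b)"
      by (simp add: b_def f_def algebra_simps)
    ultimately show ?thesis using a \<open>enn2real b \<le> 1\<close> by (simp add: ennreal_mult del: mark_prob.simps)
  qed
  finally show ?case .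
qed

end

section \<open>Poisson initial configurations\<close>

context prob_space
begin

definition nat_count :: "ennreal \<Rightarrow> nat" where
  "nat_count t = nat \<lfloor>enn2real t\<rfloor>"

lemma nat_count_of_nat [simp]: "nat_count (of_nat k) = k"
  by (simp add: nat_count_def)

lemma measurable_nat_count [measurable]: "nat_count \<in> borel \<rightarrow>\<^sub>M count_space UNIV"
  unfolding nat_count_def[abs_def] by measurable

text \<open>The Poisson weights sum to 1, so the count is almost surely a natural number, and its generating
  function at \<open>1 - c\<close> is the exponential series.\<close>

lemma poisson_count_finite:
  assumes N: "poisson_random_measure M \<mu> N" and A: "A \<in> sets \<mu>" "emeasure \<mu> A < \<infinity>"
  shows "AE \<omega> in M. emeasure (N \<omega>) A = of_nat (nat_count (emeasure (N \<omega>) A))"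
    and "0 \<le> c \<Longrightarrow> c \<le> 1 \<Longrightarrow>
      (\<integral>\<^sup>+\<omega>. ennreal ((1 - c) ^ nat_count (emeasure (N \<omega>) A)) \<partial>M) = ennreal (exp (- c * measure \<mu> A))"
proof -
  define l where "l = measure \<mu> A"
  have l: "0 \<le> l" by (simp add: l_def)
  define E where "E k = {\<omega> \<in> space M. emeasure (N \<omega>) A = of_nat k}" for k :: nat
  have [measurable]: "(\<lambda>\<omega>. emeasure (N \<omega>) A) \<in> borel_measurable M"
    using N A by (auto simp: poisson_random_measure_def)
  have [measurable]: "E k \<in> sets M" for k unfolding E_def by measurable
  have PE: "emeasure M (E k) = ennreal (exp (- l) * l ^ k / fact k)" for k
    using N A unfolding emeasure_eq_measure E_def l_def by (auto simp: poisson_random_measure_def)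
  have disj: "disjoint_family E"
    by (auto simp: disjoint_family_on_def E_def)
  have series: "(\<Sum>k. ennreal (r ^ k) * emeasure M (E k)) = ennreal (exp (- l) * exp (r * l))" if "0 \<le> r" for r
  proof -
    have "(\<Sum>k. ennreal (r ^ k) * emeasure M (E k)) = (\<Sum>k. ennreal (exp (- l) * ((r * l) ^ k /\<^sub>R fact k)))"
      using that l unfolding PE by (simp add: ennreal_mult[symmetric] power_mult_distrib divide_inverse mult_ac)
    also have "\<dots> = ennreal (exp (- l) * exp (r * l))"
      using that l by (intro suminf_ennreal_eq sums_mult exp_converges) auto
    finally show ?thesis .
  qed
  have "emeasure M (\<Union>k. E k) = (\<Sum>k. emeasure M (E k))"
    using disj by (intro suminf_emeasure[symmetric]) auto
  also have "\<dots> = 1" using series[of 1] by (simp add: exp_minus)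
  finally have "prob (\<Union>k. E k) = 1" by (simp add: emeasure_eq_measure)
  then have AE_E: "AE \<omega> in M. \<omega> \<in> (\<Union>k. E k)" by (subst (asm) prob_eq_1) auto
  then show "AE \<omega> in M. emeasure (N \<omega>) A = of_nat (nat_count (emeasure (N \<omega>) A))"
    by eventually_elim (auto simp: E_def)
  assume c: "0 \<le> c" "c \<le> 1"
  have "(\<integral>\<^sup>+\<omega>. ennreal ((1 - c) ^ nat_count (emeasure (N \<omega>) A)) \<partial>M) = (\<integral>\<^sup>+\<omega>. (\<Sum>k. ennreal ((1 - c) ^ k) * indicator (E k) \<omega>) \<partial>M)"
  proof (rule nn_integral_cong_AE, use AE_E in eventually_elim)
    case (elim \<omega>)
    then obtain k where k: "\<omega> \<in> E k" by auto
    have "(\<Sum>j. ennreal ((1 - c) ^ j) * indicator (E j) \<omega>) = (\<Sum>j\<in>{k}. ennreal ((1 - c) ^ j) * indicator (E j) \<omega>)"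
      using k disj by (intro suminf_finite) (auto simp: disjoint_family_on_def indicator_def)
    also have "\<dots> = ennreal ((1 - c) ^ nat_count (emeasure (N \<omega>) A))"
      using k by (simp add: E_def)
    finally show ?case by simp
  qed
  also have "\<dots> = (\<Sum>k. ennreal ((1 - c) ^ k) * emeasure M (E k))"
    by (subst nn_integral_suminf) (simp_all add: nn_integral_cmult_indicator)
  also have "\<dots> = ennreal (exp (- c * measure \<mu> A))"
    using series[of "1 - c"] c by (simp add: l_def algebra_simps flip: exp_add)
  finally show "(\<integral>\<^sup>+\<omega>. ennreal ((1 - c) ^ nat_count (emeasure (N \<omega>) A)) \<partial>M) = ennreal (exp (- c * measure \<mu> A))" .
qed

text \<open>The Laplace functional of a Poisson random measure at a simple function: the product over the
  points factorises into powers of \<open>1 - y\<close> whose exponents are the independent Poisson counts of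
  the level sets. The truncation to \<open>i < m\<close> makes the products finite.\<close>

lemma poisson_simple_function:
  fixes x :: "nat \<Rightarrow> 'a \<Rightarrow> 'b::euclidean_space" and f :: "'b \<Rightarrow> ennreal"
  assumes N: "poisson_random_measure M \<mu> (\<lambda>\<omega>. counting {i. enat i < n \<omega>} (\<lambda>i. x i \<omega>))"
    and sets: "sets \<mu> = sets borel"
    and n [measurable]: "n \<in> M \<rightarrow>\<^sub>M count_space UNIV" and x [measurable]: "\<And>i. x i \<in> borel_measurable M"
    and f: "simple_function \<mu> f" "\<And>y. f y \<le> 1" and fin: "emeasure \<mu> {y. f y \<noteq> 0} < \<infinity>"
  shows "(\<lambda>m. \<integral>\<^sup>+\<omega>. (\<Prod>i<m. if enat i < n \<omega> then 1 - f (x i \<omega>) else 1) \<partial>M)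
    \<longlonglongrightarrow> ennreal (exp (- enn2real (integral\<^sup>S \<mu> f)))"
proof -
  let ?P = "\<lambda>m \<omega>. \<Prod>i<m. if enat i < n \<omega> then 1 - f (x i \<omega>) else 1"
  have space: "space \<mu> = UNIV" using sets_eq_imp_space_eq[OF sets] by simp
  have [measurable]: "f \<in> borel_measurable borel"
    using borel_measurable_simple_function[OF f(1)] by (simp add: measurable_cong_sets[OF sets refl])
  define Y where "Y = f ` UNIV - {0}"
  have Y: "finite Y" using f(1) by (simp add: Y_def simple_function_def space)
  then obtain e where e: "bij_betw e {..<card Y} Y"
    using ex_bij_betw_nat_finite[OF Y] by (auto simp: atLeast0LessThan)
  define A where "A y = f -` {y}" for y
  have A_sets [measurable]: "A y \<in> sets borel" for y
    unfolding A_def using measurable_sets[of f borel borel "{y}"] by simp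
  have A_fin: "emeasure \<mu> (A y) < \<infinity>" if "y \<in> Y" for y
  proof -
    have "emeasure \<mu> (A y) \<le> emeasure \<mu> {y. f y \<noteq> 0}"
      using that by (intro emeasure_mono) (auto simp: A_def Y_def sets)
    then show ?thesis using fin by (rule le_less_trans)
  qed
  have Y1: "y \<le> 1" if "y \<in> Y" for y using that f(2) by (auto simp: Y_def)
  have yr: "y = ennreal (enn2real y)" "enn2real y \<le> 1" if "y \<in> Y" for y
    using le_less_trans[OF Y1[OF that], of top] Y1[OF that] by (auto intro!: ennreal_enn2real[symmetric] enn2real_leI)
  let ?N = "\<lambda>\<omega>. counting {i. enat i < n \<omega>} (\<lambda>i. x i \<omega>)"
  define K where "K y \<omega> = nat_count (emeasure (?N \<omega>) (A y))" for y \<omega>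
  define L where "L \<omega> = (\<Prod>y\<in>Y. ennreal ((1 - enn2real y) ^ K y \<omega>))" for \<omega>
  have K_AE: "AE \<omega> in M. \<forall>y\<in>Y. emeasure (?N \<omega>) (A y) = of_nat (K y \<omega>)"
    unfolding K_def using Y
    by (intro AE_finite_allI poisson_count_finite(1)[OF N]) (use A_fin in \<open>auto simp: sets\<close>)
  \<comment> \<open>Once all points in the support of \<open>f\<close> have been met, the product is the one over the level sets.\<close>
  have limit: "(\<lambda>m. ?P m \<omega>) \<longlonglongrightarrow> L \<omega>"
    if K: "\<forall>y\<in>Y. emeasure (?N \<omega>) (A y) = of_nat (K y \<omega>)" for \<omega>
  proof -
    define F where "F y = {i. enat i < n \<omega> \<and> x i \<omega> \<in> A y}" for y
    have F: "finite (F y) \<and> card (F y) = K y \<omega>" if "y \<in> Y" for y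
    proof -
      have "(if finite (F y) then of_nat (card (F y)) else \<infinity>) = (of_nat (K y \<omega>) :: ennreal)"
        using K that emeasure_counting[OF A_sets, of "{i. enat i < n \<omega>}" "\<lambda>i. x i \<omega>" y] by (simp add: F_def)
      then show ?thesis by (auto split: if_splits)
    qed
    define G where "G = (\<Union>y\<in>Y. F y)"
    have G: "finite G" using F Y by (auto simp: G_def)
    have f_G: "f (x i \<omega>) = 0" if "enat i < n \<omega>" "i \<notin> G" for i
      using that by (auto simp: G_def F_def A_def Y_def)
    have "?P m \<omega> = L \<omega>" if m: "G \<subseteq> {..<m}" for m
    proof -
      have "?P m \<omega> = (\<Prod>i\<in>G. if enat i < n \<omega> then 1 - f (x i \<omega>) else 1)"
        using m f_G by (intro prod.mono_neutral_right) auto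
      also have "\<dots> = (\<Prod>y\<in>Y. \<Prod>i\<in>F y. if enat i < n \<omega> then 1 - f (x i \<omega>) else 1)"
        unfolding G_def using Y F by (intro prod.UNION_disjoint) (auto simp: F_def A_def)
      also have "\<dots> = (\<Prod>y\<in>Y. \<Prod>i\<in>F y. 1 - y)"
        by (intro prod.cong) (auto simp: F_def A_def)
      also have "\<dots> = L \<omega>"
        unfolding L_def
      proof (rule prod.cong)
        fix y assume y: "y \<in> Y"
        have "1 - y = ennreal (1 - enn2real y)"
          using yr[OF y] by (metis ennreal_1 ennreal_minus enn2real_nonneg)
        then show "(\<Prod>i\<in>F y. 1 - y) = ennreal ((1 - enn2real y) ^ K y \<omega>)"
          using F[OF y] yr[OF y] by (simp add: ennreal_power)
      qed simp
      finally show ?thesis .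
    qed note eq = this
    obtain m0 where "\<forall>i\<in>G. i < m0" using G finite_nat_set_iff_bounded by blast
    then have "eventually (\<lambda>m. ?P m \<omega> = L \<omega>) sequentially"
      by (intro eventually_sequentiallyI[of m0] eq) auto
    then show ?thesis by (rule tendsto_eventually)
  qed
  have "(\<lambda>m. \<integral>\<^sup>+\<omega>. ?P m \<omega> \<partial>M) \<longlonglongrightarrow> (\<integral>\<^sup>+\<omega>. L \<omega> \<partial>M)"
  proof (rule nn_integral_dominated_convergence[where w="\<lambda>_. 1"])
    show "AE \<omega> in M. ?P m \<omega> \<le> 1" for m
    proof (rule AE_I2)
      fix \<omega>
      show "?P m \<omega> \<le> 1"
      proof (induction m)
        case (Suc m)
        have "(if enat m < n \<omega> then 1 - f (x m \<omega>) else 1) \<le> 1" by (simp add: diff_le_self_ennreal)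
        with Suc show ?case using mult_mono[OF Suc, of "if enat m < n \<omega> then 1 - f (x m \<omega>) else 1" 1] by simp
      qed simp
    qed
    show "AE \<omega> in M. (\<lambda>m. ?P m \<omega>) \<longlonglongrightarrow> L \<omega>"
      using K_AE by eventually_elim (rule limit)
    have [measurable]: "(\<lambda>\<omega>. emeasure (?N \<omega>) (A y)) \<in> borel_measurable M" for y
      using N by (auto simp: poisson_random_measure_def sets)
    show "L \<in> borel_measurable M" unfolding L_def K_def by measurable
  qed (simp_all add: emeasure_space_1)
  also have "(\<integral>\<^sup>+\<omega>. L \<omega> \<partial>M) = (\<integral>\<^sup>+\<omega>. (\<Prod>j<card Y. ennreal ((1 - enn2real (e j)) ^ K (e j) \<omega>)) \<partial>M)"
    unfolding L_def by (simp add: prod.reindex_bij_betw[OF e, symmetric])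
  also have "\<dots> = (\<Prod>j<card Y. \<integral>\<^sup>+\<omega>. ennreal ((1 - enn2real (e j)) ^ K (e j) \<omega>) \<partial>M)"
  proof (rule indep_vars_nn_integral)
    have inj: "inj_on e {..<card Y}" using e by (rule bij_betw_imp_inj_on)
    have "disjoint_family_on (\<lambda>j. A (e j)) {..<card Y}"
      using inj by (auto simp: disjoint_family_on_def A_def inj_on_def)
    then have "indep_vars (\<lambda>_. borel) (\<lambda>j \<omega>. emeasure (?N \<omega>) (A (e j))) {..<card Y}"
      using N[unfolded poisson_random_measure_def] by (auto simp: sets)
    then show "indep_vars (\<lambda>_. borel) (\<lambda>j \<omega>. ennreal ((1 - enn2real (e j)) ^ K (e j) \<omega>)) {..<card Y}"
      unfolding K_def by (rule indep_vars_compose2[where Y="\<lambda>j t. ennreal ((1 - enn2real (e j)) ^ nat_count t)"]) measurable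
  qed simp_all
  also have "\<dots> = (\<Prod>y\<in>Y. \<integral>\<^sup>+\<omega>. ennreal ((1 - enn2real y) ^ K y \<omega>) \<partial>M)"
    by (rule prod.reindex_bij_betw[OF e])
  also have "\<dots> = (\<Prod>y\<in>Y. ennreal (exp (- enn2real y * measure \<mu> (A y))))"
    unfolding K_def using yr A_fin by (intro prod.cong poisson_count_finite(2)[OF N]) (auto simp: sets)
  also have "\<dots> = ennreal (exp (- (\<Sum>y\<in>Y. enn2real y * measure \<mu> (A y))))"
    by (simp add: prod_ennreal exp_sum[OF Y, symmetric] sum_negf)
  also have "(\<Sum>y\<in>Y. enn2real y * measure \<mu> (A y)) = enn2real (integral\<^sup>S \<mu> f)"
  proof -
    have "integral\<^sup>S \<mu> f = (\<Sum>y\<in>f ` UNIV. y * emeasure \<mu> (A y))"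
      by (simp add: simple_integral_def space A_def)
    also have "\<dots> = (\<Sum>y\<in>Y. y * emeasure \<mu> (A y))"
      using f(1) by (intro sum.mono_neutral_right) (auto simp: Y_def simple_function_def space)
    also have "\<dots> = (\<Sum>y\<in>Y. ennreal (enn2real y * measure \<mu> (A y)))"
    proof (rule sum.cong)
      fix y assume y: "y \<in> Y"
      have "emeasure \<mu> (A y) = ennreal (measure \<mu> (A y))"
        using A_fin[OF y] by (intro emeasure_eq_ennreal_measure) auto
      then show "y * emeasure \<mu> (A y) = ennreal (enn2real y * measure \<mu> (A y))"
        using yr(1)[OF y] by (simp add: ennreal_mult)
    qed simp
    also have "\<dots> = ennreal (\<Sum>y\<in>Y. enn2real y * measure \<mu> (A y))"
      by (rule sum_ennreal) simp
    finally show ?thesis by (simp add: sum_nonneg)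
  qed
  finally show ?thesis .
qed

text \<open>Approximate \<open>g\<close> on \<open>B\<close> from below by a simple function whose integral still exceeds \<open>c\<close>.\<close>

lemma poisson_void_bound:
  fixes x :: "nat \<Rightarrow> 'a \<Rightarrow> 'b::euclidean_space" and g :: "'b \<Rightarrow> ennreal"
  assumes N: "poisson_random_measure M \<mu> (\<lambda>\<omega>. counting {i. enat i < n \<omega>} (\<lambda>i. x i \<omega>))"
    and sets: "sets \<mu> = sets borel"
    and nx: "n \<in> M \<rightarrow>\<^sub>M count_space UNIV" "\<And>i. x i \<in> borel_measurable M"
    and g: "\<And>y. g y \<le> 1"
    and B: "B \<in> sets borel" "emeasure \<mu> B < \<infinity>"
    and c: "ennreal c < (\<integral>\<^sup>+y. g y * indicator B y \<partial>\<mu>)" "0 \<le> c"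
    and q: "\<And>m. q \<le> (\<integral>\<^sup>+\<omega>. (\<Prod>i<m. if enat i < n \<omega> then 1 - g (x i \<omega>) else 1) \<partial>M)"
  shows "q \<le> ennreal (exp (- c))"
proof -
  obtain f where f: "simple_function \<mu> f" "f \<le> (\<lambda>y. g y * indicator B y)" "ennreal c < integral\<^sup>S \<mu> f"
    using c(1) unfolding nn_integral_def less_SUP_iff by auto
  have fg: "f y \<le> g y" "f y \<noteq> 0 \<Longrightarrow> y \<in> B" for y
    using f(2)[THEN le_funD, of y] by (cases "y \<in> B"; simp)+
  have f1: "f y \<le> 1" for y using fg(1) g by (rule order_trans)
  have fin: "emeasure \<mu> {y. f y \<noteq> 0} < \<infinity>"
  proof -
    have "emeasure \<mu> {y. f y \<noteq> 0} \<le> emeasure \<mu> B"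
      using B(1) fg(2) by (intro emeasure_mono) (auto simp: sets)
    then show ?thesis using B(2) by (rule le_less_trans)
  qed
  have "integral\<^sup>S \<mu> f \<le> emeasure \<mu> B"
  proof -
    have "integral\<^sup>S \<mu> f = (\<integral>\<^sup>+y. f y \<partial>\<mu>)" using f(1) by (simp add: nn_integral_eq_simple_integral)
    also have "\<dots> \<le> (\<integral>\<^sup>+y. indicator B y \<partial>\<mu>)"
      using fg f1 by (intro nn_integral_mono) (force simp: indicator_def)
    finally show ?thesis using B by (simp add: sets)
  qed
  then have "integral\<^sup>S \<mu> f < \<infinity>" using B(2) by (rule le_less_trans)
  then have c_le: "c \<le> enn2real (integral\<^sup>S \<mu> f)"
    using f(3) c(2) by (cases "integral\<^sup>S \<mu> f") (auto simp: ennreal_less_iff)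
  have "q \<le> (\<integral>\<^sup>+\<omega>. (\<Prod>i<m. if enat i < n \<omega> then 1 - f (x i \<omega>) else 1) \<partial>M)" for m
  proof (rule order_trans[OF q nn_integral_mono])
    fix \<omega>
    show "(\<Prod>i<m. if enat i < n \<omega> then 1 - g (x i \<omega>) else 1) \<le> (\<Prod>i<m. if enat i < n \<omega> then 1 - f (x i \<omega>) else 1)"
      by (induction m) (auto intro!: mult_mono ennreal_minus_mono fg)
  qed
  then have "q \<le> ennreal (exp (- enn2real (integral\<^sup>S \<mu> f)))"
    by (intro LIMSEQ_le_const[OF poisson_simple_function[OF N sets nx f(1) f1 fin]]) auto
  also have "\<dots> \<le> ennreal (exp (- c))" using c_le by (intro ennreal_leI) simp
  finally show ?thesis .
qed

end

section \<open>Absence of local extinction\<close>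

context branching_particle_system
begin

text \<open>A particle born in the unit ball at time \<open>t\<close> is alive at time \<open>t\<close> and has not moved yet. If the
  ball is empty from time \<open>T\<close> on, no birth of an existing particle can therefore be marked.\<close>

lemma avoidance_eq_1_if_ball_empty:
  assumes regular: "\<And>u. 0 < lifetime u \<omega> \<and> motion u 0 \<omega> = 0"
    and disp: "\<And>u. displacement u \<omega> = motion u (lifetime u \<omega>) \<omega>"
    and empty: "\<And>t. T \<le> t \<Longrightarrow> emeasure (particles_at n x motion lifetime offspring t \<omega>) (cball 0 1) = 0"
    and exists: "exists_particle (n \<omega>) (\<lambda>u. offspring u \<omega>) u"
  shows "avoidance (window \<theta> T S) g u (birth_time (\<lambda>u. lifetime u \<omega>) u,
      birth_place (\<lambda>i. x i \<omega>) (\<lambda>u s. motion u s \<omega>) (\<lambda>u. lifetime u \<omega>) u) \<omega> = 1"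
  using exists
proof (induction g arbitrary: u)
  case (Suc g)
  let ?L = "\<lambda>u. lifetime u \<omega>"
  let ?X = "\<lambda>i. x i \<omega>" and ?m = "\<lambda>u s. motion u s \<omega>"
  let ?t = "birth_time ?L u" and ?y = "birth_place ?X ?m ?L u"
  have "window \<theta> T S (?t, ?y) = 0"
  proof (rule ccontr)
    assume "window \<theta> T S (?t, ?y) \<noteq> 0"
    then have t: "T \<le> ?t" and y: "?y \<in> cball 0 1" by (auto simp: window_def indicator_def split: if_splits)
    let ?I = "alive_at (n \<omega>) ?L (\<lambda>u. offspring u \<omega>) ?t"
    let ?U = "{w \<in> ?I. position_at ?X ?m ?L ?t w \<in> cball 0 1}"
    have "u \<in> ?U"
      using Suc.prems regular[of u] y by (simp add: alive_at_def position_at_def)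
    then have "(if finite ?U then of_nat (card ?U) else \<infinity>) \<noteq> (0::ennreal)" by auto
    then show False
      using empty[OF t] unfolding particles_at_def by (subst (asm) emeasure_counting) auto
  qed
  moreover have "avoidance (window \<theta> T S) g (Child u k) (?t + lifetime u \<omega>, ?y + displacement u \<omega>) \<omega> = 1"
    if "k < offspring u \<omega>" for k
    using Suc.IH[of "Child u k"] Suc.prems that by (simp add: disp)
  ultimately show ?case by simp
qed simp

lemma measurable_number_info:
  assumes "Initial \<in> I"
  shows "n \<in> info I \<rightarrow>\<^sub>M count_space UNIV"
  using measurable_compose[OF measurable_initial[OF assms] measurable_fst] by simp

lemma measurable_initial_point_info:
  assumes "Initial \<in> I"
  shows "x i \<in> info I \<rightarrow>\<^sub>M borel"
proof -
  have "(\<lambda>w. snd w i) \<in> count_space UNIV \<Otimes>\<^sub>M (\<Pi>\<^sub>M i\<in>UNIV. borel) \<rightarrow>\<^sub>M (borel :: 'a measure)"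
    by (rule measurable_compose[OF measurable_snd measurable_component_singleton]) simp
  from measurable_compose[OF measurable_initial[OF assms] this] show ?thesis by simp
qed

text \<open>Given the initial configuration, the families of the initial particles use disjoint sources.\<close>

lemma expectation_avoidance_initial:
  assumes a [measurable]: "a \<in> borel_measurable (borel \<Otimes>\<^sub>M borel)" and a01: "\<And>z. 0 \<le> a z" "\<And>z. a z \<le> 1"
    and pos: "0 < \<alpha>" "0 < \<beta>" "0 < V"
  shows "(\<integral>\<^sup>+\<omega>. (\<Prod>i<m. if enat i < n \<omega> then avoidance a g (Root i) (0, x i \<omega>) \<omega> else 1) \<partial>M)
    \<le> (\<integral>\<^sup>+\<omega>. (\<Prod>i<m. if enat i < n \<omega> then 1 - ennreal (stable_semigroup.mark_prob motion_law V \<beta> a g (0, x i \<omega>)) else 1) \<partial>M)"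
proof -
  interpret stable_semigroup motion_law \<alpha> by (rule stable_semigroup_motion_law[OF pos(1)])
  let ?I = "{Initial}" and ?J = "sources_of UNIV"
  have [measurable]: "n \<in> info ?I \<rightarrow>\<^sub>M count_space UNIV" "x i \<in> info ?I \<rightarrow>\<^sub>M borel" for i
    by (auto intro: measurable_number_info measurable_initial_point_info)
  have meas: "(\<lambda>q. avoidance a g (Root i) (0, x i (fst q)) (snd q)) \<in> borel_measurable (info ?I \<Otimes>\<^sub>M info ?J)" for i
  proof -
    have [measurable]: "(\<lambda>q. snd q) \<in> info ?I \<Otimes>\<^sub>M info ?J \<rightarrow>\<^sub>M info (sources_of {w. descends (Root i) w})"
      by (intro measurable_compose[OF measurable_snd measurable_info_mono] sources_of_mono) auto
    have "(\<lambda>q. ((0, x i (fst q)), snd q)) \<in> info ?I \<Otimes>\<^sub>M info ?J \<rightarrow>\<^sub>M (borel \<Otimes>\<^sub>M borel) \<Otimes>\<^sub>M info (sources_of {w. descends (Root i) w})"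
      by measurable
    from measurable_compose[OF this measurable_avoidance[OF a]] show ?thesis by simp
  qed
  have "(\<integral>\<^sup>+\<omega>. (\<Prod>i<m. if enat i < n \<omega> then avoidance a g (Root i) (0, x i \<omega>) \<omega> else 1) \<partial>M)
    = (\<integral>\<^sup>+\<omega>. \<integral>\<^sup>+\<omega>'. (\<Prod>i<m. if enat i < n \<omega> then avoidance a g (Root i) (0, x i \<omega>) \<omega>' else 1) \<partial>M \<partial>M)"
  proof (rule decouple[where I="?I" and J="?J"])
    have "(\<lambda>q. \<Prod>i<m. if enat i < n (fst q) then avoidance a g (Root i) (0, x i (fst q)) (snd q) else 1) \<in> borel_measurable (info ?I \<Otimes>\<^sub>M info ?J)"
      using meas by measurable
    then show "(\<lambda>(\<omega>, \<omega>'). \<Prod>i<m. if enat i < n \<omega> then avoidance a g (Root i) (0, x i \<omega>) \<omega>' else 1) \<in> borel_measurable (info ?I \<Otimes>\<^sub>M info ?J)"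
      by (simp add: split_beta')
  qed (auto simp: sources_of_def)
  also have "\<dots> \<le> (\<integral>\<^sup>+\<omega>. (\<Prod>i<m. if enat i < n \<omega> then 1 - ennreal (mark_prob V \<beta> a g (0, x i \<omega>)) else 1) \<partial>M)"
  proof (rule nn_integral_mono)
    fix \<omega>
    let ?f = "\<lambda>i \<omega>'. if enat i < n \<omega> then avoidance a g (Root i) (0, x i \<omega>) \<omega>' else 1"
    have "(\<integral>\<^sup>+\<omega>'. (\<Prod>i<m. ?f i \<omega>') \<partial>M) = (\<Prod>i<m. \<integral>\<^sup>+\<omega>'. ?f i \<omega>' \<partial>M)"
    proof (rule expectation_prod_disjoint[where J="\<lambda>i. sources_of {w. descends (Root i) w}"])
      show "?f i \<in> borel_measurable (info (sources_of {w. descends (Root i) w}))" for i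
        using measurable_avoidance_fixed[OF a] by (cases "enat i < n \<omega>") auto
    qed (auto intro!: sources_of_disjoint dest: descends_Root)
    also have "\<dots> \<le> (\<Prod>i<m. if enat i < n \<omega> then 1 - ennreal (mark_prob V \<beta> a g (0, x i \<omega>)) else 1)"
    proof (induction m)
      case (Suc m)
      have "(\<integral>\<^sup>+\<omega>'. avoidance a g (Root m) (0, x m \<omega>) \<omega>' \<partial>M) \<le> 1 - ennreal (mark_prob V \<beta> a g (0, x m \<omega>))"
        using expectation_avoidance[OF a a01 pos, of g "Root m" "(0, x m \<omega>)"] mark_prob_bounds[OF pos(3,2), of a g "(0, x m \<omega>)"] a01
        by (metis ennreal_1 ennreal_minus)
      with Suc show ?case by (auto intro!: mult_mono simp: emeasure_space_1)
    qed simp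
    finally show "(\<integral>\<^sup>+\<omega>'. (\<Prod>i<m. ?f i \<omega>') \<partial>M) \<le> \<dots>" .
  qed
  finally show ?thesis .
qed

lemma extinction_prob_bound:
  assumes pos: "0 < \<alpha>" "0 < \<beta>" "0 < V" and \<theta>: "0 \<le> \<theta>" "\<theta> \<le> 1"
    and E: "E \<in> events" "AE \<omega> in M. \<omega> \<in> E \<longrightarrow> (\<forall>t\<ge>T. emeasure (particles_at n x motion lifetime offspring t \<omega>) (cball 0 1) = 0)"
    and c: "0 \<le> c" "ennreal c < (\<integral>\<^sup>+y. ennreal (stable_semigroup.mark_prob motion_law V \<beta> (window \<theta> T S) g (0, y)) * indicator (cball 0 R) y \<partial>initial_intensity \<gamma>)"
  shows "prob E \<le> exp (- c)"
proof -
  interpret stable_semigroup motion_law \<alpha> by (rule stable_semigroup_motion_law[OF pos(1)])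
  let ?a = "window \<theta> T S"
  have a: "0 \<le> ?a z" "?a z \<le> 1" for z :: "real \<times> 'a"
    using \<theta> by (auto simp: window_def indicator_def)
  have "emeasure M E \<le> ennreal (exp (- c))"
  proof (rule poisson_void_bound[OF poisson_initial _ measurable_initial_number measurable_initial_points])
    show "sets (initial_intensity \<gamma> :: 'a measure) = sets borel" by (simp add: initial_intensity_def)
    show "emeasure (initial_intensity \<gamma>) (cball (0::'a) R) < \<infinity>"
    proof -
      have "emeasure (initial_intensity \<gamma>) (cball (0::'a) R) =
          (\<integral>\<^sup>+y. ennreal (1 / (1 + norm y powr \<gamma>)) * indicator (cball (0::'a) R) y \<partial>lborel)"
        unfolding initial_intensity_def by (rule emeasure_density) simp_all
      also have "\<dots> \<le> (\<integral>\<^sup>+y. 1 * indicator (cball (0::'a) R) y \<partial>lborel)"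
      proof (intro nn_integral_mono mult_right_mono)
        fix y :: 'a
        have "1 / (1 + norm y powr \<gamma>) \<le> 1" by (simp add: divide_le_eq add_pos_nonneg)
        then show "ennreal (1 / (1 + norm y powr \<gamma>)) \<le> 1" by simp
      qed simp
      finally have "emeasure (initial_intensity \<gamma>) (cball (0::'a) R) \<le> (\<integral>\<^sup>+y. indicator (cball (0::'a) R) y \<partial>lborel)"
        by simp
      then show ?thesis using emeasure_lborel_cball_finite[of "0::'a" R] by (simp add: le_less_trans)
    qed
    show "ennreal (mark_prob V \<beta> ?a g (0, y)) \<le> 1" for y
      using mark_prob_bounds(2)[OF pos(3,2), of ?a g "(0, y)"] a by simp
    fix m
    have "emeasure M E = (\<integral>\<^sup>+\<omega>. indicator E \<omega> \<partial>M)" using E by simp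
    also have "\<dots> \<le> (\<integral>\<^sup>+\<omega>. (\<Prod>i<m. if enat i < n \<omega> then avoidance ?a g (Root i) (0, x i \<omega>) \<omega> else 1) \<partial>M)"
    proof (rule nn_integral_mono_AE, use E(2) AE_trajectory_regular AE_displacement in eventually_elim)
      case (elim \<omega>)
      have "avoidance ?a g (Root i) (0, x i \<omega>) \<omega> = 1" if "\<omega> \<in> E" "enat i < n \<omega>" for i
        using avoidance_eq_1_if_ball_empty[of \<omega> T "Root i" \<theta> S g] elim that by simp
      then have "(\<Prod>i<m. if enat i < n \<omega> then avoidance ?a g (Root i) (0, x i \<omega>) \<omega> else 1) = (\<Prod>i<m. 1)" if "\<omega> \<in> E"
        using that by (intro prod.cong) auto
      then show ?case by (auto simp: indicator_def)
    qed
    also have "\<dots> \<le> (\<integral>\<^sup>+\<omega>. (\<Prod>i<m. if enat i < n \<omega> then 1 - ennreal (mark_prob V \<beta> ?a g (0, x i \<omega>)) else 1) \<partial>M)"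
      by (rule expectation_avoidance_initial[OF measurable_window a pos])
    finally show "emeasure M E \<le> \<dots>" .
  qed (use c in auto)
  then show ?thesis by (simp add: emeasure_eq_measure)
qed

end

theorem corollary2p10:
  fixes M :: "'w measure"
    and \<alpha> \<beta> \<gamma> V :: real
    and n :: "'w \<Rightarrow> enat"
    and x :: "nat \<Rightarrow> 'w \<Rightarrow> 'a::euclidean_space"
    and motion :: "label \<Rightarrow> real \<Rightarrow> 'w \<Rightarrow> 'a"
    and lifetime :: "label \<Rightarrow> 'w \<Rightarrow> real"
    and offspring :: "label \<Rightarrow> 'w \<Rightarrow> nat"
  assumes "0 < \<alpha>" and "\<alpha> \<le> 2"
    and "0 < \<beta>" and "\<beta> \<le> 1"
    and "0 \<le> \<gamma>"
    and "0 < V"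
    and "branching_particle_system M \<alpha> \<beta> \<gamma> V n x motion lifetime offspring"
    and "\<gamma> < \<alpha>"
    and "real DIM('a) \<ge> \<alpha> / \<beta> + \<gamma>"
  shows "\<not> as_local_extinction M (particles_at n x motion lifetime offspring)"
proof
  interpret branching_particle_system M \<alpha> \<beta> \<gamma> V n x motion lifetime offspring by fact
  interpret stable_semigroup motion_law \<alpha> by (rule stable_semigroup_motion_law) fact
  assume "as_local_extinction M (particles_at n x motion lifetime offspring)"
  moreover have "cball (0::'a) 1 \<in> sets borel" "bounded (cball (0::'a) 1)" by auto
  ultimately obtain \<tau> where \<tau> [measurable]: "\<tau> \<in> borel_measurable M"
    and empty: "AE \<omega> in M. \<forall>t\<ge>\<tau> \<omega>. emeasure (particles_at n x motion lifetime offspring t \<omega>) (cball 0 1) = 0"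
    unfolding as_local_extinction_def by meson
  obtain m where m: "0 < m" and mass: "\<And>T. 1 \<le> T \<Longrightarrow> \<exists>\<theta> R g. 0 < \<theta> \<and> \<theta> \<le> 1 \<and>
      ennreal m \<le> (\<integral>\<^sup>+x. ennreal (mark_prob V \<beta> (window \<theta> T (2 * T)) g (0, x)) * indicator (cball 0 R) x \<partial>initial_intensity \<gamma>)"
    using marked_mass_bounded_below[OF \<open>0 < V\<close> \<open>0 < \<beta>\<close> \<open>\<beta> \<le> 1\<close> \<open>0 \<le> \<gamma>\<close> \<open>\<gamma> < \<alpha>\<close> \<open>\<alpha> / \<beta> + \<gamma> \<le> real DIM('a)\<close>]
    by blast
  \<comment> \<open>The mass estimate needs windows starting at time 1 or later, hence the successor.\<close>
  define E where "E k = {\<omega> \<in> space M. \<tau> \<omega> \<le> real (Suc k)}" for k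
  have E [measurable]: "E k \<in> events" for k unfolding E_def by measurable
  have bound: "prob (E k) \<le> exp (- (m / 2))" for k
  proof -
    obtain \<theta> R g where \<theta>: "0 < \<theta>" "\<theta> \<le> 1" and low: "ennreal m \<le>
      (\<integral>\<^sup>+x. ennreal (mark_prob V \<beta> (window \<theta> (Suc k) (2 * Suc k)) g (0, x)) * indicator (cball 0 R) x \<partial>initial_intensity \<gamma>)"
      using mass[of "real (Suc k)"] by auto
    have "ennreal (m / 2) < ennreal m" using m by (simp add: ennreal_less_iff)
    then have "ennreal (m / 2) < (\<integral>\<^sup>+x. ennreal (mark_prob V \<beta> (window \<theta> (Suc k) (2 * Suc k)) g (0, x)) * indicator (cball 0 R) x \<partial>initial_intensity \<gamma>)"
      using low by (rule less_le_trans)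
    then show ?thesis
      using m \<theta> empty
      by (intro extinction_prob_bound[OF \<open>0 < \<alpha>\<close> \<open>0 < \<beta>\<close> \<open>0 < V\<close> _ _ E]) (auto simp: E_def elim!: eventually_mono)
  qed
  have "(\<lambda>k. prob (E k)) \<longlonglongrightarrow> prob (\<Union>k. E k)"
    by (rule finite_Lim_measure_incseq) (auto simp: incseq_def E_def)
  moreover have "(\<Union>k. E k) = space M"
  proof -
    have "\<exists>k. \<tau> \<omega> \<le> real (Suc k)" for \<omega>
    proof -
      obtain k where "\<tau> \<omega> \<le> real k" using real_arch_simple by blast
      then have "\<tau> \<omega> \<le> real (Suc k)" by simp
      then show ?thesis ..
    qed
    then show ?thesis by (auto simp: E_def)
  qed
  ultimately have "(\<lambda>k. prob (E k)) \<longlonglongrightarrow> 1" by (simp add: prob_space)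
  then have "1 \<le> exp (- (m / 2))"
    by (rule LIMSEQ_le_const2) (use bound in auto)
  then show False using m by simp
qed

end
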